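(* Let $R:S^1\to\mathbb{R}$ satisfy the standing assumptions in the context. Assume that the equation $q^2=R(y)$ has a solution for some non-negative integer $q$, and that the set $\mathcal{P}$ defined in the context has the property: if $p\in\mathcal{P}$, then $\mathcal{P}$ contains no factors (positive divisors) of $p$ smaller than $p/2$. Then each of the maps $\eta_p:\Phi\to\Phi^*$ ($p\in\mathcal{P}$ odd) and $\eta_{p\epsilon}:\Phi\to\Phi^*$ ($p\in\mathcal{P}$ even, $\epsilon\in\{1,-1\}$, with $Y_{p\epsilon}(q)\ne\emptyset$ for some $q$) defined in the context is a rigging map with nontrivial, finite-dimensional image, and the images of any two distinct maps among these have trivial intersection in $\Phi^*$.
   Context: $S^1=\mathbb{R}/2\pi\mathbb{Z}$, and $\mathcal{C}=S^1\times S^1$ has coordinates $(x,y)$. Standing assumptions on $R:S^1\to\mathbb{R}$: $R$ is smooth, is positive somewhere, has at most finitely many stationary points (points with $R'=0$), at each stationary point some derivative of $R$ (of order $\ge 1$) is nonvanishing, and no zero of $R$ is a stationary point. $\mathcal{H}_{\mathrm{aux}}=L^2(\mathcal{C},dx\,dy)$ with inner product $(\phi_1,\phi_2)_{\mathrm{aux}}=\int dx\,dy\,\overline{\phi_1}\phi_2$. The constraint operator $\hat C=-\partial^2/\partial x^2-R(y)$ is essentially self-adjoint, and $U(t):=e^{-it\hat C}$, $t\in\mathbb{R}$. The test space $\Phi\subset\mathcal{H}_{\mathrm{aux}}$ is the dense subspace of functions $f(x,y)=\sum_{m\in\mathbb{Z}}e^{imx}f_m(y)$ with each $f_m:S^1\to\mathbb{C}$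 smooth and only finitely many $f_m$ nonzero. It is invariant under $U(t)$: $(U(t)f)(x,y)=\sum_m e^{-it[m^2-R(y)]}e^{imx}f_m(y)$. $\Phi^*$ is the algebraic dual of $\Phi$; $\xi[g]$ denotes the action of $\xi\in\Phi^*$ on $g\in\Phi$. $\mathcal{A}_{\mathrm{obs}}$ is the algebra of (linear, densely defined) operators $\mathcal{O}$ on $\mathcal{H}_{\mathrm{aux}}$ such that the domains of $\mathcal{O}$ and its adjoint $\mathcal{O}^\dagger$ include $\Phi$, both $\mathcal{O}$ and $\mathcal{O}^\dagger$ map $\Phi$ into $\Phi$, and $\mathcal{O}$ commutes with $U(t)$ on $\Phi$ for all $t\in\mathbb{R}$. A rigging map is an antilinear map $\eta:\Phi\to\Phi^*$ that is (i) real: $\eta(f)[g]=\overline{\eta(g)[f]}$; (ii) positive: $\eta(f)[f]\ge0$; (iii) has $U(t)$-invariant image: $\eta(f)[U(t)g]=\eta(f)[g]$ for all $t\in\mathbb{R}$; (iv) intertwining: $\eta(\mathcal{O}f)[g]=\eta(f)[\mathcal{O}^\dagger g]$ for all $\mathcal{O}\in\mathcal{A}_{\mathrm{obs}}$; all for all $f,g\in\Phi$. For a non-negative integer $q$ and a solution $y$ of $q^2=R(y)$, let $p\ge1$ be the order of the lowest nonvanishing derivative (of order $\ge1$) of $R$ at $y$. For odd $p$, $Y_p(q)$ is the (finite) set of solutions of $q^2=R(y)$ with this order $p$. For even $p$ and $\epsilon\in\{1,-1\}$, $Y_{p\epsilon}(q)$ is the (finite) set of solutions of $q^2=R(y)$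 with this order $p$ and with $R^{(p)}(y)$ of sign $\epsilon$. $\mathcal{P}$ is the set of all orders $p$ occurring for solutions of $q^2=R(y)$, over all non-negative integers $q$. For $f,g\in\Phi$, $$\eta_p(f)[g]=(2\pi)^2\sum_{m\in\mathbb{Z}}\sum_{y\in Y_p(|m|)}\frac{\overline{f_m(y)}\,g_m(y)}{|R^{(p)}(y)|^{1/p}}\quad(p\text{ odd}),\qquad \eta_{p\epsilon}(f)[g]=(2\pi)^2\sum_{m\in\mathbb{Z}}\sum_{y\in Y_{p\epsilon}(|m|)}\frac{\overline{f_m(y)}\,g_m(y)}{|R^{(p)}(y)|^{1/p}}\quad(p\text{ even}).$$ *)

theory Defs
  imports
    "HOL-Analysis.Analysis"
    "HOL-Library.Function_Algebras"
    "HOL-Library.Nonpos_Ints"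
begin

text \<open>
  Functions on the circle \<open>S\<^sup>1 = \<real> / 2\<pi>\<int>\<close> are \<open>2\<pi>\<close>-periodic functions on \<open>real\<close>, and points of the
  circle are represented by their representatives in \<open>{0..<2 * pi}\<close>.
\<close>

definition nth_deriv :: "nat \<Rightarrow> (real \<Rightarrow> 'a::real_normed_vector) \<Rightarrow> real \<Rightarrow> 'a" where
  "nth_deriv n h = ((\<lambda>g y. vector_derivative g (at y)) ^^ n) h"

definition smooth_circle :: "(real \<Rightarrow> 'a::real_normed_vector) \<Rightarrow> bool" where
  "smooth_circle h \<longleftrightarrow>
     (\<forall>y. h (y + 2 * pi) = h y) \<and> (\<forall>n y. nth_deriv n h differentiable (at y))"

definition standing_assumptions :: "(real \<Rightarrow> real) \<Rightarrow> bool" where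
  "standing_assumptions R \<longleftrightarrow>
     smooth_circle R \<and>
     (\<exists>y. R y > 0) \<and>
     finite {y \<in> {0..<2 * pi}. nth_deriv 1 R y = 0} \<and>
     (\<forall>y. nth_deriv 1 R y = 0 \<longrightarrow> (\<exists>k\<ge>1. nth_deriv k R y \<noteq> 0)) \<and>
     (\<forall>y. R y = 0 \<longrightarrow> nth_deriv 1 R y \<noteq> 0)"


subsection \<open>The auxiliary Hilbert space\<close>

text \<open>
  Elements of \<open>L\<^sup>2(S\<^sup>1 \<times> S\<^sup>1)\<close> are represented by square-integrable functions; only the values on the
  fundamental domain matter, and equality of vectors is almost-everywhere equality there.
\<close>

type_synonym wavefun = "real \<times> real \<Rightarrow> complex"

definition torus :: "(real \<times> real) measure" where
  "torus = restrict_space lborel ({0..<2 * pi} \<times> {0..<2 * pi})"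

definition H_aux :: "wavefun set" where
  "H_aux = {f \<in> borel_measurable torus. integrable torus (\<lambda>z. (cmod (f z))\<^sup>2)}"

definition ae_eq :: "wavefun \<Rightarrow> wavefun \<Rightarrow> bool" where
  "ae_eq f g \<longleftrightarrow> (AE z in torus. f z = g z)"

definition inner_aux :: "wavefun \<Rightarrow> wavefun \<Rightarrow> complex" where
  "inner_aux f g = (LINT z|torus. cnj (f z) * g z)"

text \<open>
  Unbounded operators are given by their graphs. As vectors are classes of functions, a graph is
  closed under almost-everywhere modification and single-valued up to almost-everywhere equality.
\<close>

definition linear_operator :: "(wavefun \<times> wavefun) set \<Rightarrow> bool" where
  "linear_operator A \<longleftrightarrow>
     A \<subseteq> H_aux \<times> H_aux \<and>
     (0, 0) \<in> A \<and>
     (\<forall>f h f' h'. (f, h) \<in> A \<longrightarrow> (f', h') \<in> A \<longrightarrow> (f + f', h + h') \<in> A) \<and>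
     (\<forall>c f h. (f, h) \<in> A \<longrightarrow> ((\<lambda>z. c * f z), (\<lambda>z. c * h z)) \<in> A) \<and>
     (\<forall>f h. \<forall>f' \<in> H_aux. \<forall>h' \<in> H_aux.
        (f, h) \<in> A \<longrightarrow> ae_eq f f' \<longrightarrow> ae_eq h h' \<longrightarrow> (f', h') \<in> A) \<and>
     (\<forall>f h h'. (f, h) \<in> A \<longrightarrow> (f, h') \<in> A \<longrightarrow> ae_eq h h')"

definition densely_defined :: "(wavefun \<times> wavefun) set \<Rightarrow> bool" where
  "densely_defined A \<longleftrightarrow>
     (\<forall>f \<in> H_aux. \<forall>e>0. \<exists>h \<in> Domain A. (LINT z|torus. (cmod (f z - h z))\<^sup>2) < e)"

definition adjoint_op :: "(wavefun \<times> wavefun) set \<Rightarrow> (wavefun \<times> wavefun) set" where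
  "adjoint_op A =
     {(f, h) \<in> H_aux \<times> H_aux. \<forall>(u, v) \<in> A. inner_aux f v = inner_aux h u}"


subsection \<open>The test space and its algebraic dual\<close>

definition fourier_sum :: "int set \<Rightarrow> (int \<Rightarrow> real \<Rightarrow> complex) \<Rightarrow> wavefun" where
  "fourier_sum M c = (\<lambda>(x, y). \<Sum>m\<in>M. exp (\<i> * of_int m * of_real x) * c m y)"

definition test_space :: "wavefun set" where
  "test_space = {fourier_sum M c | M c. finite M \<and> (\<forall>m. smooth_circle (c m))}"

definition coef :: "wavefun \<Rightarrow> int \<Rightarrow> real \<Rightarrow> complex" where
  "coef f m y =
     integral {0..2 * pi} (\<lambda>x. exp (- \<i> * of_int m * of_real x) * f (x, y)) / (2 * pi)"

text \<open>
  Functionals on the test space are extended by \<open>0\<close> to all functions, so that the algebraic dual is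
  a subspace of the complex vector space of all functions \<open>wavefun \<Rightarrow> complex\<close>.
\<close>

type_synonym functional = "wavefun \<Rightarrow> complex"

global_interpretation functionals:
  vector_space "\<lambda>(c::complex) (\<xi>::functional) g. c * \<xi> g"
  by unfold_locales (auto simp: fun_eq_iff algebra_simps)

definition test_dual :: "functional set" where
  "test_dual = {\<xi>.
     (\<forall>g. g \<notin> test_space \<longrightarrow> \<xi> g = 0) \<and>
     (\<forall>g \<in> test_space. \<forall>h \<in> test_space. \<xi> (g + h) = \<xi> g + \<xi> h) \<and>
     (\<forall>c. \<forall>g \<in> test_space. \<xi> (\<lambda>z. c * g z) = c * \<xi> g)}"

definition finite_dimensional :: "functional set \<Rightarrow> bool" where
  "finite_dimensional V \<longleftrightarrow> (\<exists>B. finite B \<and> B \<subseteq> V \<and> V \<subseteq> functionals.span B)"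


subsection \<open>Evolution, observables and rigging maps\<close>

definition constraint_op :: "(real \<Rightarrow> real) \<Rightarrow> wavefun \<Rightarrow> wavefun" where
  "constraint_op R f = (\<lambda>(x, y). - nth_deriv 2 (\<lambda>s. f (s, y)) x - of_real (R y) * f (x, y))"

text \<open>
  The restriction of \<open>exp (-i t C)\<close> to the test space, where \<open>C\<close> is the closure of
  \<^const>\<open>constraint_op\<close>. The sum has only finitely many nonzero terms.
\<close>

definition evol :: "(real \<Rightarrow> real) \<Rightarrow> real \<Rightarrow> wavefun \<Rightarrow> wavefun" where
  "evol R t f = (\<lambda>(x, y). \<Sum>\<^sub>\<infinity>m\<in>(UNIV :: int set).
     exp (- \<i> * of_real (t * ((of_int m)\<^sup>2 - R y))) * exp (\<i> * of_int m * of_real x) * coef f m y)"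

definition observables :: "(real \<Rightarrow> real) \<Rightarrow> (wavefun \<times> wavefun) set set" where
  "observables R = {A.
     linear_operator A \<and> densely_defined A \<and>
     (\<forall>f \<in> test_space. \<exists>h \<in> test_space. (f, h) \<in> A) \<and>
     (\<forall>f \<in> test_space. \<exists>h \<in> test_space. (f, h) \<in> adjoint_op A) \<and>
     (\<forall>t. \<forall>f \<in> test_space. \<forall>h \<in> test_space. (f, h) \<in> A \<longrightarrow> (evol R t f, evol R t h) \<in> A)}"

text \<open>
  In the intertwining property \<open>Af\<close> and \<open>Ag\<close> are the values of the observable at \<open>f\<close> and of its
  adjoint at \<open>g\<close>; as elements of the test space are continuous, these are unique as functions.
\<close>

definition rigging_map :: "(real \<Rightarrow> real) \<Rightarrow> (wavefun \<Rightarrow> functional) \<Rightarrow> bool" where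
  "rigging_map R \<eta> \<longleftrightarrow>
     (\<forall>f \<in> test_space. \<eta> f \<in> test_dual) \<and>
     (\<forall>f \<in> test_space. \<forall>g \<in> test_space. \<eta> (f + g) = \<eta> f + \<eta> g) \<and>
     (\<forall>c. \<forall>f \<in> test_space. \<eta> (\<lambda>z. c * f z) = (\<lambda>g. cnj c * \<eta> f g)) \<and>
     (\<forall>f \<in> test_space. \<forall>g \<in> test_space. \<eta> f g = cnj (\<eta> g f)) \<and>
     (\<forall>f \<in> test_space. \<eta> f f \<in> \<real>\<^sub>\<ge>\<^sub>0) \<and>
     (\<forall>t. \<forall>f \<in> test_space. \<forall>g \<in> test_space. \<eta> f (evol R t g) = \<eta> f g) \<and>
     (\<forall>A \<in> observables R. \<forall>f \<in> test_space. \<forall>g \<in> test_space.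
        \<forall>Af \<in> test_space. \<forall>Ag \<in> test_space.
          (f, Af) \<in> A \<longrightarrow> (g, Ag) \<in> adjoint_op A \<longrightarrow> \<eta> Af g = \<eta> f Ag)"


subsection \<open>The maps \<open>\<eta>\<^sub>p\<close> and \<open>\<eta>\<^sub>p\<^sub>\<epsilon>\<close>\<close>

definition stat_order :: "(real \<Rightarrow> real) \<Rightarrow> real \<Rightarrow> nat" where
  "stat_order R y = (LEAST k. k \<ge> 1 \<and> nth_deriv k R y \<noteq> 0)"

definition orders :: "(real \<Rightarrow> real) \<Rightarrow> nat set" where
  "orders R = {p. \<exists>(q::nat) y. (real q)\<^sup>2 = R y \<and> p = stat_order R y}"

datatype label = Odd nat | Even nat real

fun label_order :: "label \<Rightarrow> nat" where
  "label_order (Odd p) = p"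
| "label_order (Even p \<epsilon>) = p"

fun Y :: "(real \<Rightarrow> real) \<Rightarrow> label \<Rightarrow> nat \<Rightarrow> real set" where
  "Y R (Odd p) q = {y \<in> {0..<2 * pi}. (real q)\<^sup>2 = R y \<and> stat_order R y = p}"
| "Y R (Even p \<epsilon>) q =
     {y \<in> {0..<2 * pi}. (real q)\<^sup>2 = R y \<and> stat_order R y = p \<and> sgn (nth_deriv p R y) = \<epsilon>}"

definition labels :: "(real \<Rightarrow> real) \<Rightarrow> label set" where
  "labels R =
     {Odd p | p. p \<in> orders R \<and> odd p} \<union>
     {Even p \<epsilon> | p \<epsilon>. p \<in> orders R \<and> even p \<and> \<epsilon> \<in> {1, -1} \<and> (\<exists>q. Y R (Even p \<epsilon>) q \<noteq> {})}"

definition eta :: "(real \<Rightarrow> real) \<Rightarrow> label \<Rightarrow> wavefun \<Rightarrow> functional" where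
  "eta R l f g =
     (if g \<in> test_space
      then (2 * pi)\<^sup>2 * (\<Sum>\<^sub>\<infinity>m\<in>(UNIV :: int set). \<Sum>y\<in>Y R l (nat \<bar>m\<bar>).
             cnj (coef f m y) * coef g m y
               / of_real (\<bar>nth_deriv (label_order l) R y\<bar> powr (1 / real (label_order l))))
      else 0)"


subsection \<open>Consistency of the definitions\<close>

lemma exp_has_vector_derivative:
  "((\<lambda>s::real. exp (a * of_real s)) has_vector_derivative a * exp (a * of_real x)) (at x within S)"
  for a :: complex
  using exp_scaleR_has_vector_derivative_right[of a x S]
  by (simp add: scaleR_conv_of_real mult.commute)

lemma coef_fourier_sum:
  assumes "finite M"
  shows "coef (fourier_sum M c) m y = (if m \<in> M then c m y else 0)"
proof -
  have base: "((\<lambda>x::real. exp (\<i> * of_int k * of_real x)) has_integral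
      (if k = 0 then of_real (2 * pi) else (0::complex))) {0..2 * pi}" for k :: int
  proof (cases "k = 0")
    case True
    then show ?thesis
      using has_integral_const_real[of "1::complex" 0 "2 * pi"] by (simp add: scaleR_conv_of_real)
  next
    case False
    let ?F = "\<lambda>x::real. exp (\<i> * of_int k * of_real x) / (\<i> * of_int k)"
    have "(?F has_vector_derivative exp (\<i> * of_int k * of_real x)) (at x within {0..2 * pi})" for x
      using has_vector_derivative_divide[OF exp_has_vector_derivative[of "\<i> * of_int k" x], of "\<i> * of_int k"] False
      by simp
    then have "((\<lambda>x::real. exp (\<i> * of_int k * of_real x)) has_integral ?F (2 * pi) - ?F 0) {0..2 * pi}"
      by (intro fundamental_theorem_of_calculus) auto
    moreover have "exp (\<i> * of_int k * of_real (2 * pi)) = 1"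
      by (rule exp_eq_1[THEN iffD2]) (auto intro!: exI[of _ k])
    ultimately show ?thesis
      using False by simp
  qed
  have "((\<lambda>x. \<Sum>k\<in>M. exp (\<i> * of_int (k - m) * of_real x) * c k y) has_integral
      (\<Sum>k\<in>M. (if k - m = 0 then of_real (2 * pi) else 0) * c k y)) {0..2 * pi}"
    by (intro has_integral_sum assms has_integral_mult_left base)
  moreover have "(\<lambda>x. \<Sum>k\<in>M. exp (\<i> * of_int (k - m) * of_real x) * c k y) =
      (\<lambda>x::real. exp (- \<i> * of_int m * of_real x) * fourier_sum M c (x, y))"
  proof -
    have "exp (\<i> * of_int (k - m) * of_real x) =
        exp (- \<i> * of_int m * of_real x) * exp (\<i> * of_int k * of_real x)" for k and x :: real
      unfolding exp_add[symmetric] by (simp add: algebra_simps)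
    then show ?thesis
      by (simp add: fourier_sum_def sum_distrib_left mult.assoc)
  qed
  moreover have "(\<Sum>k\<in>M. (if k - m = 0 then of_real (2 * pi) else 0) * c k y) =
      (if m \<in> M then of_real (2 * pi) * c m y else 0)"
    using assms by (simp add: if_distrib[of "\<lambda>u. u * _"] sum.delta cong: if_cong)
  ultimately show ?thesis
    by (auto simp: coef_def dest!: integral_unique)
qed

lemma evol_fourier_sum:
  assumes "finite M"
  shows "evol R t (fourier_sum M c) =
    fourier_sum M (\<lambda>m y. exp (- \<i> * of_real (t * ((of_int m)\<^sup>2 - R y))) * c m y)"
proof -
  have "evol R t (fourier_sum M c) (x, y) =
      (\<Sum>\<^sub>\<infinity>m\<in>M. exp (- \<i> * of_real (t * ((of_int m)\<^sup>2 - R y))) * exp (\<i> * of_int m * of_real x) * c m y)"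
    for x y
    unfolding evol_def prod.case
    by (rule infsum_cong_neutral) (auto simp: coef_fourier_sum[OF assms])
  then show ?thesis
    using assms by (auto simp: fourier_sum_def fun_eq_iff algebra_simps)
qed

lemma evol_0: "f \<in> test_space \<Longrightarrow> evol R 0 f = f"
  by (auto simp: test_space_def evol_fourier_sum)

lemma constraint_op_fourier_sum:
  "constraint_op R (fourier_sum M c) =
    fourier_sum M (\<lambda>m y. of_real ((of_int m)\<^sup>2 - R y) * c m y)"
proof -
  have D: "vector_derivative (\<lambda>s. \<Sum>m\<in>M. exp (\<i> * of_int m * of_real s) * d m) (at x) =
      (\<Sum>m\<in>M. exp (\<i> * of_int m * of_real x) * (\<i> * of_int m * d m))"
    for d :: "int \<Rightarrow> complex" and x :: real
  proof (rule vector_derivative_at)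
    have "((\<lambda>s. \<Sum>m\<in>M. exp (\<i> * of_int m * of_real s) * d m) has_vector_derivative
        (\<Sum>m\<in>M. (\<i> * of_int m * exp (\<i> * of_int m * of_real x)) * d m)) (at x)"
      by (intro has_vector_derivative_sum has_vector_derivative_mult_left exp_has_vector_derivative)
    also have "(\<Sum>m\<in>M. (\<i> * of_int m * exp (\<i> * of_int m * of_real x)) * d m) =
        (\<Sum>m\<in>M. exp (\<i> * of_int m * of_real x) * (\<i> * of_int m * d m))"
      by (simp only: mult_ac)
    finally show "((\<lambda>s. \<Sum>m\<in>M. exp (\<i> * of_int m * of_real s) * d m) has_vector_derivative
        (\<Sum>m\<in>M. exp (\<i> * of_int m * of_real x) * (\<i> * of_int m * d m))) (at x)" .
  qed
  have D2: "nth_deriv 2 (\<lambda>s. fourier_sum M c (s, y)) x =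
      (\<Sum>m\<in>M. exp (\<i> * of_int m * of_real x) * (\<i> * of_int m * (\<i> * of_int m * c m y)))" for x y
    by (simp only: nth_deriv_def numeral_2_eq_2 funpow.simps comp_apply id_apply fourier_sum_def
        prod.case D)
  have "constraint_op R (fourier_sum M c) (x, y) =
      fourier_sum M (\<lambda>m y. of_real ((of_int m)\<^sup>2 - R y) * c m y) (x, y)" for x y
    unfolding constraint_op_def prod.case D2
    unfolding fourier_sum_def prod.case sum_distrib_left sum_negf[symmetric] sum_subtractf[symmetric]
    by (intro sum.cong refl) (simp add: algebra_simps power2_eq_square)
  then show ?thesis
    by (simp add: fun_eq_iff)
qed

lemma evol_Schroedinger:
  assumes "f \<in> test_space"
  shows "((\<lambda>t. evol R t f z) has_vector_derivative - \<i> * constraint_op R (evol R t f) z) (at t)"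
proof -
  obtain M c where f: "f = fourier_sum M c" "finite M"
    using assms by (auto simp: test_space_def)
  obtain x y where z: "z = (x, y)" by force
  let ?e = "\<lambda>m. - \<i> * of_real ((of_int m)\<^sup>2 - R y)"
  have "((\<lambda>t. \<Sum>m\<in>M. exp (?e m * of_real t) * (exp (\<i> * of_int m * of_real x) * c m y))
      has_vector_derivative
      (\<Sum>m\<in>M. (?e m * exp (?e m * of_real t)) * (exp (\<i> * of_int m * of_real x) * c m y))) (at t)"
    by (intro has_vector_derivative_sum has_vector_derivative_mult_left exp_has_vector_derivative)
  then show ?thesis
    unfolding f evol_fourier_sum[OF f(2)] constraint_op_fourier_sum
    by (simp add: fourier_sum_def z sum_distrib_left mult_ac)
qed

end

(*
For test functions f, g and an observable A, put
W m = cnj (g_m) (A f)_m - cnj ((A^* g)_m) f_m.  Since A commutes with the evolution, the sum over m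
of the integrals of W m(y) exp (i t (R y - m^2)) vanishes for all t; hence, by Stone-Weierstrass and
dominated convergence, so does, for every s > 0 and each sign of R - m^2, the sum over m of the
integrals of W m over {y. 0 < |R y - m^2| < s}.  As s tends to 0+ these sets shrink to the solutions
y0 of R y0 = m^2, and a solution of order p' contributes an expansion in powers s^(j/p'), j >= 1,
whose first coefficient is W m(y0) / |R^(p')(y0)|^(1/p') up to a factor depending on p' only.  The
coefficient of s^(1/p) vanishes; it receives contributions from j = 1, p' = p and from p' = j p with
j >= 2.  The latter drop out: for j >= 3 such p' are excluded by hypothesis, and for j = 2 the order
p' is even and the two sides of y0 cancel.  What remains is the intertwining property; the sign of
R - m^2 separates the two signs for even p.
*)
theory Submission
  imports Defs "HOL-Library.Landau_Symbols" "HOL-Computational_Algebra.Polynomial"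
begin

subsection \<open>Smooth functions on the circle\<close>

text \<open>The evolution sees a pair (m, y) only through the number R y - m^2, so it cannot tell
  frequencies or solutions apart; what separates them is the rate at which a small level set
  shrinks. Sharp cut-offs are used because near a solution the level set is an interval up to single
  points, and an antiderivative turns its integral into endpoint values. The endpoints are governed
  by a root coordinate \<open>E\<close> in which R y - R y0 is locally \<sigma> E^p. No smooth
  inverse function theorem is invoked: the relation \<open>Z e = e * G (Z e)\<close> for its inverse
  \<open>Z\<close> yields as many terms of an expansion as wanted. Many are needed, since a solution
  of high order contributes several powers below s^(1/p), which must be accounted for before that
  coefficient can be isolated. Everything is expanded up to s^2, which is smaller than each s^(1/p).
  The cancellation at even order is a parity: the two sides contribute F(e) - F(-e), which has no
  even powers. Distinct images are separated by evaluating a common functional at \<psi> f, where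
  \<psi> is nonnegative, vanishes at the relevant points of one label and is positive at those of
  the other.\<close>

lemma nth_deriv_0 [simp]: "nth_deriv 0 h = h"
  by (simp add: nth_deriv_def)

lemma nth_deriv_Suc: "nth_deriv (Suc n) h = (\<lambda>y. vector_derivative (nth_deriv n h) (at y))"
  by (simp add: nth_deriv_def)

lemma nth_deriv_Suc': "nth_deriv (Suc n) h = nth_deriv n (\<lambda>y. vector_derivative h (at y))"
  by (simp add: nth_deriv_def funpow_Suc_right del: funpow.simps)

section \<open>Differentiability to finite order, and closure of smooth periodic functions under the
  operations used\<close>

definition times_differentiable :: "nat \<Rightarrow> (real \<Rightarrow> 'a::real_normed_vector) \<Rightarrow> bool" where
  "times_differentiable n h \<longleftrightarrow> (\<forall>k<n. \<forall>y. nth_deriv k h differentiable (at y))"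

lemma times_differentiable_0 [simp]: "times_differentiable 0 h"
  by (simp add: times_differentiable_def)

text \<open>One more order amounts to exhibiting a derivative that has the previous order. This
  drives the inductions on \<open>n\<close> below: the derivative of a product or an exponential
  contains the original functions again, and these are known to the lower order as well.\<close>

lemma times_differentiable_Suc:
  "times_differentiable (Suc n) h \<longleftrightarrow>
    (\<exists>h'. (\<forall>y. (h has_vector_derivative h' y) (at y)) \<and> times_differentiable n h')"
proof
  assume h: "times_differentiable (Suc n) h"
  have "(h has_vector_derivative vector_derivative h (at y)) (at y)" for y
    using h by (metis nth_deriv_0 times_differentiable_def vector_derivative_works zero_less_Suc)
  moreover have "times_differentiable n (\<lambda>y. vector_derivative h (at y))"
    using h by (auto simp: times_differentiable_def nth_deriv_Suc'[symmetric])
  ultimately show "\<exists>h'. (\<forall>y. (h has_vector_derivative h' y) (at y)) \<and> times_differentiable n h'"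
    by (intro exI[of _ "\<lambda>y. vector_derivative h (at y)"]) auto
next
  assume "\<exists>h'. (\<forall>y. (h has_vector_derivative h' y) (at y)) \<and> times_differentiable n h'"
  then obtain h' where h': "\<And>y. (h has_vector_derivative h' y) (at y)" "times_differentiable n h'"
    by blast
  have eq: "(\<lambda>y. vector_derivative h (at y)) = h'"
    using h'(1) by (auto intro: vector_derivative_at)
  show "times_differentiable (Suc n) h"
    unfolding times_differentiable_def
  proof (intro allI impI)
    fix k y assume "k < Suc n"
    then show "nth_deriv k h differentiable (at y)"
      using h' by (cases k) (auto simp: nth_deriv_Suc' eq times_differentiable_def intro: differentiableI_vector[OF h'(1)])
  qed
qed

lemma times_differentiable_lower: "times_differentiable (Suc n) h \<Longrightarrow> times_differentiable n h"
  by (auto simp: times_differentiable_def)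

lemma times_differentiable_const: "times_differentiable n (\<lambda>_. c)"
  by (induction n arbitrary: c) (auto simp: times_differentiable_Suc intro!: exI[of _ "\<lambda>_. 0"])

lemma times_differentiable_add:
  "times_differentiable n f \<Longrightarrow> times_differentiable n g \<Longrightarrow> times_differentiable n (\<lambda>y. f y + g y)"
proof (induction n arbitrary: f g)
  case (Suc n)
  then obtain f' g' where "\<And>y. (f has_vector_derivative f' y) (at y)" "times_differentiable n f'"
    "\<And>y. (g has_vector_derivative g' y) (at y)" "times_differentiable n g'"
    by (auto simp: times_differentiable_Suc)
  with Suc.IH show ?case
    by (auto simp: times_differentiable_Suc intro!: exI[of _ "\<lambda>y. f' y + g' y"] has_vector_derivative_add)
qed simp

lemma times_differentiable_mult:
  fixes f g :: "real \<Rightarrow> 'a::real_normed_algebra"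
  shows "times_differentiable n f \<Longrightarrow> times_differentiable n g \<Longrightarrow> times_differentiable n (\<lambda>y. f y * g y)"
proof (induction n arbitrary: f g)
  case (Suc n)
  then obtain f' g' where *: "\<And>y. (f has_vector_derivative f' y) (at y)" "times_differentiable n f'"
    "\<And>y. (g has_vector_derivative g' y) (at y)" "times_differentiable n g'"
    by (auto simp: times_differentiable_Suc)
  have "times_differentiable n (\<lambda>y. f y * g' y + f' y * g y)"
    using Suc times_differentiable_lower[of n f] times_differentiable_lower[of n g] *
    by (intro times_differentiable_add) auto
  with * show ?case
    by (auto simp: times_differentiable_Suc intro!: exI[of _ "\<lambda>y. f y * g' y + f' y * g y"]
        has_vector_derivative_mult)
qed simp

lemma times_differentiable_linear:
  assumes "bounded_linear L"
  shows "times_differentiable n f \<Longrightarrow> times_differentiable n (\<lambda>y. L (f y))"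
proof (induction n arbitrary: f)
  case (Suc n)
  then obtain f' where *: "\<And>y. (f has_vector_derivative f' y) (at y)" "times_differentiable n f'"
    by (auto simp: times_differentiable_Suc)
  with Suc.IH[of f'] show ?case
    by (auto simp: times_differentiable_Suc intro!: exI[of _ "\<lambda>y. L (f' y)"]
        bounded_linear.has_vector_derivative[OF assms])
qed simp

lemma times_differentiable_exp:
  fixes f :: "real \<Rightarrow> complex"
  shows "times_differentiable n f \<Longrightarrow> times_differentiable n (\<lambda>y. exp (f y))"
proof (induction n arbitrary: f)
  case (Suc n)
  then obtain f' where *: "\<And>y. (f has_vector_derivative f' y) (at y)" "times_differentiable n f'"
    by (auto simp: times_differentiable_Suc)
  have "times_differentiable n (\<lambda>y. f' y * exp (f y))"
    using Suc times_differentiable_lower[of n f] * by (intro times_differentiable_mult) auto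
  moreover have "((\<lambda>y. exp (f y)) has_vector_derivative f' y * exp (f y)) (at y)" for y
    using field_vector_diff_chain_at[OF *(1)[of y] DERIV_exp[of "f y"]] by (simp add: o_def)
  ultimately show ?case
    by (auto simp: times_differentiable_Suc intro!: exI[of _ "\<lambda>y. f' y * exp (f y)"])
qed simp

lemma smooth_circle_iff:
  "smooth_circle h \<longleftrightarrow> (\<forall>y. h (y + 2 * pi) = h y) \<and> (\<forall>n. times_differentiable n h)"
  by (auto simp: smooth_circle_def times_differentiable_def)

lemma smooth_circle_const: "smooth_circle (\<lambda>_. c)"
  by (simp add: smooth_circle_iff times_differentiable_const)

lemma smooth_circle_add:
  "smooth_circle f \<Longrightarrow> smooth_circle g \<Longrightarrow> smooth_circle (\<lambda>y. f y + g y)"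
  by (simp add: smooth_circle_iff times_differentiable_add)

lemma smooth_circle_mult:
  fixes f g :: "real \<Rightarrow> 'a::real_normed_algebra"
  shows "smooth_circle f \<Longrightarrow> smooth_circle g \<Longrightarrow> smooth_circle (\<lambda>y. f y * g y)"
  by (simp add: smooth_circle_iff times_differentiable_mult)

lemma smooth_circle_linear:
  "bounded_linear L \<Longrightarrow> smooth_circle f \<Longrightarrow> smooth_circle (\<lambda>y. L (f y))"
  by (simp add: smooth_circle_iff times_differentiable_linear)

lemma smooth_circle_exp:
  fixes f :: "real \<Rightarrow> complex"
  shows "smooth_circle f \<Longrightarrow> smooth_circle (\<lambda>y. exp (f y))"
  by (simp add: smooth_circle_iff times_differentiable_exp)

lemma smooth_circle_prod:
  fixes f :: "'i \<Rightarrow> real \<Rightarrow> 'a::{real_normed_algebra, comm_ring_1}"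
  assumes "\<And>i. i \<in> I \<Longrightarrow> smooth_circle (f i)"
  shows "smooth_circle (\<lambda>y. \<Prod>i\<in>I. f i y)"
proof (cases "finite I")
  case True
  then show ?thesis
    using assms
    by (induction I rule: finite_induct) (auto intro: smooth_circle_const smooth_circle_mult)
qed (simp add: smooth_circle_const)

lemma smooth_circle_continuous:
  assumes "smooth_circle h" shows "continuous_on S h"
proof -
  have "h differentiable (at y)" for y
    using assms unfolding smooth_circle_def by (metis nth_deriv_0)
  then show ?thesis
    by (meson continuous_at_imp_continuous_on differentiable_imp_continuous_within)
qed

lemma smooth_circle_nth_deriv_has_vector_derivative:
  assumes "smooth_circle h"
  shows "(nth_deriv n h has_vector_derivative nth_deriv (Suc n) h y) (at y)"
  using assms by (simp add: smooth_circle_def nth_deriv_Suc vector_derivative_works[symmetric])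

lemma nth_deriv_periodic:
  assumes "smooth_circle h"
  shows "nth_deriv n h (y + 2 * pi) = nth_deriv n h y"
proof (induction n arbitrary: y)
  case 0
  then show ?case using assms by (simp add: smooth_circle_def)
next
  case (Suc n)
  have "((\<lambda>y. nth_deriv n h (y + 2 * pi)) has_vector_derivative nth_deriv (Suc n) h (y + 2 * pi)) (at y)"
  proof -
    have "((\<lambda>y. y + 2 * pi) has_vector_derivative 1) (at y)"
      by (auto intro!: derivative_eq_intros)
    from vector_diff_chain_at[OF this smooth_circle_nth_deriv_has_vector_derivative[OF assms]]
    show ?thesis by (simp add: o_def)
  qed
  then have "(nth_deriv n h has_vector_derivative nth_deriv (Suc n) h (y + 2 * pi)) (at y)"
    by (simp add: Suc)
  then show ?case
    using smooth_circle_nth_deriv_has_vector_derivative[OF assms] vector_derivative_unique_at by blast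
qed

section \<open>Representatives on the circle, and the cosine as a periodic test function\<close>

lemma periodic_int:
  fixes h :: "real \<Rightarrow> 'a"
  assumes "\<And>y. h (y + 2 * pi) = h y"
  shows "h (y + 2 * pi * of_int k) = h y"
proof (induction k rule: int_induct[of _ 0])
  case (step1 i)
  have "h (y + 2 * pi * of_int (i + 1)) = h (y + 2 * pi * of_int i + 2 * pi)"
    by (simp add: algebra_simps)
  with step1 show ?case by (simp only: assms)
next
  case (step2 i)
  have "h (y + 2 * pi * of_int i) = h (y + 2 * pi * of_int (i - 1) + 2 * pi)"
    by (simp add: algebra_simps)
  with step2 show ?case by (simp only: assms)
qed simp

lemma ex_representative:
  obtains k :: int where "(y::real) + 2 * pi * of_int k \<in> {0..<2 * pi}"
proof -
  let ?k = "\<lfloor>y / (2 * pi)\<rfloor>"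
  have "of_int ?k \<le> y / (2 * pi)" "y / (2 * pi) < of_int ?k + 1"
    by linarith+
  then have "of_int ?k * (2 * pi) \<le> y" "y < (of_int ?k + 1) * (2 * pi)"
    by (simp_all only: pos_le_divide_eq pos_divide_less_eq zero_less_mult_iff pi_gt_zero
        zero_less_numeral simp_thms)
  then have "y + 2 * pi * of_int (- ?k) \<in> {0..<2 * pi}"
    by (simp add: algebra_simps)
  then show thesis by (rule that)
qed

text \<open>Building block for cut-offs: \<open>1 - cos (y - b)\<close> is nonnegative and vanishes
  on the circle only at \<open>b\<close>. Smoothness is inherited from the two exponentials exp(iy)
  and exp(-iy).\<close>

lemma smooth_circle_cos: "smooth_circle (\<lambda>y. complex_of_real (cos (y - b)))"
proof -
  have lin: "smooth_circle (\<lambda>y. exp (c * of_real y) :: complex)" if "exp (c * of_real (2 * pi)) = 1" for c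
  proof -
    have "times_differentiable n (\<lambda>y. c * of_real y)" for n
      by (cases n)
        (auto simp: times_differentiable_Suc times_differentiable_const
          intro!: exI[of _ "\<lambda>_. c"] derivative_eq_intros)
    then have "times_differentiable n (\<lambda>y. exp (c * of_real y))" for n
      by (rule times_differentiable_exp)
    moreover have "exp (c * of_real (y + 2 * pi)) = exp (c * of_real y)" for y
      using that by (simp only: of_real_add distrib_left exp_add) simp
    ultimately show ?thesis by (simp add: smooth_circle_iff)
  qed
  have "exp (\<i> * of_real (2 * pi)) = 1" "exp (- \<i> * of_real (2 * pi)) = 1"
    using exp_two_pi_i by (simp_all add: mult_ac exp_minus)
  note l = this[THEN lin]
  have "complex_of_real (cos (y - b)) =
    exp (- \<i> * of_real b) / 2 * exp (\<i> * of_real y) + exp (\<i> * of_real b) / 2 * exp (- \<i> * of_real y)" for y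
  proof -
    have "complex_of_real (cos (y - b)) = (exp (\<i> * of_real (y - b)) + exp (- (\<i> * of_real (y - b)))) / 2"
      unfolding cos_of_real[symmetric] cos_exp_eq by simp
    also have "exp (\<i> * of_real (y - b)) = exp (- \<i> * of_real b) * exp (\<i> * of_real y)"
      by (simp add: exp_add[symmetric] algebra_simps)
    also have "exp (- (\<i> * of_real (y - b))) = exp (\<i> * of_real b) * exp (- \<i> * of_real y)"
      by (simp add: exp_add[symmetric] algebra_simps)
    finally show ?thesis by (simp add: add_divide_distrib)
  qed
  then show ?thesis
    by (simp only:) (intro smooth_circle_add smooth_circle_mult smooth_circle_const l)
qed

subsection \<open>Taylor expansions\<close>

text \<open>For vector values there is no Lagrange form of the remainder, so the bound for the
  derivative is integrated by the mean value inequality, by induction on \<open>N\<close>. The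
  derivatives are an arbitrary sequence \<open>D\<close> on an interval, so that the bound also
  serves antiderivatives, shifted sequences and real powers away from 0.\<close>

lemma taylor_bound:
  fixes D :: "nat \<Rightarrow> real \<Rightarrow> 'a::real_normed_vector"
  assumes "\<And>n x. \<bar>x - x0\<bar> \<le> r \<Longrightarrow> (D n has_vector_derivative D (Suc n) x) (at x)"
  shows "\<exists>C. \<forall>x. \<bar>x - x0\<bar> \<le> r \<longrightarrow>
    norm (D 0 x - (\<Sum>j<N. ((x - x0) ^ j / fact j) *\<^sub>R D j x0)) \<le> C * \<bar>x - x0\<bar> ^ N"
  using assms
proof (induction N arbitrary: D)
  case 0
  have "continuous_on {x0 - r..x0 + r} (D 0)"
    by (intro continuous_at_imp_continuous_on ballI has_vector_derivative_continuous[OF 0]) auto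
  then have "bounded (D 0 ` {x0 - r..x0 + r})"
    by (intro compact_imp_bounded compact_continuous_image) auto
  then obtain C where "\<forall>x\<in>{x0 - r..x0 + r}. norm (D 0 x) \<le> C"
    by (auto simp: bounded_iff)
  then show ?case
    by (intro exI[of _ C]) (auto simp: abs_le_iff)
next
  case (Suc N)
  have "\<exists>C. \<forall>x. \<bar>x - x0\<bar> \<le> r \<longrightarrow>
    norm (D (Suc 0) x - (\<Sum>j<N. ((x - x0) ^ j / fact j) *\<^sub>R D (Suc j) x0)) \<le> C * \<bar>x - x0\<bar> ^ N"
    by (rule Suc.IH[of "\<lambda>n. D (Suc n)"]) (rule Suc.prems)
  then obtain C where C: "\<And>x. \<bar>x - x0\<bar> \<le> r \<Longrightarrow>
    norm (D (Suc 0) x - (\<Sum>j<N. ((x - x0) ^ j / fact j) *\<^sub>R D (Suc j) x0)) \<le> C * \<bar>x - x0\<bar> ^ N"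
    by blast
  define \<phi> where "\<phi> x = D 0 x - (\<Sum>j<Suc N. ((x - x0) ^ j / fact j) *\<^sub>R D j x0)" for x
  define \<psi> where "\<psi> x = D (Suc 0) x - (\<Sum>j<N. ((x - x0) ^ j / fact j) *\<^sub>R D (Suc j) x0)" for x
  have mono: "((\<lambda>x. (x - x0) ^ Suc j / fact (Suc j)) has_vector_derivative (x - x0) ^ j / fact j) (at x)" for j x
  proof -
    have "((\<lambda>x. (x - x0) ^ Suc j) has_real_derivative real (Suc j) * (x - x0) ^ j) (at x)"
      using DERIV_power[of "\<lambda>x. x - x0" 1 x UNIV "Suc j"] by (simp add: DERIV_diff[of _ 1 _ _ _ 0, simplified])
    from DERIV_cdivide[OF this, of "fact (Suc j)"] show ?thesis
      unfolding has_real_derivative_iff_has_vector_derivative[symmetric] fact_Suc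
      by (simp del: power_Suc of_nat_Suc)
  qed
  have deriv: "(\<phi> has_vector_derivative \<psi> x) (at x)" if "\<bar>x - x0\<bar> \<le> r" for x
  proof -
    have "\<phi> = (\<lambda>x. D 0 x - (D 0 x0 + (\<Sum>j<N. ((x - x0) ^ Suc j / fact (Suc j)) *\<^sub>R D (Suc j) x0)))"
      unfolding \<phi>_def sum.lessThan_Suc_shift by simp
    moreover have "((\<lambda>x. D 0 x - (D 0 x0 + (\<Sum>j<N. ((x - x0) ^ Suc j / fact (Suc j)) *\<^sub>R D (Suc j) x0)))
       has_vector_derivative D (Suc 0) x - (0 + (\<Sum>j<N. ((x - x0) ^ j / fact j) *\<^sub>R D (Suc j) x0))) (at x)"
    proof (intro has_vector_derivative_diff has_vector_derivative_add has_vector_derivative_sum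
        has_vector_derivative_const Suc.prems that)
      fix j
      have "bounded_linear (\<lambda>t. t *\<^sub>R D (Suc j) x0)" by (rule bounded_linear_scaleR_left)
      from bounded_linear.has_vector_derivative[OF this mono]
      show "((\<lambda>x. ((x - x0) ^ Suc j / fact (Suc j)) *\<^sub>R D (Suc j) x0) has_vector_derivative
        ((x - x0) ^ j / fact j) *\<^sub>R D (Suc j) x0) (at x)" .
    qed
    ultimately show ?thesis by (simp add: \<psi>_def)
  qed
  have "norm (\<phi> x) \<le> \<bar>C\<bar> * \<bar>x - x0\<bar> ^ Suc N" if x: "\<bar>x - x0\<bar> \<le> r" for x
  proof -
    have near: "\<bar>t - x0\<bar> \<le> \<bar>x - x0\<bar>" if "t \<in> closed_segment x0 x" for t
      using that by (auto simp: closed_segment_eq_real_ivl split: if_splits)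
    \<comment> \<open>Mean value inequality on the segment from \<open>x0\<close> to
      \<open>x\<close>, where the bound for \<psi> at \<open>t\<close> is weakened to the one at
      \<open>x\<close>.\<close>
    have "norm (\<phi> x - \<phi> x0) \<le> (\<bar>C\<bar> * \<bar>x - x0\<bar> ^ N) * norm (x - x0)"
    proof (rule differentiable_bound[of "closed_segment x0 x" \<phi> "\<lambda>t h. h *\<^sub>R \<psi> t"])
      fix t assume t: "t \<in> closed_segment x0 x"
      from near[OF this] x have t': "\<bar>t - x0\<bar> \<le> r" by linarith
      show "(\<phi> has_derivative (\<lambda>h. h *\<^sub>R \<psi> t)) (at t within closed_segment x0 x)"
        using deriv[OF t'] by (simp add: has_vector_derivative_def has_derivative_at_withinI)
      have "norm (\<psi> t) \<le> C * \<bar>t - x0\<bar> ^ N"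
        unfolding \<psi>_def by (rule C[OF t'])
      also have "\<dots> \<le> \<bar>C\<bar> * \<bar>x - x0\<bar> ^ N"
        using near[OF t] by (intro mult_mono power_mono) auto
      finally show "onorm (\<lambda>h. h *\<^sub>R \<psi> t) \<le> \<bar>C\<bar> * \<bar>x - x0\<bar> ^ N"
        by (intro onorm_le) (simp add: mult.commute mult_left_mono)
    qed auto
    moreover have "\<phi> x0 = 0"
      unfolding \<phi>_def sum.lessThan_Suc_shift by simp
    ultimately show ?thesis by (simp add: mult_ac)
  qed
  then show ?case
    unfolding \<phi>_def by blast
qed

text \<open>A two-sided asymptotic expansion at 0. The degree of the polynomial is not limited by
  \<open>N\<close>, so sums, products and composites of polynomials need no truncation. The filter
  \<open>nhds 0\<close> includes the point 0 itself, so for positive \<open>N\<close> the constant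
  term is the value there.\<close>

definition expandable :: "nat \<Rightarrow> (real \<Rightarrow> complex) \<Rightarrow> bool" where
  "expandable N f \<longleftrightarrow>
    (\<exists>q. (\<lambda>e. f e - poly q (of_real e)) \<in> O[nhds 0](\<lambda>e. of_real (e ^ N)))"

lemma poly_bigo_1: "(\<lambda>e. poly q (complex_of_real e)) \<in> O[nhds 0](\<lambda>_. 1)"
proof (rule bigoI_tendsto)
  have "isCont (\<lambda>e. poly q (complex_of_real e)) 0"
    by (intro continuous_intros)
  then show "((\<lambda>e. poly q (complex_of_real e) / 1) \<longlongrightarrow> poly q (complex_of_real 0)) (nhds 0)"
    using tendsto_at_iff_tendsto_nhds[of "\<lambda>e. poly q (complex_of_real e)" 0] by (simp add: isCont_def)
qed auto

lemma power_bigo_1: "(\<lambda>e. complex_of_real (e ^ N)) \<in> O[nhds 0](\<lambda>_. 1)"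
  using poly_bigo_1[of "monom 1 N"] by (simp add: poly_monom)

lemma expandableI:
  "(\<lambda>e. f e - poly q (of_real e)) \<in> O[nhds 0](\<lambda>e. of_real (e ^ N)) \<Longrightarrow> expandable N f"
  unfolding expandable_def by blast

lemma expandable_bigo_1: 
  assumes "expandable N f" shows "f \<in> O[nhds 0](\<lambda>_. 1)"
proof -
  obtain q where "(\<lambda>e. f e - poly q (of_real e)) \<in> O[nhds 0](\<lambda>e. of_real (e ^ N))"
    using assms by (auto simp: expandable_def)
  from landau_o.big.trans[OF this power_bigo_1]
  have "(\<lambda>e. (f e - poly q (of_real e)) + poly q (of_real e)) \<in> O[nhds 0](\<lambda>_. 1)"
    by (rule sum_in_bigo(1)) (rule poly_bigo_1)
  then show ?thesis by simp
qed

lemma expandable_perturb: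
  assumes "expandable N g" "(\<lambda>e. f e - g e) \<in> O[nhds 0](\<lambda>e. of_real (e ^ N))"
  shows "expandable N f"
proof -
  obtain q where "(\<lambda>e. g e - poly q (of_real e)) \<in> O[nhds 0](\<lambda>e. of_real (e ^ N))"
    using assms by (auto simp: expandable_def)
  from sum_in_bigo(1)[OF assms(2) this] show ?thesis
    by (intro expandableI[of _ q]) simp
qed

lemma expandable_cong:
  assumes "expandable N g" "\<forall>\<^sub>F e in nhds 0. f e = g e"
  shows "expandable N f"
  using assms(1)
proof (rule expandable_perturb)
  show "(\<lambda>e. f e - g e) \<in> O[nhds 0](\<lambda>e. of_real (e ^ N))"
    by (rule bigoI[of _ 0]) (use assms(2) in \<open>simp add: eventually_mono\<close>)
qed

lemma expandable_poly: "expandable N (\<lambda>e. poly q (of_real e))"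
  by (intro expandableI[of _ q]) simp

lemma expandable_const: "expandable N (\<lambda>_. c)"
  using expandable_poly[of N "[:c:]"] by simp

lemma expandable_add:
  assumes "expandable N f" "expandable N g"
  shows "expandable N (\<lambda>e. f e + g e)"
proof -
  obtain q r where "(\<lambda>e. f e - poly q (of_real e)) \<in> O[nhds 0](\<lambda>e. of_real (e ^ N))"
    "(\<lambda>e. g e - poly r (of_real e)) \<in> O[nhds 0](\<lambda>e. of_real (e ^ N))"
    using assms by (auto simp: expandable_def)
  from sum_in_bigo(1)[OF this] show ?thesis
    by (intro expandableI[of _ "q + r"]) (simp add: algebra_simps)
qed

lemma expandable_mult:
  assumes "expandable N f" "expandable N g"
  shows "expandable N (\<lambda>e. f e * g e)"
proof -
  obtain q r where q: "(\<lambda>e. f e - poly q (of_real e)) \<in> O[nhds 0](\<lambda>e. of_real (e ^ N))"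
    and r: "(\<lambda>e. g e - poly r (of_real e)) \<in> O[nhds 0](\<lambda>e. of_real (e ^ N))"
    using assms by (auto simp: expandable_def)
  have "(\<lambda>e. (f e - poly q (of_real e)) * g e + (g e - poly r (of_real e)) * poly q (of_real e))
     \<in> O[nhds 0](\<lambda>e. of_real (e ^ N))"
    using landau_o.big.mult[OF q expandable_bigo_1[OF assms(2)]]
      landau_o.big.mult[OF r poly_bigo_1[of q]] by (intro sum_in_bigo) simp_all
  then show ?thesis
    by (intro expandableI[of _ "q * r"]) (simp add: algebra_simps)
qed

lemma expandable_compose_poly:
  assumes "expandable N f"
  shows "expandable N (\<lambda>e. poly q (f e))"
  by (induction q) (auto intro!: expandable_const expandable_add expandable_mult assms)

text \<open>The factor \<open>e\<close> gains one order; this gain is what improves the expansion of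
  the inverse \<open>Z\<close> step by step.\<close>

lemma expandable_shift:
  assumes "expandable N f"
  shows "expandable (Suc N) (\<lambda>e. of_real e * f e)"
proof -
  obtain q where "(\<lambda>e. f e - poly q (of_real e)) \<in> O[nhds 0](\<lambda>e. of_real (e ^ N))"
    using assms by (auto simp: expandable_def)
  then have "(\<lambda>e. complex_of_real e * (f e - poly q (of_real e))) \<in> O[nhds 0](\<lambda>e. of_real e * of_real (e ^ N))"
    by (intro landau_o.big.mult) simp_all
  then show ?thesis
    by (intro expandableI[of _ "pCons 0 q"]) (simp add: algebra_simps)
qed

text \<open>Only the outer function is replaced by its polynomial here;
  \<open>expandable_compose_poly\<close> then expands that polynomial of the inner function. With
  this separation the inner function enters at this point only through its size.\<close>

lemma expandable_compose:
  fixes f :: "real \<Rightarrow> complex" and Z :: "real \<Rightarrow> real"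
  assumes f: "(\<lambda>z. f z - poly q (of_real z)) \<in> O[nhds 0](\<lambda>z. of_real (z ^ N))"
    and Z: "Z \<in> O[nhds 0](\<lambda>e. e)" "filterlim Z (nhds 0) (nhds 0)"
  shows "(\<lambda>e. f (Z e) - poly q (of_real (Z e))) \<in> O[nhds 0](\<lambda>e. of_real (e ^ N))"
proof -
  have "(\<lambda>e. f (Z e) - poly q (of_real (Z e))) \<in> O[nhds 0](\<lambda>e. of_real (Z e ^ N))"
    using landau_o.big.compose[OF f Z(2)] by simp
  also have "(\<lambda>e. complex_of_real (Z e ^ N)) \<in> O[nhds 0](\<lambda>e. of_real (e ^ N))"
    using landau_o.big_power[OF Z(1), of N] by (simp add: bigo_def norm_power power_abs)
  finally show ?thesis .
qed

lemma expandable_taylor: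
  fixes D :: "nat \<Rightarrow> real \<Rightarrow> complex"
  assumes "\<And>n x. \<bar>x - x0\<bar> \<le> r \<Longrightarrow> (D n has_vector_derivative D (Suc n) x) (at x)" "r > 0"
  shows "expandable N (\<lambda>z. D 0 (x0 + z))"
proof -
  obtain C where C: "\<And>x. \<bar>x - x0\<bar> \<le> r \<Longrightarrow>
    norm (D 0 x - (\<Sum>j<N. ((x - x0) ^ j / fact j) *\<^sub>R D j x0)) \<le> C * \<bar>x - x0\<bar> ^ N"
    using taylor_bound[of x0 r D, OF assms(1)] by blast
  define q where "q = (\<Sum>j<N. monom (D j x0 / fact j) j)"
  have "(\<lambda>z. D 0 (x0 + z) - poly q (of_real z)) \<in> O[nhds 0](\<lambda>e. of_real (e ^ N))"
  proof (rule bigoI)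
    have "\<forall>\<^sub>F z in nhds 0. \<bar>z\<bar> < r"
      using assms(2) by (auto simp: eventually_nhds_metric dist_real_def intro!: exI[of _ r])
    then show "\<forall>\<^sub>F z in nhds 0. norm (D 0 (x0 + z) - poly q (of_real z)) \<le> C * norm (complex_of_real (z ^ N))"
    proof eventually_elim
      case (elim z)
      have "poly q (of_real z) = (\<Sum>j<N. (z ^ j / fact j) *\<^sub>R D j x0)"
        by (simp add: q_def poly_sum poly_monom scaleR_conv_of_real mult.commute)
      then show ?case
        using C[of "x0 + z"] elim by (simp add: norm_power)
    qed
  qed
  then show ?thesis by (rule expandableI)
qed

text \<open>Within distance \<open>x0 / 2\<close> of \<open>x0\<close> the argument stays positive,
  and the derivatives there are falling factorials times lower powers.\<close>

lemma expandable_powr: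
  assumes "x0 > 0"
  shows "expandable N (\<lambda>z. of_real ((x0 + z) powr \<alpha>))"
proof -
  define D where "D n x = complex_of_real ((\<Prod>i<n. \<alpha> - real i) * x powr (\<alpha> - real n))" for n x
  have "expandable N (\<lambda>z. D 0 (x0 + z))"
  proof (rule expandable_taylor)
    fix n x assume "\<bar>x - x0\<bar> \<le> x0 / 2"
    then have "x > 0" using assms by linarith
    then have "((\<lambda>x. (\<Prod>i<n. \<alpha> - real i) * x powr (\<alpha> - real n)) has_real_derivative
      (\<Prod>i<Suc n. \<alpha> - real i) * x powr (\<alpha> - real (Suc n))) (at x)"
      using DERIV_cmult[OF has_real_derivative_powr[of x "\<alpha> - real n"], of "\<Prod>i<n. \<alpha> - real i"]
      by (simp add: diff_diff_eq mult.assoc add.commute)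
    then have "((\<lambda>x. (\<Prod>i<n. \<alpha> - real i) * x powr (\<alpha> - real n)) has_vector_derivative
      (\<Prod>i<Suc n. \<alpha> - real i) * x powr (\<alpha> - real (Suc n))) (at x)"
      by (simp only: has_real_derivative_iff_has_vector_derivative)
    from bounded_linear.has_vector_derivative[OF bounded_linear_of_real this]
    show "(D n has_vector_derivative D (Suc n) x) (at x)"
      unfolding D_def .
  qed (use assms in auto)
  then show ?thesis by (simp add: D_def)
qed

subsection \<open>Levels of the potential near a stationary point\<close>

lemma nhds_0_iff: "(\<forall>\<^sub>F z in nhds 0. P z) \<longleftrightarrow> (\<exists>d>0. \<forall>z::real. \<bar>z\<bar> < d \<longrightarrow> P z)"
  by (simp add: eventually_nhds_metric dist_real_def)

text \<open>The case \<open>p = 1\<close>, in which \<open>y0\<close> is not stationary, is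
  included: simple crossings of a level are treated like degenerate ones.\<close>

locale critical_point =
  fixes R :: "real \<Rightarrow> real" and y0 :: real and p :: nat
  assumes smooth: "smooth_circle R"
    and p_pos: "p > 0"
    and lead: "nth_deriv p R y0 \<noteq> 0"
    and lower: "\<And>k. 0 < k \<Longrightarrow> k < p \<Longrightarrow> nth_deriv k R y0 = 0"
begin

definition a :: real where "a = nth_deriv p R y0 / fact p"

text \<open>The Hadamard quotient: R(y0 + z) - R(y0) = z^p H(z), with the nonzero leading Taylor
  coefficient filled in at 0.\<close>

definition H :: "real \<Rightarrow> real" where
  "H z = (if z = 0 then a else (R (y0 + z) - R y0) / z ^ p)"

text \<open>The root coordinate: near 0 its \<open>p\<close>-th power is |R(y0 + z) - R(y0)| up to
  the sign of z^p. The function \<open>G\<close> below is the reciprocal of the factor of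
  \<open>z\<close>, so that z = E(z) G(z) where H does not vanish.\<close>

definition E :: "real \<Rightarrow> real" where "E z = z * \<bar>H z\<bar> powr (1 / p)"

definition G :: "real \<Rightarrow> real" where "G z = \<bar>H z\<bar> powr (- 1 / p)"

lemma a_nonzero: "a \<noteq> 0"
  using lead by (simp add: a_def)

text \<open>The Taylor polynomial of R with \<open>p + N\<close> terms is divided by z^p; its first
  \<open>p\<close> terms reduce to R(y0) by the choice of \<open>p\<close>.\<close>

lemma H_bound:
  "\<exists>C. \<forall>z. \<bar>z\<bar> \<le> 1 \<longrightarrow>
    \<bar>H z - (\<Sum>i<N. nth_deriv (p + i) R y0 / fact (p + i) * z ^ i)\<bar> \<le> C * \<bar>z\<bar> ^ N"
proof -
  obtain C where C: "\<And>x. \<bar>x - y0\<bar> \<le> 1 \<Longrightarrow>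
    norm (nth_deriv 0 R x - (\<Sum>j<p + N. ((x - y0) ^ j / fact j) *\<^sub>R nth_deriv j R y0)) \<le> C * \<bar>x - y0\<bar> ^ (p + N)"
    using taylor_bound[of y0 1 "\<lambda>n. nth_deriv n R" "p + N"]
      smooth_circle_nth_deriv_has_vector_derivative[OF smooth] by blast
  \<comment> \<open>The summand \<open>\<bar>a\<bar>\<close> in the constant covers
    \<open>z = 0\<close> with \<open>N = 0\<close>, where the sum is empty and
    \<open>H 0 = a\<close>.\<close>
  have "\<bar>H z - (\<Sum>i<N. nth_deriv (p + i) R y0 / fact (p + i) * z ^ i)\<bar> \<le> (\<bar>C\<bar> + \<bar>a\<bar>) * \<bar>z\<bar> ^ N"
    if z: "\<bar>z\<bar> \<le> 1" for z
  proof (cases "z = 0")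
    case True
    then show ?thesis
      by (cases N) (simp_all add: H_def a_def sum.lessThan_Suc_shift del: sum.lessThan_Suc)
  next
    case False
    define T where "T = (\<Sum>i<N. nth_deriv (p + i) R y0 / fact (p + i) * z ^ i)"
    have "(\<Sum>j<p + N. (z ^ j / fact j) *\<^sub>R nth_deriv j R y0) =
      (\<Sum>j<p. (z ^ j / fact j) *\<^sub>R nth_deriv j R y0) + (\<Sum>i<N. (z ^ (p + i) / fact (p + i)) *\<^sub>R nth_deriv (p + i) R y0)"
      using sum.atLeastLessThan_concat[of 0 p "p + N" "\<lambda>j. (z ^ j / fact j) *\<^sub>R nth_deriv j R y0"]
        sum.shift_bounds_nat_ivl[of "\<lambda>j. (z ^ j / fact j) *\<^sub>R nth_deriv j R y0" 0 p N]
      by (simp only: lessThan_atLeast0 add.commute add_0_left add_0_right le_add2 zero_le)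
    also have "(\<Sum>j<p. (z ^ j / fact j) *\<^sub>R nth_deriv j R y0) = R y0"
      using p_pos lower by (subst sum.remove[of _ 0]) (auto intro!: sum.neutral)
    also have "(\<Sum>i<N. (z ^ (p + i) / fact (p + i)) *\<^sub>R nth_deriv (p + i) R y0) = z ^ p * T"
      by (simp add: T_def sum_distrib_left power_add mult_ac)
    finally have "\<bar>R (y0 + z) - (R y0 + z ^ p * T)\<bar> \<le> C * \<bar>z\<bar> ^ (p + N)"
      using C[of "y0 + z"] z by simp
    moreover have "R (y0 + z) - (R y0 + z ^ p * T) = z ^ p * (H z - T)"
      using False by (simp add: H_def field_simps)
    ultimately have "\<bar>z\<bar> ^ p * \<bar>H z - T\<bar> \<le> \<bar>z\<bar> ^ p * (C * \<bar>z\<bar> ^ N)"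
      by (simp add: abs_mult power_abs power_add mult_ac)
    then have "\<bar>H z - T\<bar> \<le> C * \<bar>z\<bar> ^ N"
      using False by simp
    also have "\<dots> \<le> (\<bar>C\<bar> + \<bar>a\<bar>) * \<bar>z\<bar> ^ N"
      by (intro mult_right_mono) auto
    finally show ?thesis by (simp add: T_def)
  qed
  then show ?thesis by blast
qed

lemma H_expandable: "expandable N (\<lambda>z. of_real (H z))"
proof -
  obtain C where C: "\<And>z. \<bar>z\<bar> \<le> 1 \<Longrightarrow>
    \<bar>H z - (\<Sum>i<N. nth_deriv (p + i) R y0 / fact (p + i) * z ^ i)\<bar> \<le> C * \<bar>z\<bar> ^ N"
    using H_bound by blast
  define q where "q = (\<Sum>i<N. monom (complex_of_real (nth_deriv (p + i) R y0 / fact (p + i))) i)"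
  have q: "poly q (of_real z) = of_real (\<Sum>i<N. nth_deriv (p + i) R y0 / fact (p + i) * z ^ i)" for z
    by (simp add: q_def poly_sum poly_monom)
  show ?thesis
  proof (rule expandableI, rule bigoI)
    show "\<forall>\<^sub>F z in nhds 0. norm (of_real (H z) - poly q (of_real z)) \<le> C * norm (complex_of_real (z ^ N))"
      unfolding nhds_0_iff q of_real_diff[symmetric] norm_of_real power_abs
      using C by (intro exI[of _ 1]) auto
  qed
qed

lemma H_tendsto: "(H \<longlongrightarrow> a) (nhds 0)"
proof -
  obtain C where C: "\<And>z. \<bar>z\<bar> \<le> 1 \<Longrightarrow> \<bar>H z - a\<bar> \<le> C * \<bar>z\<bar>"
    using H_bound[of 1] by (auto simp: a_def)
  have "((\<lambda>z. H z - a) \<longlongrightarrow> 0) (nhds 0)"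
  proof (rule Lim_null_comparison)
    show "\<forall>\<^sub>F z in nhds 0. norm (H z - a) \<le> C * \<bar>z\<bar>"
      unfolding nhds_0_iff using C by (intro exI[of _ 1]) auto
    show "((\<lambda>z. C * \<bar>z\<bar>) \<longlongrightarrow> 0) (nhds 0)"
      by (rule tendsto_eq_intros filterlim_ident | simp)+
  qed
  then show ?thesis by (rule LIM_zero_cancel)
qed

lemma isCont_H: "isCont H z"
proof (cases "z = 0")
  case True
  have "H 0 = a" by (simp add: H_def)
  then show ?thesis
    using H_tendsto tendsto_at_iff_tendsto_nhds[of H 0] True by (simp add: isCont_def)
next
  case False
  have "continuous_on UNIV R" by (rule smooth_circle_continuous[OF smooth])
  then have "isCont (\<lambda>z. R (y0 + z)) z"
    by (intro continuous_at_compose[of z "\<lambda>z. y0 + z" R, unfolded o_def] continuous_intros)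
      (simp add: continuous_on_eq_continuous_at)
  then have "isCont (\<lambda>z. (R (y0 + z) - R y0) / z ^ p) z"
    using False by (intro continuous_intros) auto
  moreover have "\<forall>\<^sub>F x in nhds z. H x = (R (y0 + x) - R y0) / x ^ p"
    using t1_space_nhds[OF False] by eventually_elim (simp add: H_def)
  ultimately show ?thesis by (simp add: isCont_cong)
qed

text \<open>Near 0 the quotient \<open>H\<close> has the sign of \<open>a\<close>, so
  \<open>\<bar>H z\<bar>\<close> is \<open>\<bar>a\<bar> + h z\<close> with h = O(z). The function
  \<open>h\<close> is affine in \<open>H\<close>, which avoids expanding an absolute value, and the
  power is smooth near the positive number \<open>\<bar>a\<bar>\<close>.\<close>

lemma G_expandable: "expandable N (\<lambda>z. of_real (G z))"
proof -
  define h where "h z = sgn a * H z - \<bar>a\<bar>" for z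
  have h_exp: "expandable M (\<lambda>z. of_real (h z))" for M
  proof -
    have "(\<lambda>z. complex_of_real (h z)) = (\<lambda>z. of_real (sgn a) * of_real (H z) + of_real (- \<bar>a\<bar>))"
      by (simp add: h_def)
    then show ?thesis
      using expandable_add[OF expandable_mult[OF expandable_const H_expandable] expandable_const] by metis
  qed
  obtain q where q: "(\<lambda>z. complex_of_real ((\<bar>a\<bar> + z) powr (- 1 / p)) - poly q (of_real z)) \<in> O[nhds 0](\<lambda>e. of_real (e ^ N))"
    using expandable_powr[of "\<bar>a\<bar>" N "- 1 / p"] a_nonzero by (auto simp: expandable_def)
  have "h \<in> O[nhds 0](\<lambda>e. e)"
  proof -
    obtain C where C: "\<And>z. \<bar>z\<bar> \<le> 1 \<Longrightarrow> \<bar>H z - a\<bar> \<le> C * \<bar>z\<bar>"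
      using H_bound[of 1] by (auto simp: a_def)
    have eq: "\<bar>h z\<bar> = \<bar>H z - a\<bar>" for z
      using a_nonzero by (simp add: h_def sgn_if abs_minus_commute)
    show ?thesis
      by (rule bigoI[of _ C]) (use C in \<open>auto simp: nhds_0_iff eq intro!: exI[of _ 1]\<close>)
  qed
  moreover have lim: "(h \<longlongrightarrow> 0) (nhds 0)"
    unfolding h_def by (rule tendsto_eq_intros H_tendsto refl)+ (simp add: sgn_if)
  ultimately have
    "(\<lambda>z. of_real ((\<bar>a\<bar> + h z) powr (- 1 / p)) - poly q (of_real (h z))) \<in> O[nhds 0](\<lambda>e. of_real (e ^ N))"
    by (rule expandable_compose[OF q])
  then have "expandable N (\<lambda>z. of_real ((\<bar>a\<bar> + h z) powr (- 1 / p)))"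
    by (rule expandable_perturb[OF expandable_compose_poly[OF h_exp]])
  moreover have "\<forall>\<^sub>F z in nhds 0. complex_of_real (G z) = of_real ((\<bar>a\<bar> + h z) powr (- 1 / p))"
  proof -
    have "\<forall>\<^sub>F z in nhds 0. \<bar>h z\<bar> < \<bar>a\<bar>"
      using tendstoD[OF lim, of "\<bar>a\<bar>"] a_nonzero by simp
    then show ?thesis
      by eventually_elim (auto simp: G_def h_def sgn_if abs_if split: if_splits)
  qed
  ultimately show ?thesis by (rule expandable_cong)
qed

lemma E_zero [simp]: "E 0 = 0"
  by (simp add: E_def)

lemma isCont_E: 
  assumes "H z \<noteq> 0" shows "isCont E z"
  unfolding E_def by (intro continuous_intros isCont_H) (use assms in auto)

lemma E_power: "E z ^ p = z ^ p * \<bar>H z\<bar>"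
proof (cases "H z = 0")
  case False
  then have "(\<bar>H z\<bar> powr (1 / p)) ^ p = \<bar>H z\<bar>"
    using p_pos by (simp add: powr_realpow[symmetric] powr_powr)
  then show ?thesis by (simp add: E_def power_mult_distrib)
qed (use p_pos in \<open>simp add: E_def\<close>)

lemma E_G: "H z \<noteq> 0 \<Longrightarrow> z = E z * G z"
  by (simp add: E_def G_def mult.assoc flip: powr_add)

lemma R_eq_H: "R (y0 + z) - R y0 = z ^ p * H z"
  using p_pos by (simp add: H_def)

definition \<sigma> :: real where "\<sigma> = sgn (nth_deriv p R y0)"

text \<open>The first bound keeps \<open>H\<close> away from 0 and of constant sign. The second
  makes R strictly monotone on each side of \<open>y0\<close>: by Taylor, R'(y0 + z) behaves like
  its leading term, a multiple of z^(p-1) whose factor has the sign \<sigma>.\<close>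

lemma good_radius:
  obtains d where "d > 0"
    "\<And>z. \<bar>z\<bar> \<le> d \<Longrightarrow> \<bar>H z - a\<bar> \<le> \<bar>a\<bar> / 2"
    "\<And>z. \<bar>z\<bar> \<le> d \<Longrightarrow> z \<noteq> 0 \<Longrightarrow> \<sigma> * nth_deriv 1 R (y0 + z) * z ^ (p - 1) > 0"
proof -
  have "\<forall>\<^sub>F z in nhds 0. \<bar>H z - a\<bar> < \<bar>a\<bar> / 2"
    using tendstoD[OF H_tendsto, of "\<bar>a\<bar> / 2"] a_nonzero by (simp add: dist_real_def)
  then obtain d1 where d1: "d1 > 0" "\<And>z. \<bar>z\<bar> < d1 \<Longrightarrow> \<bar>H z - a\<bar> < \<bar>a\<bar> / 2"
    by (auto simp: nhds_0_iff)
  define A where "A = nth_deriv p R y0"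
  have A: "A \<noteq> 0" using lead by (simp add: A_def)
  obtain C where C: "\<And>x. \<bar>x - y0\<bar> \<le> 1 \<Longrightarrow>
    norm (nth_deriv (Suc 0) R x - (\<Sum>j<p. ((x - y0) ^ j / fact j) *\<^sub>R nth_deriv (Suc j) R y0)) \<le> C * \<bar>x - y0\<bar> ^ p"
    using taylor_bound[of y0 1 "\<lambda>n. nth_deriv (Suc n) R" p]
      smooth_circle_nth_deriv_has_vector_derivative[OF smooth] by blast
  have R': "\<bar>nth_deriv 1 R (y0 + z) - z ^ (p - 1) / fact (p - 1) * A\<bar> \<le> C * \<bar>z\<bar> ^ p" if "\<bar>z\<bar> \<le> 1" for z
  proof -
    have "(\<Sum>j<p. (z ^ j / fact j) *\<^sub>R nth_deriv (Suc j) R y0) = z ^ (p - 1) / fact (p - 1) * A"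
    proof -
      have "nth_deriv (Suc j) R y0 = 0" if "j \<in> {..<p} - {p - 1}" for j
        using that by (intro lower) auto
      then have "(\<Sum>j\<in>{..<p} - {p - 1}. (z ^ j / fact j) *\<^sub>R nth_deriv (Suc j) R y0) = 0"
        by (intro sum.neutral) simp
      moreover have "Suc (p - 1) = p" using p_pos by simp
      ultimately show ?thesis
        using p_pos by (simp add: sum.remove[of _ "p - 1"] A_def)
    qed
    then show ?thesis using C[of "y0 + z"] that by simp
  qed
  \<comment> \<open>The last entry makes the Taylor remainder of R' at most half of the leading
    term; adding 1 to \<open>\<bar>C\<bar>\<close> keeps the divisor positive. Halving
    \<open>d1\<close> turns the strict bound on \<open>\<bar>z\<bar>\<close> into a weak
    one.\<close>
  define d where "d = min 1 (min (d1 / 2) (\<bar>A\<bar> / fact (p - 1) / (\<bar>C\<bar> + 1) / 2))"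
  have "d > 0" using d1(1) A by (simp add: d_def)
  then show thesis
  proof (rule that)
    fix z assume z: "\<bar>z\<bar> \<le> d"
    show "\<bar>H z - a\<bar> \<le> \<bar>a\<bar> / 2"
      using d1(2)[of z] z d1(1) by (simp add: d_def)
    assume z0: "z \<noteq> 0"
    define u where "u = z ^ (p - 1)"
    have u0: "u \<noteq> 0" using z0 by (simp add: u_def)
    have zp: "\<bar>z\<bar> ^ p = \<bar>u\<bar> * \<bar>z\<bar>"
      using p_pos by (cases p) (simp_all add: u_def power_abs abs_mult)
    have "\<bar>nth_deriv 1 R (y0 + z) - u / fact (p - 1) * A\<bar> \<le> C * (\<bar>u\<bar> * \<bar>z\<bar>)"
      using R'[of z] z zp by (simp add: d_def u_def)
    also have "\<dots> \<le> \<bar>u\<bar> * ((\<bar>C\<bar> + 1) * \<bar>z\<bar>)"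
    proof -
      have "C * (\<bar>u\<bar> * \<bar>z\<bar>) \<le> (\<bar>C\<bar> + 1) * (\<bar>u\<bar> * \<bar>z\<bar>)"
        by (intro mult_right_mono) auto
      then show ?thesis by (simp add: mult_ac)
    qed
    also have "\<dots> < \<bar>u\<bar> * (\<bar>A\<bar> / fact (p - 1))"
    proof (intro mult_strict_left_mono)
      have "(\<bar>C\<bar> + 1) * \<bar>z\<bar> \<le> (\<bar>C\<bar> + 1) * (\<bar>A\<bar> / fact (p - 1) / (\<bar>C\<bar> + 1) / 2)"
        using z by (intro mult_left_mono) (auto simp: d_def)
      also have "\<dots> = \<bar>A\<bar> / fact (p - 1) / 2"
      proof -
        have "c * (X / c / 2) = X / 2" if "c \<noteq> 0" for c X :: real
          using that by simp
        moreover have "\<bar>C\<bar> + 1 \<noteq> 0" by linarith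
        ultimately show ?thesis by blast
      qed
      also have "\<dots> < \<bar>A\<bar> / fact (p - 1)"
      proof -
        have "\<bar>A\<bar> / fact (p - 1) > 0" using A by simp
        moreover have "X / 2 < X" if "X > 0" for X :: real
          using that by simp
        ultimately show ?thesis by blast
      qed
      finally show "(\<bar>C\<bar> + 1) * \<bar>z\<bar> < \<bar>A\<bar> / fact (p - 1)" .
    qed (use u0 in simp)
    finally have *: "\<bar>nth_deriv 1 R (y0 + z) - u / fact (p - 1) * A\<bar> < \<bar>u / fact (p - 1) * A\<bar>"
      by (simp add: abs_mult)
    have "(nth_deriv 1 R (y0 + z)) * (u / fact (p - 1) * A) > 0"
    proof -
      have "x * b > 0" if "\<bar>x - b\<bar> < \<bar>b\<bar>" for x b :: real
        using that by (cases "b > 0") (auto simp: abs_if mult_pos_pos mult_neg_neg split: if_splits)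
      with * show ?thesis by blast
    qed
    then have "nth_deriv 1 R (y0 + z) * u * A > 0"
      by (simp add: zero_less_divide_iff)
    then have "sgn A * (nth_deriv 1 R (y0 + z) * u) > 0"
      using A by (auto simp only: zero_less_mult_iff sgn_greater sgn_less)
    then show "\<sigma> * nth_deriv 1 R (y0 + z) * z ^ (p - 1) > 0"
      by (simp only: \<sigma>_def A_def u_def mult.assoc)
  qed
qed

end

section \<open>Monotonicity of the root coordinate on a small interval, and its inverse\<close>

context critical_point
begin

lemma \<sigma>_a: "\<sigma> = sgn a"
  by (simp add: \<sigma>_def a_def sgn_divide)

lemma R_deriv: "((\<lambda>z. R (y0 + z) - R y0) has_real_derivative nth_deriv 1 R (y0 + z)) (at z)"
proof -
  have "((\<lambda>z. y0 + z) has_vector_derivative 1) (at z)"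
    by (auto intro!: derivative_eq_intros)
  from vector_diff_chain_at[OF this smooth_circle_nth_deriv_has_vector_derivative[OF smooth, of 0 "y0 + z"]]
  have "((\<lambda>z. R (y0 + z)) has_real_derivative nth_deriv 1 R (y0 + z)) (at z)"
    by (simp add: o_def has_real_derivative_iff_has_vector_derivative)
  then show ?thesis
    by (auto intro!: derivative_eq_intros)
qed

end

text \<open>The estimates reach the ends of the closed interval, where the intermediate value
  theorem needs them, and they pass to every smaller radius, which later permits a common radius for
  all solutions.\<close>

locale critical_radius = critical_point +
  fixes d :: real
  assumes d_pos: "d > 0"
    and H_near: "\<And>z. \<bar>z\<bar> \<le> d \<Longrightarrow> \<bar>H z - a\<bar> \<le> \<bar>a\<bar> / 2"
    and slope: "\<And>z. \<bar>z\<bar> \<le> d \<Longrightarrow> z \<noteq> 0 \<Longrightarrow> \<sigma> * nth_deriv 1 R (y0 + z) * z ^ (p - 1) > 0"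
begin

lemma H_sign: assumes "\<bar>z\<bar> \<le> d" shows "\<sigma> * H z = \<bar>H z\<bar>" "\<bar>H z\<bar> \<ge> \<bar>a\<bar> / 2" "H z \<noteq> 0"
  using H_near[OF assms] a_nonzero by (auto simp: \<sigma>_a sgn_if abs_if split: if_splits)

lemma R_eq_E: assumes "\<bar>z\<bar> \<le> d" shows "\<sigma> * (R (y0 + z) - R y0) = E z ^ p"
  using H_sign(1)[OF assms] by (simp add: R_eq_H E_power)

lemma E_sign: assumes "\<bar>z\<bar> \<le> d" shows "E z > 0 \<longleftrightarrow> z > 0" "E z < 0 \<longleftrightarrow> z < 0"
  using H_sign(3)[OF assms] by (auto simp: E_def zero_less_mult_iff mult_less_0_iff)

text \<open>On each half-interval \<open>E z ^ p\<close> is \<sigma> (R(y0 + z) - R(y0)), which is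
  monotone by \<open>slope\<close>; taking \<open>p\<close>-th roots of nonnegative bases transfers
  this to \<open>E\<close> or \<open>- E\<close>. The signs of \<open>E\<close> join the halves, so
  \<open>E\<close> is never differentiated.\<close>

lemma E_strict_mono: 
  assumes "- d \<le> z" "z < z'" "z' \<le> d"
  shows "E z < E z'"
proof -
  have cont: "continuous_on S (\<lambda>z. c * (R (y0 + z) - R y0))" for S c
  proof -
    have "continuous_on S (\<lambda>z. R (y0 + z))"
      by (rule continuous_on_compose2[OF smooth_circle_continuous[OF smooth, of UNIV]])
        (auto intro: continuous_intros)
    then show ?thesis by (intro continuous_intros)
  qed
  have right: "E u < E v" if "0 \<le> u" "u < v" "v \<le> d" for u v
  proof -
    have "\<sigma> * (R (y0 + u) - R y0) < \<sigma> * (R (y0 + v) - R y0)"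
    proof (rule DERIV_pos_imp_increasing_open[of u v "\<lambda>z. \<sigma> * (R (y0 + z) - R y0)"])
      fix x assume x: "u < x" "x < v"
      have "x ^ (p - 1) > 0" using x that by simp
      moreover have "\<bar>x\<bar> \<le> d" "x \<noteq> 0" using x that by auto
      note slope[OF this]
      ultimately have "\<sigma> * nth_deriv 1 R (y0 + x) > 0"
        by (rule zero_less_mult_pos2[rotated])
      then show "\<exists>y. ((\<lambda>z. \<sigma> * (R (y0 + z) - R y0)) has_real_derivative y) (at x) \<and> 0 < y"
        using DERIV_cmult[OF R_deriv[of x], of \<sigma>] by blast
    qed (use that cont in auto)
    moreover have small: "\<bar>u\<bar> \<le> d" "\<bar>v\<bar> \<le> d" using that by auto
    ultimately have "E u ^ p < E v ^ p"
      by (simp only: R_eq_E)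
    moreover have "E v \<ge> 0"
      using E_sign(1)[OF small(2)] that by linarith
    ultimately show ?thesis
      by (rule power_less_imp_less_base)
  qed
  have left: "E u < E v" if "- d \<le> u" "u < v" "v \<le> 0" for u v
  proof -
    \<comment> \<open>The sign of \<open>x ^ (p - 1)\<close> for negative \<open>x\<close>; it turns
      \<open>slope\<close> into positivity of one derivative for both parities of
      \<open>p\<close>.\<close>
    define s :: real where "s = (- 1) ^ (p - 1)"
    have "(s * \<sigma>) * (R (y0 + u) - R y0) < (s * \<sigma>) * (R (y0 + v) - R y0)"
    proof (rule DERIV_pos_imp_increasing_open[of u v "\<lambda>z. (s * \<sigma>) * (R (y0 + z) - R y0)"])
      fix x assume x: "u < x" "x < v"
      have "x ^ (p - 1) = s * (- x) ^ (p - 1)"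
        by (simp add: s_def flip: power_mult_distrib)
      moreover have "\<bar>x\<bar> \<le> d" "x \<noteq> 0" using x that by auto
      note slope[OF this]
      ultimately have "(s * (\<sigma> * nth_deriv 1 R (y0 + x))) * (- x) ^ (p - 1) > 0"
        by (simp only: mult_ac)
      moreover have "(- x) ^ (p - 1) > 0" using x that by simp
      ultimately have "(s * \<sigma>) * nth_deriv 1 R (y0 + x) > 0"
        unfolding mult.assoc[of s \<sigma>] by (rule zero_less_mult_pos2)
      then show "\<exists>y. ((\<lambda>z. (s * \<sigma>) * (R (y0 + z) - R y0)) has_real_derivative y) (at x) \<and> 0 < y"
        using DERIV_cmult[OF R_deriv[of x], of "s * \<sigma>"] by blast
    qed (use that cont in auto)
    moreover have "(s * \<sigma>) * (R (y0 + x) - R y0) = - ((- E x) ^ p)" if "\<bar>x\<bar> \<le> d" for x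
    proof -
      have "(s * \<sigma>) * (R (y0 + x) - R y0) = s * E x ^ p"
        using R_eq_E[OF that] by (simp add: mult.assoc)
      moreover have "s = - ((- 1) ^ p)"
        using p_pos by (cases p) (auto simp: s_def)
      ultimately show ?thesis by (simp add: power_minus[of "E x"])
    qed
    moreover have small: "\<bar>u\<bar> \<le> d" "\<bar>v\<bar> \<le> d" using that by auto
    ultimately have "(- E v) ^ p < (- E u) ^ p"
      by (simp only: neg_less_iff_less)
    moreover have "- E u \<ge> 0"
      using E_sign(2)[OF small(1)] that by linarith
    ultimately have "- E v < - E u"
      by (rule power_less_imp_less_base)
    then show ?thesis by simp
  qed
  consider "z \<ge> 0" | "z' \<le> 0" | "z < 0" "z' > 0" by linarith
  then show ?thesis
  proof cases
    case 1
    then show ?thesis using right[OF _ assms(2,3)] by simp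
  next
    case 2
    then show ?thesis using left[OF assms(1,2)] by simp
  next
    case 3
    then have "\<bar>z\<bar> \<le> d" "\<bar>z'\<bar> \<le> d" using assms by auto
    with 3 have "E z < 0" "0 < E z'" by (simp_all add: E_sign)
    then show ?thesis by simp
  qed
qed

lemma E_less_iff: "\<bar>z\<bar> \<le> d \<Longrightarrow> \<bar>z'\<bar> \<le> d \<Longrightarrow> E z < E z' \<longleftrightarrow> z < z'"
  using E_strict_mono[of z z'] E_strict_mono[of z' z]
  by (cases z z' rule: linorder_cases) (auto simp: abs_le_iff)

text \<open>\<open>E\<close> is positive at \<open>d\<close> and negative at \<open>- d\<close>, and
  \<open>e0\<close> is the smaller of the two moduli. The ends are not attained for smaller
  \<open>e\<close>, hence the strict bound on \<open>Z\<close>.\<close>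

lemma E_inverse:
  "\<exists>Z e0. e0 > 0 \<and> (\<forall>e. \<bar>e\<bar> < e0 \<longrightarrow> \<bar>Z e\<bar> < d \<and> E (Z e) = e)"
proof -
  define e0 where "e0 = min (E d) (- E (- d))"
  have "\<exists>z. \<bar>z\<bar> < d \<and> E z = e" if "\<bar>e\<bar> < e0" for e
  proof -
    have "\<exists>z\<ge>- d. z \<le> d \<and> E z = e"
      by (rule IVT) (use that d_pos isCont_E H_sign(3) in \<open>auto simp: e0_def abs_le_iff\<close>)
    then obtain z where z: "- d \<le> z" "z \<le> d" "E z = e" by blast
    moreover from this that have "z \<noteq> d" "z \<noteq> - d" by (auto simp: e0_def)
    ultimately show ?thesis by (intro exI[of _ z]) auto
  qed
  then obtain Z where "\<And>e. \<bar>e\<bar> < e0 \<Longrightarrow> \<bar>Z e\<bar> < d \<and> E (Z e) = e"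
    by metis
  moreover have "e0 > 0"
    using E_sign[of d] E_sign[of "- d"] d_pos by (simp add: e0_def)
  ultimately show ?thesis by blast
qed

lemma G_bound: "\<bar>z\<bar> \<le> d \<Longrightarrow> \<bar>G z\<bar> \<le> (\<bar>a\<bar> / 2) powr (- 1 / p)"
  using H_sign(2)[of z] a_nonzero by (auto simp: G_def intro!: powr_mono2')

end

text \<open>\<open>Z\<close> is a mere choice of preimages under \<open>E\<close>; its limit,
  derivative and expansion at 0 are all drawn from z = E(z) G(z), that is, Z(e) = e G(Z(e)).\<close>

locale critical_inverse = critical_radius +
  fixes Z :: "real \<Rightarrow> real" and e0 :: real
  assumes e0: "e0 > 0" and Z_small: "\<And>e. \<bar>e\<bar> < e0 \<Longrightarrow> \<bar>Z e\<bar> < d"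
    and E_Z: "\<And>e. \<bar>e\<bar> < e0 \<Longrightarrow> E (Z e) = e"
begin

lemma Z_eq: "\<bar>e\<bar> < e0 \<Longrightarrow> Z e = e * G (Z e)"
  using E_G[of "Z e"] H_sign(3)[of "Z e"] Z_small[of e] E_Z[of e] by simp

lemma Z_zero: "Z 0 = 0"
  using Z_eq[of 0] e0 by simp

lemma Z_bigo: "Z \<in> O[nhds 0](\<lambda>e. e)"
proof (rule bigoI)
  show "\<forall>\<^sub>F e in nhds 0. norm (Z e) \<le> (\<bar>a\<bar> / 2) powr (- 1 / p) * norm e"
    unfolding nhds_0_iff
  proof (intro exI[of _ e0] conjI allI impI e0)
    fix e assume e: "\<bar>e\<bar> < e0"
    then show "norm (Z e) \<le> (\<bar>a\<bar> / 2) powr (- 1 / p) * norm e"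
      using G_bound[of "Z e"] Z_small[OF e]
      by (subst Z_eq) (auto simp: abs_mult mult.commute[of _ "\<bar>e\<bar>"] intro!: mult_left_mono)
  qed
qed

lemma Z_tendsto: "(Z \<longlongrightarrow> 0) (nhds 0)"
proof -
  obtain c where "\<forall>\<^sub>F e in nhds 0. norm (Z e) \<le> c * norm e"
    using Z_bigo by (auto simp: bigo_def)
  then show ?thesis
    by (rule Lim_null_comparison) (rule tendsto_eq_intros filterlim_ident | simp)+
qed

text \<open>Bootstrapping of Z(e) = e G(Z(e)): an expansion of \<open>Z\<close> to order
  \<open>N\<close> gives one of \<open>G (Z e)\<close> to order \<open>N\<close>, and the factor
  \<open>e\<close> raises it to order \<open>N + 1\<close>. The start is mere boundedness.\<close>

lemma Z_expandable: "expandable N (\<lambda>e. of_real (Z e))"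
proof (induction N)
  case 0
  have "(\<lambda>e. of_real (Z e) - poly 0 (of_real e)) \<in> O[nhds 0](\<lambda>e. complex_of_real (e ^ 0))"
  proof (rule bigoI[of _ d])
    show "\<forall>\<^sub>F e in nhds 0. norm (complex_of_real (Z e) - poly 0 (of_real e)) \<le> d * norm (complex_of_real (e ^ 0))"
      unfolding nhds_0_iff using e0 Z_small by (intro exI[of _ e0]) (simp add: less_imp_le)
  qed
  then show ?case by (rule expandableI)
next
  case (Suc N)
  obtain q where "(\<lambda>z. of_real (G z) - poly q (of_real z)) \<in> O[nhds 0](\<lambda>z. complex_of_real (z ^ N))"
    using G_expandable[of N] by (auto simp: expandable_def)
  then have "(\<lambda>e. of_real (G (Z e)) - poly q (of_real (Z e))) \<in> O[nhds 0](\<lambda>z. complex_of_real (z ^ N))"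
    by (rule expandable_compose[OF _ Z_bigo Z_tendsto])
  then have "expandable N (\<lambda>e. of_real (G (Z e)))"
    by (rule expandable_perturb[OF expandable_compose_poly[OF Suc]])
  from expandable_shift[OF this] show ?case
  proof (rule expandable_cong)
    show "\<forall>\<^sub>F e in nhds 0. complex_of_real (Z e) = of_real e * of_real (G (Z e))"
      unfolding nhds_0_iff of_real_mult[symmetric] of_real_eq_iff using e0 Z_eq by blast
  qed
qed

text \<open>The difference quotient of \<open>Z\<close> at 0 is \<open>G (Z e)\<close>
  itself.\<close>

lemma Z_deriv: "(Z has_real_derivative G 0) (at 0)"
proof -
  have "isCont G 0"
    unfolding G_def by (intro continuous_intros isCont_H) (use a_nonzero in \<open>simp add: H_def\<close>)
  moreover have "(Z \<longlongrightarrow> 0) (at 0)"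
    using Z_tendsto tendsto_at_iff_tendsto_nhds[of Z 0] Z_zero by simp
  ultimately have "((\<lambda>e. G (Z e)) \<longlongrightarrow> G 0) (at 0)"
    by (rule isCont_tendsto_compose)
  moreover have "\<forall>\<^sub>F e in at 0. G (Z e) = (Z e - Z 0) / (e - 0)"
  proof -
    have "\<forall>\<^sub>F e in at 0. \<bar>e\<bar> < e0"
      using e0 by (auto simp: eventually_at dist_real_def intro!: exI[of _ e0])
    moreover have "\<forall>\<^sub>F e in at (0::real). e \<noteq> 0" by (simp add: eventually_at_filter)
    ultimately show ?thesis
      by eventually_elim (use Z_eq Z_zero in \<open>simp add: field_simps\<close>)
  qed
  ultimately show ?thesis
    unfolding has_field_derivative_iff by (rule tendsto_cong[THEN iffD1, rotated])
qed

text \<open>On either side of the critical value, the levels at distance less than \<open>e ^ p\<close> fill the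
  interval between these two ends, up to \<open>y0\<close> itself.\<close>

definition lo :: "real \<Rightarrow> real \<Rightarrow> real" where
  "lo \<tau> e = (if \<tau> = \<sigma> \<longleftrightarrow> odd p then 0 else Z (- e))"

definition hi :: "real \<Rightarrow> real \<Rightarrow> real" where
  "hi \<tau> e = (if \<tau> = \<sigma> then Z e else 0)"

text \<open>Here \<tau> (R(y0 + z) - R(y0)) is \<tau> \<sigma> E(z)^p. For odd \<open>p\<close> the
  sign of E(z)^p is that of z, so exactly one side of \<open>y0\<close> belongs to \<tau>; for even
  \<open>p\<close> it is positive, so both sides or neither do. The upper bound becomes -e < E(z) <
  e, which monotonicity translates into the ends \<open>Z (- e)\<close> and
  \<open>Z e\<close>.\<close>

lemma level_iff:
  assumes "0 < e" "e < e0" "\<bar>z\<bar> < d" "z \<noteq> 0" "\<tau> \<in> {1, -1}"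
  shows "0 < \<tau> * (R (y0 + z) - R y0) \<and> \<tau> * (R (y0 + z) - R y0) < e ^ p \<longleftrightarrow>
    lo \<tau> e < z \<and> z < hi \<tau> e"
proof -
  have \<sigma>: "\<sigma> \<in> {1, -1}" using a_nonzero by (auto simp: \<sigma>_a sgn_if)
  have "\<tau> * (R (y0 + z) - R y0) = (\<tau> * \<sigma>) * (\<sigma> * (R (y0 + z) - R y0))"
    using \<sigma> by auto
  then have R: "\<tau> * (R (y0 + z) - R y0) = (\<tau> * \<sigma>) * E z ^ p"
    using R_eq_E[of z] assms by simp
  have small: "\<bar>z\<bar> \<le> d" "\<bar>Z e\<bar> \<le> d" "\<bar>Z (- e)\<bar> \<le> d"
    using assms Z_small[of e] Z_small[of "- e"] by (simp_all add: less_imp_le)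
  have EZ: "E (Z e) = e" "E (Z (- e)) = - e"
    using assms by (simp_all add: E_Z)
  have Z: "E z < e \<longleftrightarrow> z < Z e" "- e < E z \<longleftrightarrow> Z (- e) < z"
    using E_less_iff[OF small(1,2)] E_less_iff[OF small(3,1)] unfolding EZ by blast+
  have Zs: "Z e > 0" "Z (- e) < 0"
    using E_sign(1)[OF small(2)] E_sign(2)[OF small(3)] assms(1) unfolding EZ by simp_all
  define N where "N = \<bar>E z\<bar> ^ p"
  have pw: "N < e ^ p \<longleftrightarrow> z < Z e \<and> Z (- e) < z"
  proof -
    have "e ^ p \<le> N \<longleftrightarrow> e \<le> \<bar>E z\<bar>"
      unfolding N_def using p_pos assms(1) by (intro power_mono_iff) auto
    then have "N < e ^ p \<longleftrightarrow> \<bar>E z\<bar> < e" by linarith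
    also have "\<dots> \<longleftrightarrow> E z < e \<and> - e < E z" by linarith
    finally show ?thesis by (simp only: Z)
  qed
  have "E z \<noteq> 0" using E_sign[OF small(1)] assms(4) by linarith
  then have "N > 0" by (simp add: N_def)
  note E_sign = E_sign[OF small(1)]
  show ?thesis
  proof (cases "even p")
    case True
    then have "E z ^ p = N" by (simp add: N_def power_even_abs)
    note R = R[unfolded this]
    show ?thesis
    proof (cases "\<tau> = \<sigma>")
      case True
      then have "\<tau> * \<sigma> = 1" using \<sigma> by auto
      then have "\<tau> * (R (y0 + z) - R y0) = N" by (simp add: R)
      moreover have "lo \<tau> e = Z (- e)" "hi \<tau> e = Z e"
        using \<open>even p\<close> True by (simp_all add: lo_def hi_def)
      ultimately show ?thesis
        using \<open>N > 0\<close> pw by auto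
    next
      case False
      then have "\<tau> * \<sigma> = - 1" using \<sigma> assms(5) by auto
      then have "\<tau> * (R (y0 + z) - R y0) = - N" by (simp add: R)
      moreover have "lo \<tau> e = 0" "hi \<tau> e = 0"
        using \<open>even p\<close> False by (simp_all add: lo_def hi_def)
      ultimately show ?thesis
        using \<open>N > 0\<close> by auto
    qed
  next
    case False
    have Ez: "E z ^ p = sgn z * N"
      using E_sign False assms(4) by (cases "z > 0") (auto simp: N_def sgn_if power_minus_odd)
    note R = R[unfolded this]
    show ?thesis
    proof (cases "\<tau> = \<sigma>")
      case True
      then have "\<tau> * \<sigma> = 1" using \<sigma> by auto
      then have "\<tau> * (R (y0 + z) - R y0) = sgn z * N" by (simp add: R)
      moreover have "lo \<tau> e = 0" "hi \<tau> e = Z e"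
        using False True by (simp_all add: lo_def hi_def)
      ultimately show ?thesis
        using \<open>N > 0\<close> pw Zs assms(4) by (cases "z > 0") auto
    next
      case neq: False
      then have "\<tau> * \<sigma> = - 1" using \<sigma> assms(5) by auto
      then have "\<tau> * (R (y0 + z) - R y0) = - sgn z * N" by (simp add: R)
      moreover have "lo \<tau> e = Z (- e)" "hi \<tau> e = 0"
        using False neq by (simp_all add: lo_def hi_def)
      ultimately show ?thesis
        using \<open>N > 0\<close> pw Zs assms(4) by (cases "z > 0") auto
    qed
  qed
qed

lemma lo_hi_bounds:
  assumes "0 < e" "e < e0"
  shows "- d < lo \<tau> e" "lo \<tau> e \<le> 0" "0 \<le> hi \<tau> e" "hi \<tau> e < d"
proof -
  have small: "\<bar>Z e\<bar> < d" "\<bar>Z (- e)\<bar> < d"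
    using assms Z_small[of e] Z_small[of "- e"] by simp_all
  have EZ: "E (Z e) = e" "E (Z (- e)) = - e"
    using assms by (simp_all add: E_Z)
  have Zs: "Z e > 0" "Z (- e) < 0"
    using E_sign(1)[OF less_imp_le[OF small(1)]] E_sign(2)[OF less_imp_le[OF small(2)]] assms(1)
    unfolding EZ by simp_all
  show "- d < lo \<tau> e" "lo \<tau> e \<le> 0" "0 \<le> hi \<tau> e" "hi \<tau> e < d"
    using Zs small d_pos by (auto simp: lo_def hi_def)
qed

text \<open>The level set and the interval between the two ends agree off three points. The
  antiderivative \<open>P\<close> is given rather than chosen, so that one \<open>P\<close> serves
  all \<open>e\<close> and can be expanded.\<close>

lemma level_integral:
  fixes W P :: "real \<Rightarrow> complex"
  assumes W: "continuous_on UNIV W"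
    and P: "\<forall>y. \<bar>y - y0\<bar> \<le> d \<longrightarrow> (P has_vector_derivative W y) (at y)"
    and e: "0 < e" "e < e0" and \<tau>: "\<tau> \<in> {1, -1}"
  shows "(LINT y|lborel. indicator {y. \<bar>y - y0\<bar> < d \<and> 0 < \<tau> * (R y - R y0) \<and> \<tau> * (R y - R y0) < e ^ p} y *\<^sub>R W y)
    = P (y0 + hi \<tau> e) - P (y0 + lo \<tau> e)"
proof -
  let ?S = "{y. \<bar>y - y0\<bar> < d \<and> 0 < \<tau> * (R y - R y0) \<and> \<tau> * (R y - R y0) < e ^ p}"
  let ?T = "{y0 + lo \<tau> e..y0 + hi \<tau> e}"
  note bounds = lo_hi_bounds[OF e, of \<tau>]
  have [measurable]: "R \<in> borel_measurable borel" "W \<in> borel_measurable borel"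
    using smooth_circle_continuous[OF smooth] W by (auto intro: borel_measurable_continuous_onI)
  have "{y0, y0 + lo \<tau> e, y0 + hi \<tau> e} \<in> null_sets lborel"
    by (rule finite_imp_null_set_lborel) simp
  then have "AE y in lborel. y \<notin> {y0, y0 + lo \<tau> e, y0 + hi \<tau> e}"
    by (rule AE_not_in)
  then have "AE y in lborel. indicator ?S y *\<^sub>R W y = indicator ?T y *\<^sub>R W y"
  proof eventually_elim
    case (elim y)
    have "y \<in> ?S \<longleftrightarrow> y \<in> ?T"
    proof (cases "\<bar>y - y0\<bar> < d")
      case True
      then show ?thesis
        using level_iff[OF e True, of \<tau>] elim \<tau> by auto
    next
      case False
      then show ?thesis using bounds by auto
    qed
    then show ?case by (simp add: indicator_def)
  qed
  moreover have "?S \<in> sets borel" by measurable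
  ultimately have "(LINT y|lborel. indicator ?S y *\<^sub>R W y) = (LINT y|lborel. indicator ?T y *\<^sub>R W y)"
    by (intro integral_cong_AE) (auto intro!: borel_measurable_scaleR borel_measurable_indicator)
  also have "\<dots> = P (y0 + hi \<tau> e) - P (y0 + lo \<tau> e)"
  proof (rule integral_FTC_atLeastAtMost)
    fix y assume "y0 + lo \<tau> e \<le> y" "y \<le> y0 + hi \<tau> e"
    with bounds have "\<bar>y - y0\<bar> \<le> d" by auto
    from P[rule_format, OF this] show "(P has_vector_derivative W y) (at y within ?T)"
      by (rule has_vector_derivative_at_within)
  qed (use bounds W in \<open>auto intro: continuous_on_subset\<close>)
  finally show ?thesis .
qed

text \<open>With F(e) = P(y0 + Z(e)) the difference is F(e) - F(0), F(0) - F(-e), F(e) - F(-e) or 0.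
  The third is odd in \<open>e\<close>, which kills the second coefficient for even
  \<open>p\<close>, and F'(0) = G(0) W(y0) is the source of the first.\<close>

lemma endpoint_expansion:
  fixes W P :: "real \<Rightarrow> complex"
  assumes W: "smooth_circle W"
    and P: "\<forall>y. \<bar>y - y0\<bar> \<le> d \<longrightarrow> (P has_vector_derivative W y) (at y)"
    and N: "N \<ge> 2"
  shows "\<exists>r. (\<lambda>e. P (y0 + hi \<tau> e) - P (y0 + lo \<tau> e) - poly r (of_real e)) \<in> O[nhds 0](\<lambda>e. of_real (e ^ N)) \<and>
    coeff r 1 = (if odd p then 1 else if \<tau> = \<sigma> then 2 else 0) * of_real (G 0) * W y0 \<and>
    (even p \<longrightarrow> coeff r 2 = 0)"
proof -
  define F where "F e = P (y0 + Z e)" for e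
  \<comment> \<open>The successive derivatives of the antiderivative \<open>P\<close>.\<close>
  define D where "D n = (case n of 0 \<Rightarrow> P | Suc n \<Rightarrow> nth_deriv n W)" for n
  have "(D n has_vector_derivative D (Suc n) x) (at x)" if "\<bar>x - y0\<bar> \<le> d" for n x
    using P[rule_format, OF that] smooth_circle_nth_deriv_has_vector_derivative[OF W] by (cases n) (auto simp: D_def)
  from expandable_taylor[of y0 d D, OF this d_pos]
  have "expandable N (\<lambda>z. P (y0 + z))" by (simp add: D_def)
  then obtain qP where "(\<lambda>z. P (y0 + z) - poly qP (of_real z)) \<in> O[nhds 0](\<lambda>e. of_real (e ^ N))"
    by (auto simp: expandable_def)
  then have "(\<lambda>e. P (y0 + Z e) - poly qP (of_real (Z e))) \<in> O[nhds 0](\<lambda>e. of_real (e ^ N))"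
    by (rule expandable_compose[OF _ Z_bigo Z_tendsto])
  then have "expandable N F"
    unfolding F_def by (rule expandable_perturb[OF expandable_compose_poly[OF Z_expandable]])
  then obtain q where q: "(\<lambda>e. F e - poly q (of_real e)) \<in> O[nhds 0](\<lambda>e. of_real (e ^ N))"
    by (auto simp: expandable_def)
  define q' where "q' = pcompose q [:0, -1:]"
  have F0: "F 0 = P y0" by (simp add: F_def Z_zero)
  have "filterlim uminus (nhds 0) (nhds (0::real))"
    using tendsto_minus[OF filterlim_ident[of "nhds (0::real)"]] by simp
  from landau_o.big.compose[OF q this]
  have q': "(\<lambda>e. F (- e) - poly q' (of_real e)) \<in> O[nhds 0](\<lambda>e. of_real (e ^ N))"
    by (simp add: q'_def poly_pcompose bigo_def norm_power)
  have coeff_q': "coeff q' i = (- 1) ^ i * coeff q i" for i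
    by (simp add: q'_def coeff_pcompose_linear)
  have "coeff q 1 = of_real (G 0) * W y0"
  proof -
    \<comment> \<open>The linear coefficient is identified through the derivative at 0; the error is
      o(e) because \<open>N\<close> is at least 2.\<close>
    have "((\<lambda>e. F e - poly q (of_real e)) has_vector_derivative 0) (at 0)"
    proof -
      obtain C where C0: "C > 0" and "\<forall>\<^sub>F e in nhds 0. norm (F e - poly q (of_real e)) \<le> C * norm (complex_of_real (e ^ N))"
        using q by (auto simp: bigo_def)
      then obtain b where b: "b > 0" "\<And>e. \<bar>e\<bar> < b \<Longrightarrow> norm (F e - poly q (of_real e)) \<le> C * \<bar>e\<bar> ^ N"
        by (auto simp: nhds_0_iff norm_power)
      from b(2)[of 0] b(1) N have zero: "F 0 - poly q (of_real 0) = 0" by (simp add: power_0_left)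
      have "((\<lambda>e. norm (F e - poly q (of_real e)) / norm e) \<longlongrightarrow> 0) (at 0)"
      proof (rule Lim_null_comparison)
        have "\<forall>\<^sub>F e in at 0. \<bar>e\<bar> < min b 1"
          using b(1) by (auto simp: eventually_at dist_real_def intro!: exI[of _ "min b 1"])
        then show "\<forall>\<^sub>F e in at 0. norm (norm (F e - poly q (of_real e)) / norm e) \<le> C * \<bar>e\<bar>"
        proof eventually_elim
          case (elim e)
          then have "norm (F e - poly q (of_real e)) \<le> C * \<bar>e\<bar> ^ N" by (intro b(2)) auto
          also have "\<dots> \<le> C * \<bar>e\<bar> ^ 2"
            using elim N C0 by (intro mult_left_mono power_decreasing) auto
          also have "\<dots> = (C * \<bar>e\<bar>) * norm e" by (simp add: power2_eq_square)
          finally show ?case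
            using C0 by (cases "e = 0") (simp_all add: pos_divide_le_eq)
        qed
        show "((\<lambda>e. C * \<bar>e\<bar>) \<longlongrightarrow> 0) (at 0)"
          by (rule tendsto_eq_intros | simp)+
      qed
      then show ?thesis
        using zero by (simp add: has_vector_derivative_def has_derivative_iff_norm)
    qed
    moreover have "(F has_vector_derivative G 0 *\<^sub>R W y0) (at 0)"
    proof -
      have "((\<lambda>e. y0 + Z e) has_vector_derivative G 0) (at 0)"
        using Z_deriv by (auto simp: has_real_derivative_iff_has_vector_derivative[symmetric] intro!: derivative_eq_intros)
      moreover have "(P has_vector_derivative W y0) (at (y0 + Z 0))"
        using P[rule_format, of y0] d_pos by (simp add: Z_zero)
      ultimately show ?thesis
        using vector_diff_chain_at[of "\<lambda>e. y0 + Z e" "G 0" 0 P "W y0"] unfolding F_def o_def by blast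
    qed
    ultimately have "((\<lambda>e. F e - (F e - poly q (of_real e))) has_vector_derivative G 0 *\<^sub>R W y0 - 0) (at 0)"
      by (intro has_vector_derivative_diff)
    moreover have "((\<lambda>e. poly q (of_real e)) has_vector_derivative coeff q 1) (at 0)"
    proof -
      have "(poly q has_field_derivative poly (pderiv q) 0) (at (of_real 0))"
        by (simp add: poly_DERIV)
      from has_vector_derivative_real_field[OF this] show ?thesis
        by (simp add: poly_0_coeff_0 coeff_pderiv)
    qed
    ultimately show ?thesis
      using vector_derivative_unique_at by (fastforce simp: scaleR_conv_of_real)
  qed
  note q1 = this
  \<comment> \<open>In the last case both ends are \<open>y0\<close>: there are no points on that
    side of the critical value.\<close>
  consider "odd p" "\<tau> = \<sigma>" | "odd p" "\<tau> \<noteq> \<sigma>" | "even p" "\<tau> = \<sigma>" | "even p" "\<tau> \<noteq> \<sigma>" by blast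
  then show ?thesis
  proof cases
    case 1
    have "(\<lambda>e. P (y0 + hi \<tau> e) - P (y0 + lo \<tau> e) - poly (q - [:P y0:]) (of_real e)) \<in> O[nhds 0](\<lambda>e. of_real (e ^ N))"
      using q 1 by (simp add: lo_def hi_def F_def algebra_simps)
    then show ?thesis
      using 1 q1 by (intro exI[of _ "q - [:P y0:]"]) auto
  next
    case 2
    have "(\<lambda>e. - (F (- e) - poly q' (of_real e))) \<in> O[nhds 0](\<lambda>e. of_real (e ^ N))"
      using q' by (simp only: landau_o.big.uminus_in_iff)
    then have "(\<lambda>e. P (y0 + hi \<tau> e) - P (y0 + lo \<tau> e) - poly ([:P y0:] - q') (of_real e)) \<in> O[nhds 0](\<lambda>e. of_real (e ^ N))"
      using 2 by (simp add: lo_def hi_def F_def algebra_simps)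
    then show ?thesis
      using 2 q1 by (intro exI[of _ "[:P y0:] - q'"]) (auto simp: coeff_q')
  next
    case 3
    have "(\<lambda>e. P (y0 + hi \<tau> e) - P (y0 + lo \<tau> e) - poly (q - q') (of_real e)) \<in> O[nhds 0](\<lambda>e. of_real (e ^ N))"
      using sum_in_bigo(2)[OF q q'] 3 by (simp add: lo_def hi_def F_def algebra_simps)
    then show ?thesis
      using 3 q1 by (intro exI[of _ "q - q'"]) (auto simp: coeff_q')
  next
    case 4
    then show ?thesis
      by (intro exI[of _ 0]) (simp add: lo_def hi_def)
  qed
qed

end

section \<open>Integrals over small level sets near one solution\<close>

context critical_point
begin

lemma G_zero: "G 0 = \<bar>a\<bar> powr (- 1 / p)"
  by (simp add: G_def H_def)

text \<open>The substitution e = s^(1/p) in the endpoint expansion. It is stated for every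
  sufficiently small \<delta>, because the neighbourhoods of several solutions have to be shrunk
  together later; the two recorded coefficients do not depend on \<delta>.\<close>

lemma local_expansion:
  fixes W :: "real \<Rightarrow> complex" and N :: nat
  assumes W: "smooth_circle W" and \<tau>: "\<tau> \<in> {1, -1}" and N: "N \<ge> 2"
  shows "\<exists>\<delta>0>0. (\<forall>y. \<bar>y - y0\<bar> < \<delta>0 \<and> y \<noteq> y0 \<longrightarrow> R y \<noteq> R y0) \<and>
    (\<forall>\<delta>. 0 < \<delta> \<and> \<delta> \<le> \<delta>0 \<longrightarrow> (\<exists>r. (\<lambda>s. (LINT y|lborel. indicator {y. \<bar>y - y0\<bar> < \<delta> \<and> 0 < \<tau> * (R y - R y0) \<and> \<tau> * (R y - R y0) < s} y *\<^sub>R W y)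
          - poly r (complex_of_real (s powr (1 / p)))) \<in> O[at_right 0](\<lambda>s. of_real (s powr (N / p))) \<and>
        coeff r 1 = (if odd p then 1 else if \<tau> = sgn (nth_deriv p R y0) then 2 else 0)
          * of_real (\<bar>nth_deriv p R y0 / fact p\<bar> powr (- 1 / p)) * W y0 \<and>
        (even p \<longrightarrow> coeff r 2 = 0)))"
proof -
  obtain d where d: "d > 0"
    "\<And>z. \<bar>z\<bar> \<le> d \<Longrightarrow> \<bar>H z - a\<bar> \<le> \<bar>a\<bar> / 2"
    "\<And>z. \<bar>z\<bar> \<le> d \<Longrightarrow> z \<noteq> 0 \<Longrightarrow> \<sigma> * nth_deriv 1 R (y0 + z) * z ^ (p - 1) > 0"
    using good_radius by blast
  interpret critical_radius R y0 p d
    by unfold_locales (use d in auto)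
  show ?thesis
  proof (intro exI[of _ d] conjI allI impI d(1))
    fix y assume "\<bar>y - y0\<bar> < d \<and> y \<noteq> y0"
    then show "R y \<noteq> R y0"
      using R_eq_H[of "y - y0"] H_sign(3)[of "y - y0"] by auto
  next
    fix \<delta> :: real
    assume "0 < \<delta> \<and> \<delta> \<le> d"
    then have \<delta>: "0 < \<delta>" "\<delta> \<le> d" by simp_all
    \<comment> \<open>The inverse is chosen anew for the smaller radius, so that its values stay
      within \<delta>.\<close>
    interpret \<delta>: critical_radius R y0 p \<delta>
      by unfold_locales (use d(2,3) \<delta> order_trans[OF _ \<delta>(2)] in blast)+
    obtain Z e0 where Z: "e0 > 0" "\<forall>e. \<bar>e\<bar> < e0 \<longrightarrow> \<bar>Z e\<bar> < \<delta> \<and> E (Z e) = e"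
      using \<delta>.E_inverse by (elim exE conjE)
    interpret Z: critical_inverse R y0 p \<delta> Z e0
      by unfold_locales (use Z in auto)
    \<comment> \<open>The margin 1 makes the derivative two-sided also at distance exactly
      \<delta>.\<close>
    obtain P where P: "\<And>y. y \<in> {y0 - \<delta> - 1..y0 + \<delta> + 1} \<Longrightarrow>
        (P has_vector_derivative W y) (at y within {y0 - \<delta> - 1..y0 + \<delta> + 1})"
      using antiderivative_continuous[OF smooth_circle_continuous[OF W]] by blast
    have P': "\<forall>y. \<bar>y - y0\<bar> \<le> \<delta> \<longrightarrow> (P has_vector_derivative W y) (at y)"
    proof (intro allI impI)
      fix y assume that: "\<bar>y - y0\<bar> \<le> \<delta>"
      have "y \<in> interior {y0 - \<delta> - 1..y0 + \<delta> + 1}"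
        using that by auto
      then show "(P has_vector_derivative W y) (at y)"
        using P[of y] interior_subset by (metis at_within_interior subsetD)
    qed
    obtain r where r: "(\<lambda>e. P (y0 + Z.hi \<tau> e) - P (y0 + Z.lo \<tau> e) - poly r (of_real e)) \<in> O[nhds 0](\<lambda>e. of_real (e ^ N))"
      "coeff r 1 = (if odd p then 1 else if \<tau> = \<sigma> then 2 else 0) * of_real (G 0) * W y0"
      "even p \<Longrightarrow> coeff r 2 = 0"
      using Z.endpoint_expansion[OF W P' N, of \<tau>] by (elim exE conjE) simp
    have lim: "filterlim (\<lambda>s. s powr (1 / p)) (nhds 0) (at_right 0)"
    proof -
      have "((\<lambda>s::real. s powr (1 / p)) \<longlongrightarrow> 0 powr (1 / p)) (at_right 0)"
        by (rule tendsto_powr') (use p_pos in \<open>auto simp: eventually_at_filter\<close>)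
      then show ?thesis by simp
    qed
    have pos: "\<forall>\<^sub>F s in at_right (0::real). s > 0"
      by (simp add: eventually_at_filter)
    have "(\<lambda>s. P (y0 + Z.hi \<tau> (s powr (1 / p))) - P (y0 + Z.lo \<tau> (s powr (1 / p)))
        - poly r (of_real (s powr (1 / p)))) \<in> O[at_right 0](\<lambda>s. of_real ((s powr (1 / p)) ^ N))"
      by (rule landau_o.big.compose[OF r(1) lim])
    also have "?this \<longleftrightarrow> (\<lambda>s. (LINT y|lborel. indicator {y. \<bar>y - y0\<bar> < \<delta> \<and> 0 < \<tau> * (R y - R y0) \<and> \<tau> * (R y - R y0) < s} y *\<^sub>R W y)
          - poly r (complex_of_real (s powr (1 / p)))) \<in> O[at_right 0](\<lambda>s. of_real (s powr (N / p)))"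
    proof (rule landau_o.big.cong_ex)
      have "\<forall>\<^sub>F s in at_right 0. s powr (1 / p) < e0"
        using order_tendstoD(2)[OF lim Z(1)] .
      then show "\<forall>\<^sub>F s in at_right 0. P (y0 + Z.hi \<tau> (s powr (1 / p))) - P (y0 + Z.lo \<tau> (s powr (1 / p)))
        - poly r (of_real (s powr (1 / p))) = (LINT y|lborel. indicator {y. \<bar>y - y0\<bar> < \<delta> \<and> 0 < \<tau> * (R y - R y0) \<and> \<tau> * (R y - R y0) < s} y *\<^sub>R W y)
          - poly r (complex_of_real (s powr (1 / p)))"
        using pos
      proof eventually_elim
        case (elim s)
        then have s: "(s powr (1 / p)) ^ p = s"
          using p_pos by (simp add: powr_realpow[symmetric] powr_powr)
        show ?case
          using Z.level_integral[OF smooth_circle_continuous[OF W] P' _ elim(1) \<tau>] elim(2)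
          by (simp add: s)
      qed
      show "\<forall>\<^sub>F s in at_right 0. complex_of_real ((s powr (1 / p)) ^ N) = of_real (s powr (N / p))"
        using pos
      proof eventually_elim
        case (elim s)
        then show ?case
          by (subst powr_realpow[symmetric]) (simp_all add: powr_powr)
      qed
    qed
    finally show "\<exists>r. (\<lambda>s. (LINT y|lborel. indicator {y. \<bar>y - y0\<bar> < \<delta> \<and> 0 < \<tau> * (R y - R y0) \<and> \<tau> * (R y - R y0) < s} y *\<^sub>R W y)
          - poly r (complex_of_real (s powr (1 / p)))) \<in> O[at_right 0](\<lambda>s. of_real (s powr (N / p))) \<and>
        coeff r 1 = (if odd p then 1 else if \<tau> = sgn (nth_deriv p R y0) then 2 else 0)
          * of_real (\<bar>nth_deriv p R y0 / fact p\<bar> powr (- 1 / p)) * W y0 \<and>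
        (even p \<longrightarrow> coeff r 2 = 0)"
      using r(2,3) unfolding \<sigma>_def G_zero a_def by blast
  qed
qed

end

subsection \<open>From the evolution to level sets\<close>

text \<open>Exponents may coincide for different indices, so only the total coefficient of a power
  is determined. If some power below \<open>b\<close> had a nonzero total, dividing by the lowest
  such power and letting s tend to 0 would give a nonzero limit against the error bound.\<close>

lemma powr_expansion_unique:
  fixes c :: "'i \<Rightarrow> complex" and x :: "'i \<Rightarrow> real"
  assumes "finite I"
    and bigo: "(\<lambda>s. \<Sum>i\<in>I. c i * of_real (s powr x i)) \<in> O[at_right 0](\<lambda>s. of_real (s powr b))"
    and "\<alpha> < b"
  shows "(\<Sum>i | i \<in> I \<and> x i = \<alpha>. c i) = 0"
proof (rule ccontr)
  define C where "C \<beta> = (\<Sum>i | i \<in> I \<and> x i = \<beta>. c i)" for \<beta>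
  \<comment> \<open>Only exponents below \<open>b\<close> compete; the others are hidden in the
    error.\<close>
  define A where "A = {\<beta> \<in> x ` I. \<beta> < b \<and> C \<beta> \<noteq> 0}"
  assume "(\<Sum>i | i \<in> I \<and> x i = \<alpha>. c i) \<noteq> 0"
  then have "C \<alpha> \<noteq> 0" by (simp add: C_def)
  moreover from this have "\<alpha> \<in> x ` I"
    by (rule contrapos_np) (auto simp: C_def intro!: sum.neutral)
  ultimately have A: "finite A" "A \<noteq> {}"
    using assms by (auto simp: A_def)
  define \<mu> where "\<mu> = Min A"
  have \<mu>: "\<mu> \<in> x ` I" "\<mu> < b" "C \<mu> \<noteq> 0"
    using Min_in[OF A] by (auto simp: \<mu>_def A_def)
  have small: "C \<beta> = 0" if "\<beta> \<in> x ` I" "\<beta> < \<mu>" for \<beta>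
    using that Min_le[OF A(1), of \<beta>] \<mu>(2) by (force simp: \<mu>_def A_def)
  have pos: "\<forall>\<^sub>F s in at_right (0::real). s > 0"
    by (simp add: eventually_at_filter)
  have powr0: "((\<lambda>s::real. s powr e) \<longlongrightarrow> 0) (at_right 0)" if "e > 0" for e
  proof -
    have "((\<lambda>s::real. s powr e) \<longlongrightarrow> 0 powr e) (at_right 0)"
      by (rule tendsto_powr') (use that in \<open>auto simp: eventually_at_filter\<close>)
    then show ?thesis by simp
  qed
  define f where "f s = (\<Sum>i\<in>I. c i * complex_of_real (s powr x i)) * of_real (s powr (- \<mu>))" for s
  have f_eq: "f s = (\<Sum>\<beta>\<in>x ` I. C \<beta> * of_real (s powr (\<beta> - \<mu>)))" for s
  proof -
    have "(\<Sum>i\<in>I. c i * complex_of_real (s powr x i)) = (\<Sum>\<beta>\<in>x ` I. \<Sum>i | i \<in> I \<and> x i = \<beta>. c i * of_real (s powr x i))"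
      by (rule sum.image_gen[OF assms(1)])
    also have "\<dots> = (\<Sum>\<beta>\<in>x ` I. C \<beta> * of_real (s powr \<beta>))"
      unfolding C_def sum_distrib_right by (intro sum.cong) auto
    finally show ?thesis
      by (simp add: f_def sum_distrib_right powr_add[of _ _ "- \<mu>", simplified] mult.assoc)
  qed
  have "(f \<longlongrightarrow> (\<Sum>\<beta>\<in>x ` I. if \<beta> = \<mu> then C \<mu> else 0)) (at_right 0)"
    unfolding f_eq
  proof (rule tendsto_sum)
    fix \<beta> assume \<beta>: "\<beta> \<in> x ` I"
    consider "\<beta> < \<mu>" | "\<beta> = \<mu>" | "\<beta> > \<mu>" by linarith
    then show "((\<lambda>s. C \<beta> * of_real (s powr (\<beta> - \<mu>))) \<longlongrightarrow> (if \<beta> = \<mu> then C \<mu> else 0)) (at_right 0)"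
    proof cases
      case 1
      then show ?thesis using small[OF \<beta>] by simp
    next
      case 2
      have "\<forall>\<^sub>F s in at_right 0. C \<mu> = C \<beta> * of_real (s powr (\<beta> - \<mu>))"
        using pos by eventually_elim (use 2 in simp)
      then show ?thesis using 2 by (auto intro: Lim_transform_eventually[OF tendsto_const])
    next
      case 3
      then have "((\<lambda>s. C \<beta> * of_real (s powr (\<beta> - \<mu>))) \<longlongrightarrow> C \<beta> * of_real 0) (at_right 0)"
        by (intro tendsto_mult tendsto_const tendsto_of_real powr0) simp
      then show ?thesis using 3 by simp
    qed
  qed
  then have "(f \<longlongrightarrow> C \<mu>) (at_right 0)"
    using \<mu>(1) assms(1) by (simp add: sum.delta)
  moreover have "(f \<longlongrightarrow> 0) (at_right 0)"
  proof -
    obtain B where B: "B > 0" and ev: "\<forall>\<^sub>F s in at_right 0. norm (\<Sum>i\<in>I. c i * complex_of_real (s powr x i)) \<le> B * norm (complex_of_real (s powr b))"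
      using bigo by (auto simp: bigo_def)
    from ev have "\<forall>\<^sub>F s in at_right 0. norm (f s) \<le> B * s powr (b - \<mu>)"
      using pos
    proof eventually_elim
      case (elim s)
      have "norm (f s) \<le> B * s powr b * s powr (- \<mu>)"
        unfolding f_def norm_mult using elim B by (intro mult_mono) auto
      then show ?case by (simp add: mult.assoc flip: powr_add)
    qed
    moreover have "((\<lambda>s. B * s powr (b - \<mu>)) \<longlongrightarrow> 0) (at_right 0)"
      using tendsto_mult[OF tendsto_const powr0[of "b - \<mu>"], of B] \<mu>(2) by simp
    ultimately show ?thesis by (rule Lim_null_comparison)
  qed
  ultimately have "C \<mu> = 0"
    by (rule tendsto_unique[OF trivial_limit_at_right_real])
  with \<mu>(3) show False by simp
qed

text \<open>Stone-Weierstrass for a bounded functional that kills all exponentials. The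
  approximating ring must consist of real functions, while the exponentials are complex; this is
  bridged by working with multipliers.\<close>

lemma functional_vanishes_of_exp:
  fixes L :: "(real \<Rightarrow> complex) \<Rightarrow> complex"
  assumes K: "K > 0"
    and L_add: "\<And>f g. continuous_on {-K..K} f \<Longrightarrow> continuous_on {-K..K} g \<Longrightarrow> L (\<lambda>x. f x + g x) = L f + L g"
    and scale: "\<And>c f. continuous_on {-K..K} f \<Longrightarrow> L (\<lambda>x. c * f x) = c * L f"
    and bound: "\<And>e f. continuous_on {-K..K} f \<Longrightarrow> (\<And>x. x \<in> {-K..K} \<Longrightarrow> norm (f x) \<le> e) \<Longrightarrow> norm (L f) \<le> B * e"
    and exp0: "\<And>t. L (\<lambda>x. exp (\<i> * of_real t * of_real x)) = 0"
    and h: "continuous_on {-K..K} h"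
  shows "L (\<lambda>x. complex_of_real (h x)) = 0"
proof -
  let ?S = "{-K..K}"
  define good where "good k \<longleftrightarrow> continuous_on ?S k \<and> (\<forall>t. L (\<lambda>x. k x * exp (\<i> * of_real t * of_real x)) = 0)" for k
  \<comment> \<open>The real multipliers that preserve the functions annihilated together with all
    their exponential multiples. Such multipliers are closed under products without any
    multiplicativity of \<open>L\<close>.\<close>
  define A where "A = {u. continuous_on ?S u \<and> (\<forall>k. good k \<longrightarrow> good (\<lambda>x. k x * complex_of_real (u x)))}"
  have cexp: "continuous_on ?S (\<lambda>x. exp (\<i> * of_real t * of_real x))" for t
    by (intro continuous_intros)
  have good_1: "good (\<lambda>_. 1)" by (simp add: good_def exp0)
  have good_add: "good (\<lambda>x. k x + k' x)" if "good k" "good k'" for k k'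
    using that L_add[OF continuous_on_mult[OF _ cexp] continuous_on_mult[OF _ cexp], of k k']
    by (auto simp: good_def distrib_right intro: continuous_on_add)
  have good_scale: "good (\<lambda>x. c * k x)" if "good k" for c k
    using that scale[OF continuous_on_mult[OF _ cexp], of k c]
    by (auto simp: good_def mult.assoc intro: continuous_on_mult continuous_on_const)
  have good_exp: "good (\<lambda>x. k x * exp (\<i> * of_real t * of_real x))" if "good k" for k t
  proof -
    have "exp (\<i> * of_real t * of_real x) * exp (\<i> * of_real t' * of_real x) = exp (\<i> * of_real (t + t') * of_real x)" for t' x
      by (simp add: exp_add[symmetric] algebra_simps)
    then have "L (\<lambda>x. (k x * exp (\<i> * of_real t * of_real x)) * exp (\<i> * of_real t' * of_real x)) =
        L (\<lambda>x. k x * exp (\<i> * of_real (t + t') * of_real x))" for t'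
      by (simp only: mult.assoc[of "k _"])
    then show ?thesis
      using that cexp unfolding good_def by (simp only: continuous_on_mult simp_thms)
  qed
  interpret function_ring_on A ?S
  proof
    fix u v assume u: "u \<in> A" and v: "v \<in> A"
    show "(\<lambda>x. u x * v x) \<in> A"
    proof -
      have "good (\<lambda>x. k x * complex_of_real (u x * v x))" if "good k" for k
      proof -
        have "good (\<lambda>x. k x * complex_of_real (u x))" using u that by (simp add: A_def)
        then have "good (\<lambda>x. (k x * complex_of_real (u x)) * complex_of_real (v x))"
          using v by (simp add: A_def)
        then show ?thesis by (simp add: mult.assoc)
      qed
      then show ?thesis using u v by (auto simp: A_def intro: continuous_on_mult)
    qed
    show "(\<lambda>x. u x + v x) \<in> A"
      using u v good_add by (auto simp: A_def distrib_left intro: continuous_on_add)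
    show "continuous_on ?S u" using u by (simp add: A_def)
  next
    fix c :: real
    have "good (\<lambda>x. k x * complex_of_real c)" if "good k" for k
      using good_scale[OF that, of "of_real c"] by (simp add: mult.commute)
    then show "(\<lambda>_. c) \<in> A"
      by (simp add: A_def)
  next
    fix x y assume xy: "x \<in> ?S" "y \<in> ?S" "x \<noteq> y"
    show "\<exists>f\<in>A. f x \<noteq> f y"
    \<comment> \<open>The scaling puts x / K into [-1, 1], where the sine is injective; as a
      combination of the exponentials with t = 1/K and t = -1/K it is a multiplier.\<close>
    proof (rule bexI[of _ "\<lambda>x. sin (x / K)"])
      have b: "- (pi / 2) \<le> u / K" "u / K \<le> pi / 2" if "u \<in> ?S" for u
      proof -
        have "- 1 \<le> u / K" "u / K \<le> 1"
          using that K by (auto simp: pos_le_divide_eq pos_divide_le_eq)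
        then show "- (pi / 2) \<le> u / K" "u / K \<le> pi / 2" using pi_ge_two by linarith+
      qed
      have "sin (x / K) = sin (y / K) \<Longrightarrow> x / K = y / K"
        by (rule sin_inj_pi[OF b[OF xy(1)] b[OF xy(2)]])
      then show "sin (x / K) \<noteq> sin (y / K)" using xy K by auto
      have "good (\<lambda>x. k x * complex_of_real (sin (x / K)))" if "good k" for k
      proof -
        have sin: "complex_of_real (sin (x / K)) =
          (- \<i> / 2) * exp (\<i> * of_real (1 / K) * of_real x) + (\<i> / 2) * exp (\<i> * of_real (- 1 / K) * of_real x)" for x
        proof -
          have "(u - v) / (2 * \<i>) = (- \<i> / 2) * u + (\<i> / 2) * v" for u v :: complex
            by (simp add: field_simps)
          then show ?thesis
            unfolding sin_of_real[symmetric] sin_exp_eq by simp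
        qed
        have eq: "(\<lambda>x. k x * complex_of_real (sin (x / K))) = (\<lambda>x.
          (- \<i> / 2) * (k x * exp (\<i> * of_real (1 / K) * of_real x)) +
          (\<i> / 2) * (k x * exp (\<i> * of_real (- 1 / K) * of_real x)))"
          by (intro ext) (simp only: sin distrib_left mult_ac)
        show ?thesis
          unfolding eq by (intro good_add good_scale good_exp that)
      qed
      then show "(\<lambda>x. sin (x / K)) \<in> A"
        by (auto simp: A_def intro!: continuous_intros) (use K in simp)
    qed
  qed simp
  let ?h = "\<lambda>x. complex_of_real (h x)"
  have small: "norm (L ?h) \<le> B * e" if "e > 0" for e
  proof -
    obtain g where g: "g \<in> A" "\<And>x. x \<in> ?S \<Longrightarrow> \<bar>h x - g x\<bar> < e"
      using Stone_Weierstrass_basic[OF h \<open>e > 0\<close>] by blast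
    have cg0: "continuous_on ?S g"
      using g(1) by (simp add: A_def)
    then have cg: "continuous_on ?S (\<lambda>x. complex_of_real (g x))"
      by (rule continuous_on_of_real)
    have "good (\<lambda>x. complex_of_real (g x))"
      using g(1) good_1 by (fastforce simp: A_def)
    then have "L (\<lambda>x. complex_of_real (g x) * exp (\<i> * of_real 0 * of_real x)) = 0"
      unfolding good_def by blast
    then have "L (\<lambda>x. complex_of_real (g x)) = 0" by simp
    moreover have "L (\<lambda>x. ?h x + (- 1) * complex_of_real (g x)) = L ?h + (- 1) * L (\<lambda>x. complex_of_real (g x))"
      using L_add[of ?h "\<lambda>x. (- 1) * complex_of_real (g x)"] scale[OF cg, of "- 1"] h cg0
      by (simp add: continuous_on_of_real continuous_on_minus)
    moreover have "norm (L (\<lambda>x. ?h x + (- 1) * complex_of_real (g x))) \<le> B * e"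
    proof (rule bound)
      show "continuous_on ?S (\<lambda>x. ?h x + (- 1) * complex_of_real (g x))"
        using h cg0 by (intro continuous_intros)
      show "norm (?h x + (- 1) * complex_of_real (g x)) \<le> e" if "x \<in> ?S" for x
        using g(2)[OF that] by (simp flip: of_real_diff)
    qed
    ultimately show ?thesis by simp
  qed
  have "norm (L ?h) \<le> e" if "e > 0" for e
  proof -
    have "norm (L ?h) \<le> B * (e / (\<bar>B\<bar> + 1))"
      using that by (intro small) (simp add: add_nonneg_pos)
    also have "\<dots> = B / (\<bar>B\<bar> + 1) * e" by simp
    also have "\<dots> \<le> 1 * e"
      using that by (intro mult_right_mono) (auto simp: divide_le_eq)
    finally show ?thesis by simp
  qed
  then have "norm (L ?h) \<le> 0" by (rule field_le_epsilon[of _ 0, simplified])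
  then show ?thesis by simp
qed

text \<open>The exponentials give vanishing for all continuous functions of the values of
  \<open>\<phi> m\<close>. The sharp cut-off is a pointwise limit of continuous ones bounded by 1,
  and dominated convergence passes to it.\<close>

lemma levels_vanish:
  fixes W :: "'m \<Rightarrow> real \<Rightarrow> complex" and \<phi> :: "'m \<Rightarrow> real \<Rightarrow> real"
  assumes M: "finite M" and W: "\<And>m. m \<in> M \<Longrightarrow> continuous_on UNIV (W m)"
    and \<phi>: "\<And>m. m \<in> M \<Longrightarrow> continuous_on UNIV (\<phi> m)"
    and vanish: "\<And>t. (\<Sum>m\<in>M. LINT y:{a..b}|lborel. W m y * exp (\<i> * of_real t * of_real (\<phi> m y))) = 0"
    and s: "s > 0"
  shows "(\<Sum>m\<in>M. LINT y:{a..b}|lborel. indicator {y. 0 < \<tau> * \<phi> m y \<and> \<tau> * \<phi> m y < s} y *\<^sub>R W m y) = 0"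
proof -
  have "\<exists>K. \<forall>y\<in>{a..b}. \<bar>\<phi> m y\<bar> \<le> K" if "m \<in> M" for m
  proof -
    have "bounded (\<phi> m ` {a..b})"
      using continuous_on_subset[OF \<phi>[OF that]] by (intro compact_imp_bounded compact_continuous_image) auto
    then show ?thesis by (auto simp: bounded_iff)
  qed
  then obtain k where k: "\<And>m y. m \<in> M \<Longrightarrow> y \<in> {a..b} \<Longrightarrow> \<bar>\<phi> m y\<bar> \<le> k m"
    by metis
  define K where "K = (\<Sum>m\<in>M. \<bar>k m\<bar>) + 1"
  have K: "\<phi> m y \<in> {-K..K}" if "m \<in> M" "y \<in> {a..b}" for m y
  proof -
    have "\<bar>\<phi> m y\<bar> \<le> \<bar>k m\<bar>" using k[OF that] by linarith
    also have "\<dots> \<le> (\<Sum>m\<in>M. \<bar>k m\<bar>)" using M that by (intro member_le_sum) auto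
    finally show ?thesis by (auto simp: K_def abs_le_iff)
  qed
  have K0: "K > 0" by (simp add: K_def add_nonneg_pos sum_nonneg)
  \<comment> \<open>One functional in the common variable \<open>\<phi> m y\<close>: the same
    function \<open>f\<close> is inserted for every \<open>m\<close>, so only the sum over
    \<open>m\<close> is controlled.\<close>
  define L where "L f = (\<Sum>m\<in>M. LINT y:{a..b}|lborel. W m y * f (\<phi> m y))" for f
  have cont: "continuous_on {a..b} (\<lambda>y. W m y * f (\<phi> m y))" if "continuous_on {-K..K} f" "m \<in> M" for f m
    using continuous_on_subset[OF W[OF that(2)]] continuous_on_subset[OF \<phi>[OF that(2)]] K that
    by (intro continuous_on_mult continuous_on_compose2[OF that(1)]) auto
  note int = borel_integrable_atLeastAtMost'[OF cont]
  have L0: "L (\<lambda>x. complex_of_real (h x)) = 0" if h: "continuous_on {-K..K} h" for h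
  proof (rule functional_vanishes_of_exp[OF K0 _ _ _ _ h])
    fix f g :: "real \<Rightarrow> complex" assume f: "continuous_on {-K..K} f" and g: "continuous_on {-K..K} g"
    show "L (\<lambda>x. f x + g x) = L f + L g"
      unfolding L_def sum.distrib[symmetric]
      by (intro sum.cong refl) (simp add: distrib_left set_integral_add(2)[OF int[OF f] int[OF g]])
  next
    fix f :: "real \<Rightarrow> complex" and c assume f: "continuous_on {-K..K} f"
    show "L (\<lambda>x. c * f x) = c * L f"
      unfolding L_def sum_distrib_left
      by (intro sum.cong refl) (simp add: mult.left_commute[of _ c])
  next
    fix f :: "real \<Rightarrow> complex" and e assume f: "continuous_on {-K..K} f"
      and e: "\<And>x. x \<in> {-K..K} \<Longrightarrow> norm (f x) \<le> e"
    have "norm (L f) \<le> (\<Sum>m\<in>M. (LINT y:{a..b}|lborel. norm (W m y)) * e)"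
      unfolding L_def
    proof (intro sum_norm_le)
      fix m assume m: "m \<in> M"
      have intW: "set_integrable lborel {a..b} (\<lambda>y. norm (W m y))"
        using continuous_on_subset[OF W[OF m]] by (intro borel_integrable_atLeastAtMost' continuous_on_norm) auto
      have "norm (LINT y:{a..b}|lborel. W m y * f (\<phi> m y)) \<le> (LINT y:{a..b}|lborel. norm (W m y * f (\<phi> m y)))"
        by (rule set_integral_norm_bound[OF int[OF f m]])
      also have "\<dots> \<le> (LINT y:{a..b}|lborel. norm (W m y) * e)"
        using intW set_integrable_norm[OF int[OF f m]]
        by (intro set_integral_mono) (auto simp: norm_mult intro!: mult_left_mono e K[OF m])
      finally show "norm (LINT y:{a..b}|lborel. W m y * f (\<phi> m y)) \<le> (LINT y:{a..b}|lborel. norm (W m y)) * e"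
        by simp
    qed
    then show "norm (L f) \<le> (\<Sum>m\<in>M. (LINT y:{a..b}|lborel. norm (W m y))) * e"
      by (simp add: sum_distrib_right)
  next
    fix t show "L (\<lambda>x. exp (\<i> * of_real t * of_real x)) = 0"
      using vanish[of t] by (simp add: L_def)
  qed
  \<comment> \<open>Trapezoids with slopes \<open>n\<close>, tending to the indicator of the open
    interval 0 < \<tau> x < s; both ends carry the value 0.\<close>
  define h where "h n x = max 0 (min 1 (min (real n * (\<tau> * x)) (real n * (s - \<tau> * x))))" for n and x :: real
  have h_cont: "continuous_on S (h n)" for n S
    unfolding h_def by (intro continuous_intros)
  have h_lim: "(\<lambda>n. h n x) \<longlonglongrightarrow> indicator {x. 0 < \<tau> * x \<and> \<tau> * x < s} x" for x
  proof (cases "0 < \<tau> * x \<and> \<tau> * x < s")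
    case True
    have "\<forall>\<^sub>F n in sequentially. 1 < real n * (\<tau> * x)" "\<forall>\<^sub>F n in sequentially. 1 < real n * (s - \<tau> * x)"
    proof -
      have "filterlim (\<lambda>n. real n * c) at_top sequentially" if "c > 0" for c
        by (rule filterlim_at_top_mult_tendsto_pos[OF tendsto_const that filterlim_real_sequentially])
      then show "\<forall>\<^sub>F n in sequentially. 1 < real n * (\<tau> * x)" "\<forall>\<^sub>F n in sequentially. 1 < real n * (s - \<tau> * x)"
        using True by (simp_all add: filterlim_at_top_dense)
    qed
    then have "\<forall>\<^sub>F n in sequentially. h n x = 1"
      by eventually_elim (simp add: h_def)
    then show ?thesis using True by (simp add: tendsto_eventually)
  next
    case False
    have "h n x = 0" for n
    proof -
      have "real n * (\<tau> * x) \<le> 0 \<or> real n * (s - \<tau> * x) \<le> 0"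
        using False by (auto simp: mult_nonneg_nonpos not_less)
      then show ?thesis by (auto simp: h_def)
    qed
    then show ?thesis using False by simp
  qed
  have "(\<lambda>n. L (\<lambda>x. complex_of_real (h n x))) \<longlonglongrightarrow>
    (\<Sum>m\<in>M. LINT y:{a..b}|lborel. indicator {y. 0 < \<tau> * \<phi> m y \<and> \<tau> * \<phi> m y < s} y *\<^sub>R W m y)"
    unfolding L_def set_lebesgue_integral_def
  proof (intro tendsto_sum integral_dominated_convergence[where w = "\<lambda>y. indicator {a..b} y *\<^sub>R norm (W _ y)"])
    fix m assume m: "m \<in> M"
    have [measurable]: "W m \<in> borel_measurable borel" "\<phi> m \<in> borel_measurable borel"
      using W[OF m] \<phi>[OF m] by (auto intro: borel_measurable_continuous_onI)
    show "(\<lambda>y. indicator {a..b} y *\<^sub>R indicator {y. 0 < \<tau> * \<phi> m y \<and> \<tau> * \<phi> m y < s} y *\<^sub>R W m y) \<in> borel_measurable lborel"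
      by measurable
    have [measurable]: "h n \<in> borel_measurable borel" for n
      by (intro borel_measurable_continuous_onI h_cont)
    show "(\<lambda>y. indicator {a..b} y *\<^sub>R (W m y * complex_of_real (h n (\<phi> m y)))) \<in> borel_measurable lborel" for n
      by measurable
    show "integrable lborel (\<lambda>y. indicator {a..b} y *\<^sub>R norm (W m y))"
      using continuous_on_subset[OF W[OF m]]
      by (intro borel_integrable_compact continuous_on_norm) auto
    show "AE y in lborel. (\<lambda>n. indicator {a..b} y *\<^sub>R (W m y * complex_of_real (h n (\<phi> m y)))) \<longlonglongrightarrow>
        indicator {a..b} y *\<^sub>R indicator {y. 0 < \<tau> * \<phi> m y \<and> \<tau> * \<phi> m y < s} y *\<^sub>R W m y"
    proof (rule AE_I2)
      fix y
      have "(\<lambda>n. indicator {a..b} y *\<^sub>R (W m y * complex_of_real (h n (\<phi> m y)))) \<longlonglongrightarrow>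
        indicator {a..b} y *\<^sub>R (W m y * complex_of_real (indicator {x. 0 < \<tau> * x \<and> \<tau> * x < s} (\<phi> m y)))"
        by (intro tendsto_intros h_lim)
      also have "indicator {a..b} y *\<^sub>R (W m y * complex_of_real (indicator {x. 0 < \<tau> * x \<and> \<tau> * x < s} (\<phi> m y))) =
        indicator {a..b} y *\<^sub>R indicator {y. 0 < \<tau> * \<phi> m y \<and> \<tau> * \<phi> m y < s} y *\<^sub>R W m y"
        by (simp add: indicator_def)
      finally show "(\<lambda>n. indicator {a..b} y *\<^sub>R (W m y * complex_of_real (h n (\<phi> m y)))) \<longlonglongrightarrow>
        indicator {a..b} y *\<^sub>R indicator {y. 0 < \<tau> * \<phi> m y \<and> \<tau> * \<phi> m y < s} y *\<^sub>R W m y"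
        .
    qed
    show "AE y in lborel. norm (indicator {a..b} y *\<^sub>R (W m y * complex_of_real (h n (\<phi> m y))))
        \<le> indicator {a..b} y *\<^sub>R norm (W m y)" for n
    proof (rule AE_I2)
      fix y
      have "\<bar>h n (\<phi> m y)\<bar> \<le> 1" by (auto simp: h_def)
      then have "norm (W m y) * \<bar>h n (\<phi> m y)\<bar> \<le> norm (W m y)"
        by (simp add: mult_left_le)
      then show "norm (indicator {a..b} y *\<^sub>R (W m y * complex_of_real (h n (\<phi> m y))))
        \<le> indicator {a..b} y *\<^sub>R norm (W m y)"
        by (auto simp: indicator_def norm_mult)
    qed
  qed
  moreover have "L (\<lambda>x. complex_of_real (h n x)) = 0" for n
    by (rule L0[OF h_cont])
  ultimately show ?thesis
    by (simp add: LIMSEQ_const_iff)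
qed

section \<open>Finiteness of level sets, and the expansion of level integrals over an
  interval\<close>

lemma finite_if_isolated:
  fixes S :: "'a::metric_space set"
  assumes "compact S" and isolated: "\<And>x. x \<in> S \<Longrightarrow> \<exists>d>0. \<forall>y\<in>S. dist y x < d \<longrightarrow> y = x"
  shows "finite S"
proof (rule ccontr)
  assume "infinite S"
  then obtain x where x: "x \<in> S" "x islimpt S"
    using assms(1) by (meson compact_eq_Bolzano_Weierstrass subset_refl)
  obtain d where "d > 0" "\<forall>y\<in>S. dist y x < d \<longrightarrow> y = x"
    using isolated[OF x(1)] by blast
  with x(2) show False
    unfolding islimpt_approachable by blast
qed

lemma (in critical_point) isolated: "\<exists>\<delta>>0. \<forall>y. \<bar>y - y0\<bar> < \<delta> \<and> y \<noteq> y0 \<longrightarrow> R y \<noteq> R y0"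
proof -
  obtain d where d: "d > 0"
    "\<And>z. \<bar>z\<bar> \<le> d \<Longrightarrow> \<bar>H z - a\<bar> \<le> \<bar>a\<bar> / 2"
    "\<And>z. \<bar>z\<bar> \<le> d \<Longrightarrow> z \<noteq> 0 \<Longrightarrow> \<sigma> * nth_deriv 1 R (y0 + z) * z ^ (p - 1) > 0"
    using good_radius by blast
  interpret critical_radius R y0 p d
    by unfold_locales (use d in auto)
  show ?thesis
  proof (intro exI[of _ d] conjI allI impI d(1))
    fix y assume "\<bar>y - y0\<bar> < d \<and> y \<noteq> y0"
    then show "R y \<noteq> R y0"
      using R_eq_H[of "y - y0"] H_sign(3)[of "y - y0"] by auto
  qed
qed

text \<open>The solutions are isolated because \<open>H\<close> does not vanish near 0, and they
  form a compact set.\<close>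

lemma finite_level:
  assumes R: "smooth_circle R" and crit: "\<And>y. R y = c \<Longrightarrow> critical_point R y (ord y)"
  shows "finite {y \<in> {a..b}. R y = c}"
proof (rule finite_if_isolated)
  have "closed ({a..b} \<inter> R -` {c})"
    using smooth_circle_continuous[OF R] by (intro continuous_closed_preimage) auto
  moreover have "{y \<in> {a..b}. R y = c} = {a..b} \<inter> ({a..b} \<inter> R -` {c})" by auto
  ultimately show "compact {y \<in> {a..b}. R y = c}"
    by (metis compact_Icc compact_Int_closed)
next
  fix x assume "x \<in> {y \<in> {a..b}. R y = c}"
  then have x: "R x = c" by simp
  obtain \<delta> where "\<delta> > 0" "\<forall>y. \<bar>y - x\<bar> < \<delta> \<and> y \<noteq> x \<longrightarrow> R y \<noteq> R x"
    using critical_point.isolated[OF crit[OF x]] by blast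
  then show "\<exists>d>0. \<forall>y\<in>{y \<in> {a..b}. R y = c}. dist y x < d \<longrightarrow> y = x"
    using x by (intro exI[of _ \<delta>]) (auto simp: dist_real_def)
qed

text \<open>Off small neighbourhoods of the solutions |R - c| is bounded below by compactness, so
  for small \<open>s\<close> the level set splits into the local pieces. The ends of the interval
  are not solutions, so no neighbourhood is cut in half.\<close>

lemma level_expansion:
  fixes R :: "real \<Rightarrow> real" and W :: "real \<Rightarrow> complex" and ord :: "real \<Rightarrow> nat"
  assumes R: "smooth_circle R" and W: "smooth_circle W" and \<tau>: "\<tau> \<in> {1, -1}"
    and crit: "\<And>y. R y = c \<Longrightarrow> critical_point R y (ord y)"
    and ends: "R a \<noteq> c" "R b \<noteq> c"
  defines "Z \<equiv> {y \<in> {a..b}. R y = c}"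
  shows "finite Z \<and> (\<exists>r.
    (\<lambda>s. (LINT y:{a..b}|lborel. indicator {y. 0 < \<tau> * (R y - c) \<and> \<tau> * (R y - c) < s} y *\<^sub>R W y) -
      (\<Sum>y0\<in>Z. poly (r y0) (complex_of_real (s powr (1 / ord y0))))) \<in> O[at_right 0](\<lambda>s. of_real (s powr 2)) \<and>
    (\<forall>y0\<in>Z. coeff (r y0) 1 =
        (if odd (ord y0) then 1 else if \<tau> = sgn (nth_deriv (ord y0) R y0) then 2 else 0)
          * of_real (\<bar>nth_deriv (ord y0) R y0 / fact (ord y0)\<bar> powr (- 1 / ord y0)) * W y0 \<and>
        (even (ord y0) \<longrightarrow> coeff (r y0) 2 = 0)))"
proof -
  define S where "S y0 \<delta> s = {y. \<bar>y - y0\<bar> < \<delta> \<and> 0 < \<tau> * (R y - R y0) \<and> \<tau> * (R y - R y0) < s}" for y0 \<delta> s :: real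
  define V where "V s = {y. 0 < \<tau> * (R y - c) \<and> \<tau> * (R y - c) < s}" for s :: real
  have contR: "continuous_on A R" and contW: "continuous_on A W" for A
    using R W by (simp_all add: smooth_circle_continuous)
  have Z_c: "R y = c" if "y \<in> Z" for y
    using that by (simp add: Z_def)
  have "\<exists>\<delta>0>0. (\<forall>y. \<bar>y - y0\<bar> < \<delta>0 \<and> y \<noteq> y0 \<longrightarrow> R y \<noteq> R y0) \<and> (\<forall>\<delta>. 0 < \<delta> \<and> \<delta> \<le> \<delta>0 \<longrightarrow>
      (\<exists>r. (\<lambda>s. (LINT y|lborel. indicator (S y0 \<delta> s) y *\<^sub>R W y)
          - poly r (complex_of_real (s powr (1 / ord y0)))) \<in> O[at_right 0](\<lambda>s. of_real (s powr 2)) \<and>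
        coeff r 1 = (if odd (ord y0) then 1 else if \<tau> = sgn (nth_deriv (ord y0) R y0) then 2 else 0)
          * of_real (\<bar>nth_deriv (ord y0) R y0 / fact (ord y0)\<bar> powr (- 1 / ord y0)) * W y0 \<and>
        (even (ord y0) \<longrightarrow> coeff r 2 = 0)))"
    (is "\<exists>\<delta>0>0. ?iso y0 \<delta>0 \<and> ?exp y0 \<delta>0") if y0: "y0 \<in> Z" for y0
  proof -
    interpret critical_point R y0 "ord y0"
      using crit Z_c y0 by blast
    \<comment> \<open>Expanding to twice the order makes the error s^2 for every order, so that all
      pieces can be added.\<close>
    have "2 * ord y0 \<ge> 2" "real (2 * ord y0) / real (ord y0) = 2"
      using p_pos by simp_all
    then show ?thesis
      using local_expansion[OF W \<tau>, of "2 * ord y0"] unfolding S_def by simp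
  qed
  then have "\<forall>y0\<in>Z. \<exists>\<delta>0. \<delta>0 > 0 \<and> ?iso y0 \<delta>0 \<and> ?exp y0 \<delta>0"
    by blast
  from bchoice[OF this] obtain \<delta>0 where "\<forall>y0\<in>Z. \<delta>0 y0 > 0 \<and> ?iso y0 (\<delta>0 y0) \<and> ?exp y0 (\<delta>0 y0)" ..
  then obtain \<delta>0 where \<delta>0: "\<And>y0. y0 \<in> Z \<Longrightarrow> \<delta>0 y0 > 0"
    "\<And>y0 y. y0 \<in> Z \<Longrightarrow> \<bar>y - y0\<bar> < \<delta>0 y0 \<Longrightarrow> y \<noteq> y0 \<Longrightarrow> R y \<noteq> R y0"
    and exp: "\<And>y0 \<delta>. y0 \<in> Z \<Longrightarrow> 0 < \<delta> \<Longrightarrow> \<delta> \<le> \<delta>0 y0 \<Longrightarrow>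
      (\<exists>r. (\<lambda>s. (LINT y|lborel. indicator (S y0 \<delta> s) y *\<^sub>R W y)
          - poly r (complex_of_real (s powr (1 / ord y0)))) \<in> O[at_right 0](\<lambda>s. of_real (s powr 2)) \<and>
        coeff r 1 = (if odd (ord y0) then 1 else if \<tau> = sgn (nth_deriv (ord y0) R y0) then 2 else 0)
          * of_real (\<bar>nth_deriv (ord y0) R y0 / fact (ord y0)\<bar> powr (- 1 / ord y0)) * W y0 \<and>
        (even (ord y0) \<longrightarrow> coeff r 2 = 0))"
    by blast+
  have fin: "finite Z"
    unfolding Z_def by (rule finite_level[OF R crit])
  \<comment> \<open>A common radius: admissible for each local expansion, inside the interval, and
    at most half the distance of any two solutions, which makes the neighbourhoods disjoint.\<close>
  obtain \<delta> where \<delta>: "\<delta> > 0" "\<And>y0. y0 \<in> Z \<Longrightarrow> \<delta> \<le> \<delta>0 y0" "\<And>y0. y0 \<in> Z \<Longrightarrow> \<delta> \<le> y0 - a"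
     "\<And>y0. y0 \<in> Z \<Longrightarrow> \<delta> \<le> b - y0" "\<And>y0 y1. y0 \<in> Z \<Longrightarrow> y1 \<in> Z \<Longrightarrow> y0 \<noteq> y1 \<Longrightarrow> \<delta> \<le> \<bar>y0 - y1\<bar> / 2"
  proof -
    define T where "T = insert 1 (\<delta>0 ` Z \<union> (\<lambda>y. y - a) ` Z \<union> (\<lambda>y. b - y) ` Z \<union>
      (\<lambda>(y0, y1). \<bar>y0 - y1\<bar> / 2) ` {(y0, y1) \<in> Z \<times> Z. y0 \<noteq> y1})"
    have "finite {(y0, y1) \<in> Z \<times> Z. y0 \<noteq> y1}"
      by (rule finite_subset[of _ "Z \<times> Z"]) (use fin in auto)
    then have T: "finite T" "T \<noteq> {}" using fin by (auto simp: T_def)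
    have inside: "a < y \<and> y < b" if "y \<in> Z" for y
    proof -
      have "y \<noteq> a" "y \<noteq> b" using ends Z_c[OF that] by auto
      then show ?thesis using that by (auto simp: Z_def)
    qed
    have "Min T > 0"
      unfolding Min_gr_iff[OF T] using \<delta>0(1) inside by (auto simp: T_def)
    moreover have "Min T \<le> t" if "t \<in> T" for t using Min_le[OF T(1) that] .
    moreover have "\<bar>y0 - y1\<bar> / 2 \<in> T" if "y0 \<in> Z" "y1 \<in> Z" "y0 \<noteq> y1" for y0 y1
      unfolding T_def using that by (intro insertI2 UnI2 image_eqI[of _ _ "(y0, y1)"]) auto
    moreover have "\<delta>0 y \<in> T" "y - a \<in> T" "b - y \<in> T" if "y \<in> Z" for y
      using that by (auto simp: T_def)
    ultimately show thesis
      by (intro that[of "Min T"]) blast+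
  qed
  \<comment> \<open>\<open>s0\<close> is the minimum of |R - c| on the compact remainder, or 1 if
    that is empty.\<close>
  obtain s0 where s0: "s0 > 0"
    "\<And>y. y \<in> {a..b} \<Longrightarrow> \<bar>R y - c\<bar> < s0 \<Longrightarrow> \<exists>y0\<in>Z. \<bar>y - y0\<bar> < \<delta>"
  proof -
    define K where "K = {a..b} - (\<Union>y0\<in>Z. ball y0 \<delta>)"
    have K: "compact K" unfolding K_def by (intro compact_diff) auto
    have cover: "\<exists>y0\<in>Z. \<bar>y - y0\<bar> < \<delta>" if "y \<in> {a..b}" "y \<notin> K" for y
    proof -
      have "y \<in> (\<Union>y0\<in>Z. ball y0 \<delta>)" using that by (simp add: K_def)
      then show ?thesis by (auto simp: dist_real_def abs_minus_commute)
    qed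
    show thesis
    proof (cases "K = {}")
      case True
      then show thesis
        by (intro that[of 1] cover) simp_all
    next
      case False
      have "continuous_on K (\<lambda>y. \<bar>R y - c\<bar>)"
        by (intro continuous_intros contR)
      from continuous_attains_inf[OF K False this]
      obtain k where k: "k \<in> K" "\<And>y. y \<in> K \<Longrightarrow> \<bar>R k - c\<bar> \<le> \<bar>R y - c\<bar>" by blast
      have "R k \<noteq> c"
        using k(1) \<delta>(1) by (auto simp: K_def Z_def)
      then show thesis
      proof (intro that[of "\<bar>R k - c\<bar>"])
        fix y assume y: "y \<in> {a..b}" "\<bar>R y - c\<bar> < \<bar>R k - c\<bar>"
        with k(2)[of y] have "y \<notin> K" by auto
        with y(1) show "\<exists>y0\<in>Z. \<bar>y - y0\<bar> < \<delta>"
          by (rule cover)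
      qed simp
    qed
  qed
  have "\<forall>y0\<in>Z. \<exists>r. (\<lambda>s. (LINT y|lborel. indicator (S y0 \<delta> s) y *\<^sub>R W y)
          - poly r (complex_of_real (s powr (1 / ord y0)))) \<in> O[at_right 0](\<lambda>s. of_real (s powr 2)) \<and>
        coeff r 1 = (if odd (ord y0) then 1 else if \<tau> = sgn (nth_deriv (ord y0) R y0) then 2 else 0)
          * of_real (\<bar>nth_deriv (ord y0) R y0 / fact (ord y0)\<bar> powr (- 1 / ord y0)) * W y0 \<and>
        (even (ord y0) \<longrightarrow> coeff r 2 = 0)"
    using exp \<delta>(1,2) by blast
  from bchoice[OF this] obtain r where r: "\<And>y0. y0 \<in> Z \<Longrightarrow> (\<lambda>s. (LINT y|lborel. indicator (S y0 \<delta> s) y *\<^sub>R W y)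
          - poly (r y0) (complex_of_real (s powr (1 / ord y0)))) \<in> O[at_right 0](\<lambda>s. of_real (s powr 2))"
    and coeffs: "\<forall>y0\<in>Z. coeff (r y0) 1 = (if odd (ord y0) then 1 else if \<tau> = sgn (nth_deriv (ord y0) R y0) then 2 else 0)
          * of_real (\<bar>nth_deriv (ord y0) R y0 / fact (ord y0)\<bar> powr (- 1 / ord y0)) * W y0 \<and>
        (even (ord y0) \<longrightarrow> coeff (r y0) 2 = 0)"
    by blast
  have split: "(LINT y:{a..b}|lborel. indicator (V s) y *\<^sub>R W y) = (\<Sum>y0\<in>Z. LINT y|lborel. indicator (S y0 \<delta> s) y *\<^sub>R W y)"
    if s: "0 < s" "s < s0" for s
  proof -
    have [measurable]: "R \<in> borel_measurable borel" "W \<in> borel_measurable borel"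
      using contR contW by (auto intro: borel_measurable_continuous_onI)
    have pointwise: "indicator {a..b} y *\<^sub>R indicator (V s) y *\<^sub>R W y = (\<Sum>y0\<in>Z. indicator (S y0 \<delta> s) y *\<^sub>R W y)" for y
    proof (cases "\<exists>y0\<in>Z. \<bar>y - y0\<bar> < \<delta>")
      case True
      then obtain y0 where y0: "y0 \<in> Z" "\<bar>y - y0\<bar> < \<delta>" by blast
      have other: "y \<notin> S y1 \<delta> s" if "y1 \<in> Z" "y1 \<noteq> y0" for y1
        using \<delta>(5)[OF y0(1) that(1)] that y0(2) by (auto simp: S_def)
      have "(\<Sum>y1\<in>Z. indicator (S y1 \<delta> s) y *\<^sub>R W y) = indicator (S y0 \<delta> s) y *\<^sub>R W y"
        using other by (intro sum.mono_neutral_right[OF fin, of "{y0}", simplified]) (use y0 in auto)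
      moreover have "y \<in> {a..b}"
        using \<delta>(3,4)[OF y0(1)] y0(2) by auto
      moreover have "y \<in> V s \<longleftrightarrow> y \<in> S y0 \<delta> s"
        using y0 Z_c[OF y0(1)] by (simp add: V_def S_def)
      ultimately show ?thesis by (simp add: indicator_def)
    next
      case False
      have "y \<notin> S y0 \<delta> s" if "y0 \<in> Z" for y0
        using False that by (auto simp: S_def)
      moreover have "\<not> (y \<in> {a..b} \<and> y \<in> V s)"
      proof
        assume y: "y \<in> {a..b} \<and> y \<in> V s"
        then have "\<bar>R y - c\<bar> < s"
          using \<tau> by (auto simp: V_def)
        with s s0(2)[of y] y False show False by auto
      qed
      ultimately show ?thesis by (auto simp: indicator_def intro!: sum.neutral[symmetric])
    qed
    have "integrable lborel (\<lambda>y. indicator (S y0 \<delta> s) y *\<^sub>R W y)" if "y0 \<in> Z" for y0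
    proof -
      have "S y0 \<delta> s \<in> sets borel" unfolding S_def by measurable
      moreover have "S y0 \<delta> s \<subseteq> {a..b}" using \<delta>(3,4)[OF that] by (auto simp: S_def)
      moreover have "set_integrable lborel {a..b} W"
        by (rule borel_integrable_atLeastAtMost'[OF contW])
      ultimately have "set_integrable lborel (S y0 \<delta> s) W"
        using set_integrable_subset[of lborel "{a..b}" W "S y0 \<delta> s"] by simp
      then show ?thesis by (simp add: set_integrable_def)
    qed
    then show ?thesis
      unfolding set_lebesgue_integral_def pointwise by (rule Bochner_Integration.integral_sum)
  qed
  have "(\<lambda>s. \<Sum>y0\<in>Z. (LINT y|lborel. indicator (S y0 \<delta> s) y *\<^sub>R W y) - poly (r y0) (complex_of_real (s powr (1 / ord y0))))
     \<in> O[at_right 0](\<lambda>s. of_real (s powr 2))"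
    by (intro big_sum_in_bigo r)
  also have "?this \<longleftrightarrow> (\<lambda>s. (LINT y:{a..b}|lborel. indicator (V s) y *\<^sub>R W y) -
      (\<Sum>y0\<in>Z. poly (r y0) (complex_of_real (s powr (1 / ord y0))))) \<in> O[at_right 0](\<lambda>s. of_real (s powr 2))"
  proof (rule landau_o.big.in_cong)
    have "\<forall>\<^sub>F s in at_right 0. s < s0" "\<forall>\<^sub>F s in at_right (0::real). s > 0"
      using s0(1) by (auto simp: eventually_at_right_field)
    then show "\<forall>\<^sub>F s in at_right 0. (\<Sum>y0\<in>Z. (LINT y|lborel. indicator (S y0 \<delta> s) y *\<^sub>R W y) - poly (r y0) (complex_of_real (s powr (1 / ord y0)))) =
      (LINT y:{a..b}|lborel. indicator (V s) y *\<^sub>R W y) - (\<Sum>y0\<in>Z. poly (r y0) (complex_of_real (s powr (1 / ord y0))))"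
      by eventually_elim (simp add: split sum_subtractf)
  qed
  finally show ?thesis
    using fin coeffs unfolding V_def by blast
qed

subsection \<open>The weighted point sums\<close>

text \<open>The integral over a sliding window of length 2 pi has derivative k(x + 2 pi) - k(x) =
  0.\<close>

lemma set_integral_periodic:
  fixes k :: "real \<Rightarrow> complex"
  assumes k: "continuous_on UNIV k" and per: "\<And>y. k (y + 2 * pi) = k y"
  shows "(LINT y:{a..a + 2 * pi}|lborel. k y) = (LINT y:{0..2 * pi}|lborel. k y)"
proof -
  define u v where "u = - \<bar>a\<bar> - 1" and "v = \<bar>a\<bar> + 2 * pi + 1"
  have "continuous_on {u..v} k" using k continuous_on_subset by blast
  then obtain P where P: "\<And>x. x \<in> {u..v} \<Longrightarrow> (P has_vector_derivative k x) (at x within {u..v})"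
    using antiderivative_continuous by blast
  have FTC: "(LINT y:{x..x + 2 * pi}|lborel. k y) = P (x + 2 * pi) - P x" if "x \<in> {u..\<bar>a\<bar> + 1}" for x
  proof -
    have "{x..x + 2 * pi} \<subseteq> {u..v}" using that by (auto simp: v_def)
    then show ?thesis
      unfolding set_lebesgue_integral_def
      by (intro integral_FTC_Icc continuous_on_subset[OF k])
        (auto intro!: has_vector_derivative_within_subset[OF P])
  qed
  have "((\<lambda>x. P (x + 2 * pi) - P x) has_vector_derivative 0) (at x within {u..\<bar>a\<bar> + 1})"
    if "x \<in> {u..\<bar>a\<bar> + 1}" for x
  proof -
    have sub: "{u..\<bar>a\<bar> + 1} \<subseteq> {u..v}" "(\<lambda>x. x + 2 * pi) ` {u..\<bar>a\<bar> + 1} \<subseteq> {u..v}"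
      using pi_gt_zero by (auto simp: v_def)
    have "((\<lambda>x. x + 2 * pi) has_vector_derivative 1) (at x within {u..\<bar>a\<bar> + 1})"
      by (auto intro!: derivative_eq_intros)
    moreover have "(P has_vector_derivative k x) (at (x + 2 * pi) within (\<lambda>x. x + 2 * pi) ` {u..\<bar>a\<bar> + 1})"
    proof -
      have "x + 2 * pi \<in> {u..v}"
        using that pi_gt_zero unfolding atLeastAtMost_iff v_def by linarith
      from has_vector_derivative_within_subset[OF P[OF this] sub(2)] show ?thesis
        by (simp only: per)
    qed
    ultimately have "((\<lambda>x. P (x + 2 * pi)) has_vector_derivative k x) (at x within {u..\<bar>a\<bar> + 1})"
      using vector_diff_chain_within[of "\<lambda>x. x + 2 * pi" 1 x "{u..\<bar>a\<bar> + 1}" P "k x"] by (simp add: o_def)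
    moreover have "(P has_vector_derivative k x) (at x within {u..\<bar>a\<bar> + 1})"
      using has_vector_derivative_within_subset[OF P sub(1)] sub(1) that by blast
    ultimately show ?thesis
      using has_vector_derivative_diff by fastforce
  qed
  then obtain d where d: "\<And>x. x \<in> {u..\<bar>a\<bar> + 1} \<Longrightarrow> P (x + 2 * pi) - P x = d"
    using has_vector_derivative_zero_constant[of "{u..\<bar>a\<bar> + 1}" "\<lambda>x. P (x + 2 * pi) - P x"] by auto
  have "a \<in> {u..\<bar>a\<bar> + 1}" "0 \<in> {u..\<bar>a\<bar> + 1}"
    unfolding u_def by auto
  from this[THEN d] this[THEN FTC] show ?thesis by simp
qed

lemma standing_assumptions_smooth: "standing_assumptions R \<Longrightarrow> smooth_circle R"
  by (simp add: standing_assumptions_def)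

text \<open>This covers every point of the circle: where R' does not vanish the order is 1, and at
  stationary points the standing assumptions supply a nonvanishing derivative.\<close>

lemma critical_point_stat_order:
  assumes "standing_assumptions R"
  shows "critical_point R y (stat_order R y)"
proof -
  have "\<exists>k\<ge>1. nth_deriv k R y \<noteq> 0"
    using assms unfolding standing_assumptions_def by (metis le_refl)
  then have "stat_order R y \<ge> 1 \<and> nth_deriv (stat_order R y) R y \<noteq> 0"
    unfolding stat_order_def by (rule LeastI_ex)
  moreover have "nth_deriv k R y = 0" if "0 < k" "k < stat_order R y" for k
    using not_less_Least[of k "\<lambda>k. k \<ge> 1 \<and> nth_deriv k R y \<noteq> 0"] that unfolding stat_order_def by auto
  ultimately show ?thesis
    using standing_assumptions_smooth[OF assms] by unfold_locales auto
qed

lemma square_nat_abs: "(real (nat \<bar>m\<bar>))\<^sup>2 = (of_int m)\<^sup>2"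
proof -
  have "real (nat \<bar>m\<bar>) = \<bar>of_int m\<bar>" by (simp flip: of_int_abs)
  then show ?thesis by simp
qed

lemma poly_eq_sum_atMost:
  fixes q :: "'a::comm_semiring_1 poly"
  assumes "degree q \<le> D"
  shows "poly q x = (\<Sum>j\<le>D. coeff q j * x ^ j)"
proof -
  have "poly q x = (\<Sum>j\<le>degree q. coeff q j * x ^ j)" by (rule poly_altdef)
  also have "\<dots> = (\<Sum>j\<le>D. coeff q j * x ^ j)"
    using assms by (intro sum.mono_neutral_left) (auto simp: coeff_eq_0)
  finally show ?thesis .
qed

text \<open>Treats both kinds of labels at once. For odd order the side \<tau> = 1 is an arbitrary
  choice, since both sides of the level give the same first coefficient.\<close>

lemma Y_iff:
  assumes "l \<in> labels R"
  defines "p \<equiv> label_order l" and "\<tau> \<equiv> (case l of Odd _ \<Rightarrow> 1 | Even _ \<epsilon> \<Rightarrow> \<epsilon>)"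
  shows "y \<in> Y R l q \<longleftrightarrow> y \<in> {0..<2 * pi} \<and> R y = (real q)\<^sup>2 \<and> stat_order R y = p \<and>
      (odd p \<or> sgn (nth_deriv p R y) = \<tau>)"
    "p \<in> orders R" "\<tau> \<in> {1, -1}"
  using assms by (cases l; auto simp: labels_def)+

text \<open>All local expansions are merged into one finite sum of powers of s, indexed by triples
  (m, y, j) with exponent j / p', where p' is the order at y. Uniqueness is applied to the exponent
  1/p, which singles out the triples with j p = p'.\<close>

lemma weighted_sum_vanishes:
  fixes W :: "int \<Rightarrow> real \<Rightarrow> complex"
  assumes R: "standing_assumptions R"
    and orders: "\<And>p d. p \<in> orders R \<Longrightarrow> d dvd p \<Longrightarrow> real d < real p / 2 \<Longrightarrow> d \<notin> orders R"
    and M: "finite M" and W: "\<And>m. m \<in> M \<Longrightarrow> smooth_circle (W m)"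
    and vanish: "\<And>t. (\<Sum>m\<in>M. LINT y:{0..2 * pi}|lborel. W m y * exp (\<i> * of_real t * of_real (R y - (of_int m)\<^sup>2))) = 0"
    and l: "l \<in> labels R"
  shows "(\<Sum>m\<in>M. \<Sum>y\<in>Y R l (nat \<bar>m\<bar>). W m y /
    of_real (\<bar>nth_deriv (label_order l) R y\<bar> powr (1 / real (label_order l)))) = 0"
proof -
  define p where "p = label_order l"
  define \<tau> :: real where "\<tau> = (case l of Odd _ \<Rightarrow> 1 | Even _ \<epsilon> \<Rightarrow> \<epsilon>)"
  note Y = Y_iff[OF l, folded p_def \<tau>_def]
  define c :: "int \<Rightarrow> real" where "c m = (of_int m)\<^sup>2" for m
  let ?ord = "stat_order R"
  note smooth = standing_assumptions_smooth[OF R]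
  note crit = critical_point_stat_order[OF R]
  have ord_pos: "?ord y > 0" for y using critical_point.p_pos[OF crit] .
  have p_pos: "p > 0" using Y(2) ord_pos by (auto simp: orders_def)
  have contR: "continuous_on A R" for A using smooth_circle_continuous[OF smooth] .

  \<comment> \<open>A solution may sit at 0, the end of the fundamental domain. The window is
    therefore moved left to a point \<open>a\<close> halfway between 0 and the largest negative
    solution found here (or -1). No solution lies in [a, 0), so the window of length 2 pi contains
    exactly the solutions of [0, 2 pi).\<close>
  define F where "F = (\<Union>m\<in>M. {y \<in> {-1..2 * pi}. R y = c m})"
  have "finite F"
    unfolding F_def by (rule finite_UN_I[OF M finite_level[OF smooth crit]])
  define F' where "F' = insert (- 1) {y \<in> F. y < 0}"
  have F': "finite F'" "F' \<noteq> {}" using \<open>finite F\<close> by (auto simp: F'_def)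
  define a where "a = Max F' / 2"
  define b where "b = a + 2 * pi"
  have "Max F' < 0" using F' by (subst Max_less_iff) (auto simp: F'_def)
  moreover have "Max F' \<ge> - 1" using F' by (intro Max_ge) (auto simp: F'_def)
  ultimately have a: "- 1 < a" "a < 0" "Max F' < a" by (auto simp: a_def)
  have no_level: "R y \<noteq> c m" if "m \<in> M" "a \<le> y" "y < 0" for m y
  proof
    assume "R y = c m"
    moreover have "- 1 \<le> y" "y \<le> 2 * pi" using that a pi_gt_zero by linarith+
    ultimately have "y \<in> F"
      unfolding F_def using that(1) by (intro UN_I[of m]) simp_all
    then have "y \<in> F'" using that(3) by (simp add: F'_def)
    then have "y \<le> Max F'" using F' by (intro Max_ge)
    with that a show False by simp
  qed
  have R_per: "R (y + 2 * pi) = R y" for y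
    using smooth by (simp add: smooth_circle_def)
  have ends: "R a \<noteq> c m" "R b \<noteq> c m" if "m \<in> M" for m
    using no_level[OF that, of a] a R_per[of a] by (auto simp: b_def)
  define Z where "Z m = {y \<in> {a..b}. R y = c m}" for m
  have Z_eq: "Z m = {y \<in> {0..<2 * pi}. R y = c m}" if "m \<in> M" for m
  proof (intro equalityI subsetI)
    fix y assume "y \<in> Z m"
    then show "y \<in> {y \<in> {0..<2 * pi}. R y = c m}"
      using no_level[OF that, of y] a by (cases "y < 0") (auto simp: Z_def b_def)
  next
    fix y assume y: "y \<in> {y \<in> {0..<2 * pi}. R y = c m}"
    then have y': "R y = c m" "0 \<le> y" "y < 2 * pi" by auto
    have "R (y - 2 * pi) = c m" using R_per[of "y - 2 * pi"] y'(1) by simp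
    then have "\<not> a \<le> y - 2 * pi" using no_level[OF that, of "y - 2 * pi"] y'(3) by auto
    then have "y \<le> b" unfolding b_def by linarith
    then show "y \<in> Z m" using y a by (auto simp: Z_def)
  qed

  have "\<forall>m\<in>M. finite (Z m) \<and> (\<exists>r.
    (\<lambda>s. (LINT y:{a..b}|lborel. indicator {y. 0 < \<tau> * (R y - c m) \<and> \<tau> * (R y - c m) < s} y *\<^sub>R W m y) -
      (\<Sum>y0\<in>Z m. poly (r y0) (complex_of_real (s powr (1 / ?ord y0))))) \<in> O[at_right 0](\<lambda>s. of_real (s powr 2)) \<and>
    (\<forall>y0\<in>Z m. coeff (r y0) 1 =
        (if odd (?ord y0) then 1 else if \<tau> = sgn (nth_deriv (?ord y0) R y0) then 2 else 0)
          * of_real (\<bar>nth_deriv (?ord y0) R y0 / fact (?ord y0)\<bar> powr (- 1 / ?ord y0)) * W m y0 \<and>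
        (even (?ord y0) \<longrightarrow> coeff (r y0) 2 = 0)))"
    unfolding Z_def using level_expansion[OF smooth W Y(3) crit ends] by blast
  then have finZ: "\<And>m. m \<in> M \<Longrightarrow> finite (Z m)" and "\<forall>m\<in>M. \<exists>r.
    (\<lambda>s. (LINT y:{a..b}|lborel. indicator {y. 0 < \<tau> * (R y - c m) \<and> \<tau> * (R y - c m) < s} y *\<^sub>R W m y) -
      (\<Sum>y0\<in>Z m. poly (r y0) (complex_of_real (s powr (1 / ?ord y0))))) \<in> O[at_right 0](\<lambda>s. of_real (s powr 2)) \<and>
    (\<forall>y0\<in>Z m. coeff (r y0) 1 =
        (if odd (?ord y0) then 1 else if \<tau> = sgn (nth_deriv (?ord y0) R y0) then 2 else 0)
          * of_real (\<bar>nth_deriv (?ord y0) R y0 / fact (?ord y0)\<bar> powr (- 1 / ?ord y0)) * W m y0 \<and>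
        (even (?ord y0) \<longrightarrow> coeff (r y0) 2 = 0))"
    by blast+
  from bchoice[OF this(2)] obtain r where r: "\<And>m. m \<in> M \<Longrightarrow>
    (\<lambda>s. (LINT y:{a..b}|lborel. indicator {y. 0 < \<tau> * (R y - c m) \<and> \<tau> * (R y - c m) < s} y *\<^sub>R W m y) -
      (\<Sum>y0\<in>Z m. poly (r m y0) (complex_of_real (s powr (1 / ?ord y0))))) \<in> O[at_right 0](\<lambda>s. of_real (s powr 2))"
    and coeff1: "\<And>m y0. m \<in> M \<Longrightarrow> y0 \<in> Z m \<Longrightarrow> coeff (r m y0) 1 =
        (if odd (?ord y0) then 1 else if \<tau> = sgn (nth_deriv (?ord y0) R y0) then 2 else 0)
          * of_real (\<bar>nth_deriv (?ord y0) R y0 / fact (?ord y0)\<bar> powr (- 1 / ?ord y0)) * W m y0"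
    and coeff2: "\<And>m y0. m \<in> M \<Longrightarrow> y0 \<in> Z m \<Longrightarrow> even (?ord y0) \<Longrightarrow> coeff (r m y0) 2 = 0"
    by blast

  have levels: "(\<Sum>m\<in>M. LINT y:{a..b}|lborel. indicator {y. 0 < \<tau> * (R y - c m) \<and> \<tau> * (R y - c m) < s} y *\<^sub>R W m y) = 0"
    if "s > 0" for s
  proof (rule levels_vanish[OF M _ _ _ that, of W "\<lambda>m y. R y - c m"])
    show "continuous_on UNIV (W m)" if "m \<in> M" for m
      using smooth_circle_continuous[OF W[OF that]] .
    show "continuous_on UNIV (\<lambda>y. R y - c m)" for m
      by (intro continuous_intros contR)
    show "(\<Sum>m\<in>M. LINT y:{a..b}|lborel. W m y * exp (\<i> * of_real t * of_real (R y - c m))) = 0" for t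
    proof -
      have "(LINT y:{a..b}|lborel. W m y * exp (\<i> * of_real t * of_real (R y - c m))) =
        (LINT y:{0..2 * pi}|lborel. W m y * exp (\<i> * of_real t * of_real (R y - c m)))" if "m \<in> M" for m
        unfolding b_def
        using W[OF that] smooth_circle_continuous[OF W[OF that]]
        by (intro set_integral_periodic continuous_intros contR) (auto simp: R_per smooth_circle_def)
      then show ?thesis
        using vanish[of t] by (simp add: c_def)
    qed
  qed

  \<comment> \<open>A common degree bound; the extra 1 keeps the index j = 1 in range even if all
    polynomials are constant.\<close>
  define D where "D = (\<Sum>m\<in>M. \<Sum>y\<in>Z m. degree (r m y)) + 1"
  have D: "degree (r m y) \<le> D" if "m \<in> M" "y \<in> Z m" for m y
  proof -
    have "degree (r m y) \<le> (\<Sum>y\<in>Z m. degree (r m y))"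
      using that finZ by (intro member_le_sum) auto
    also have "\<dots> \<le> (\<Sum>m\<in>M. \<Sum>y\<in>Z m. degree (r m y))"
      using that M by (intro member_le_sum) auto
    finally show ?thesis by (simp add: D_def)
  qed
  define I where "I = Sigma M (\<lambda>m. Z m \<times> {..D})"
  define C where "C = (\<lambda>(m, y, j). coeff (r m y) j)"
  define x where "x = (\<lambda>(m :: int, y, j). real j / ?ord y)"
  have finI: "finite I" using M finZ by (auto simp: I_def)
  have sum_I: "(\<Sum>i\<in>I. f i) = (\<Sum>m\<in>M. \<Sum>y\<in>Z m. \<Sum>j\<le>D. f (m, y, j))" for f :: "int \<times> real \<times> nat \<Rightarrow> complex"
  proof -
    have "(\<Sum>m\<in>M. \<Sum>y\<in>Z m. \<Sum>j\<le>D. f (m, y, j)) = (\<Sum>m\<in>M. \<Sum>z\<in>Z m \<times> {..D}. f (m, z))"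
      by (simp add: sum.cartesian_product case_prod_beta)
    also have "\<dots> = (\<Sum>(m, z)\<in>I. f (m, z))"
      unfolding I_def using M finZ by (intro sum.Sigma) auto
    finally show ?thesis by (simp add: case_prod_beta)
  qed
  have expand: "(\<Sum>m\<in>M. \<Sum>y\<in>Z m. poly (r m y) (complex_of_real (s powr (1 / ?ord y)))) =
    (\<Sum>i\<in>I. C i * of_real (s powr x i))" if s: "s > 0" for s
  proof -
    have "poly (r m y) (complex_of_real (s powr (1 / ?ord y))) =
      (\<Sum>j\<le>D. C (m, y, j) * of_real (s powr x (m, y, j)))" if "m \<in> M" "y \<in> Z m" for m y
    proof -
      have "complex_of_real (s powr (1 / ?ord y)) ^ j = of_real (s powr (real j / ?ord y))" for j
        using s by (simp add: powr_realpow[symmetric] powr_powr flip: of_real_power)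
      then show ?thesis
        by (simp add: poly_eq_sum_atMost[OF D[OF that]] C_def x_def)
    qed
    then show ?thesis
      unfolding sum_I by (intro sum.cong refl)
  qed
  have "(\<lambda>s. \<Sum>m\<in>M. (LINT y:{a..b}|lborel. indicator {y. 0 < \<tau> * (R y - c m) \<and> \<tau> * (R y - c m) < s} y *\<^sub>R W m y) -
      (\<Sum>y0\<in>Z m. poly (r m y0) (complex_of_real (s powr (1 / ?ord y0))))) \<in> O[at_right 0](\<lambda>s. of_real (s powr 2))"
    by (intro big_sum_in_bigo r)
  also have "?this \<longleftrightarrow> (\<lambda>s. - (\<Sum>i\<in>I. C i * of_real (s powr x i))) \<in> O[at_right 0](\<lambda>s. of_real (s powr 2))"
  proof (rule landau_o.big.in_cong)
    have "\<forall>\<^sub>F s in at_right (0::real). s > 0"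
      by (simp add: eventually_at_filter)
    then show "\<forall>\<^sub>F s in at_right 0. (\<Sum>m\<in>M. (LINT y:{a..b}|lborel. indicator {y. 0 < \<tau> * (R y - c m) \<and> \<tau> * (R y - c m) < s} y *\<^sub>R W m y) -
      (\<Sum>y0\<in>Z m. poly (r m y0) (complex_of_real (s powr (1 / ?ord y0))))) = - (\<Sum>i\<in>I. C i * of_real (s powr x i))"
      by eventually_elim (simp only: sum_subtractf levels expand diff_0)
  qed
  finally have "(\<lambda>s. \<Sum>i\<in>I. C i * of_real (s powr x i)) \<in> O[at_right 0](\<lambda>s. of_real (s powr 2))"
    by (simp only: landau_o.big.uminus_in_iff)
  moreover have "1 / real p < 2" using p_pos by (simp add: divide_simps)
  ultimately have zero: "(\<Sum>i | i \<in> I \<and> x i = 1 / p. C i) = 0"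
    by (rule powr_expansion_unique[OF finI])

  \<comment> \<open>The factor depending on \<open>p\<close> alone: the factorial comes from the
    Taylor coefficient R^(p) / p!, the 2 from the two sides of a solution of even order.\<close>
  define \<kappa> :: complex where "\<kappa> = (if odd p then 1 else 2) * of_real (fact p powr (1 / p))"
  have inner: "(\<Sum>j\<le>D. if real j / ?ord y = 1 / p then coeff (r m y) j else 0) =
     \<kappa> * (if y \<in> Y R l (nat \<bar>m\<bar>) then W m y / of_real (\<bar>nth_deriv p R y\<bar> powr (1 / p)) else 0)"
    if my: "m \<in> M" "y \<in> Z m" for m y
  proof -
    have Ry: "R y = c m" using my by (simp add: Z_def)
    have ordR: "?ord y \<in> orders R"
      using Ry square_nat_abs[of m] by (auto simp: orders_def c_def intro!: exI[of _ "nat \<bar>m\<bar>"] exI[of _ y])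
    have "(if real j / ?ord y = 1 / p then coeff (r m y) j else 0) = (if 1 = j then (if ?ord y = p then coeff (r m y) 1 else 0) else 0)" for j
    proof (cases "real j / ?ord y = 1 / p")
      case True
      then have "real (j * p) = real (?ord y)"
        using p_pos ord_pos[of y] by (simp add: field_simps)
      then have jp: "j * p = ?ord y" by (simp only: of_nat_eq_iff)
      then have "j \<noteq> 0" using ord_pos[of y] by (metis mult_0 less_irrefl)
      consider "j = 1" | "j = 2" | "j \<ge> 3" using \<open>j \<noteq> 0\<close> by linarith
      then show ?thesis
      proof cases
        case 1
        then show ?thesis using True jp by simp
      next
        case 2
        then have "even (?ord y)" using jp by (metis dvd_triv_left)
        then show ?thesis using 2 coeff2[OF my] by simp
      next
        case 3
        then have "3 * p \<le> ?ord y" using jp by (metis mult_le_mono1)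
        then have "real p < real (?ord y) / 2" using p_pos by linarith
        moreover have "p dvd ?ord y" using jp by (metis dvd_triv_right)
        ultimately show ?thesis using orders[OF ordR] Y(2) by blast
      qed
    next
      case False
      then have "\<not> (j = 1 \<and> ?ord y = p)" by auto
      then show ?thesis using False by auto
    qed
    then have "(\<Sum>j\<le>D. if real j / ?ord y = 1 / p then coeff (r m y) j else 0) = (if ?ord y = p then coeff (r m y) 1 else 0)"
      by (simp add: sum.delta' D_def)
    also have "\<dots> = \<kappa> * (if y \<in> Y R l (nat \<bar>m\<bar>) then W m y / of_real (\<bar>nth_deriv p R y\<bar> powr (1 / p)) else 0)"
    proof (cases "?ord y = p")
      case True
      have "y \<in> {0..<2 * pi}" using my Z_eq[OF my(1)] by simp
      then have Y': "y \<in> Y R l (nat \<bar>m\<bar>) \<longleftrightarrow> odd p \<or> sgn (nth_deriv p R y) = \<tau>"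
        unfolding Y(1) using True Ry square_nat_abs[of m] by (simp add: c_def)
      have "\<bar>nth_deriv p R y / fact p\<bar> powr (- 1 / p) = fact p powr (1 / p) / \<bar>nth_deriv p R y\<bar> powr (1 / p)"
        by (simp add: powr_divide powr_minus field_simps)
      then have "coeff (r m y) 1 = (if odd p then 1 else if \<tau> = sgn (nth_deriv p R y) then 2 else 0) *
        (of_real (fact p powr (1 / p)) / of_real (\<bar>nth_deriv p R y\<bar> powr (1 / p))) * W m y"
        using coeff1[OF my] True by simp
      then show ?thesis
        using True Y' by (auto simp: \<kappa>_def)
    next
      case False
      then have "y \<notin> Y R l (nat \<bar>m\<bar>)" by (simp add: Y(1))
      with False show ?thesis by simp
    qed
    finally show ?thesis .
  qed
  have "(\<Sum>i | i \<in> I \<and> x i = 1 / p. C i) = (\<Sum>i\<in>I. if x i = 1 / p then C i else 0)"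
    using finI by (simp add: sum.inter_filter)
  also have "\<dots> = (\<Sum>m\<in>M. \<Sum>y\<in>Z m. \<Sum>j\<le>D. if real j / ?ord y = 1 / p then coeff (r m y) j else 0)"
    unfolding sum_I by (simp add: C_def x_def cong: if_cong)
  also have "\<dots> = (\<Sum>m\<in>M. \<Sum>y\<in>Z m. \<kappa> * (if y \<in> Y R l (nat \<bar>m\<bar>) then W m y / of_real (\<bar>nth_deriv p R y\<bar> powr (1 / p)) else 0))"
    by (intro sum.cong refl inner)
  also have "\<dots> = \<kappa> * (\<Sum>m\<in>M. \<Sum>y\<in>Z m. if y \<in> Y R l (nat \<bar>m\<bar>) then W m y / of_real (\<bar>nth_deriv p R y\<bar> powr (1 / p)) else 0)"
    by (simp add: sum_distrib_left)
  also have "(\<Sum>m\<in>M. \<Sum>y\<in>Z m. if y \<in> Y R l (nat \<bar>m\<bar>) then W m y / of_real (\<bar>nth_deriv p R y\<bar> powr (1 / p)) else 0) =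
    (\<Sum>m\<in>M. \<Sum>y\<in>Y R l (nat \<bar>m\<bar>). W m y / of_real (\<bar>nth_deriv p R y\<bar> powr (1 / p)))"
  proof (rule sum.cong[OF refl])
    fix m assume m: "m \<in> M"
    have "Y R l (nat \<bar>m\<bar>) = {y \<in> Z m. y \<in> Y R l (nat \<bar>m\<bar>)}"
      using square_nat_abs[of m] by (auto simp: Y(1) Z_eq[OF m] c_def)
    then show "(\<Sum>y\<in>Z m. if y \<in> Y R l (nat \<bar>m\<bar>) then W m y / of_real (\<bar>nth_deriv p R y\<bar> powr (1 / p)) else 0) =
      (\<Sum>y\<in>Y R l (nat \<bar>m\<bar>). W m y / of_real (\<bar>nth_deriv p R y\<bar> powr (1 / p)))"
      using sum.inter_filter[OF finZ[OF m], of "\<lambda>y. W m y / of_real (\<bar>nth_deriv p R y\<bar> powr (1 / p))" "\<lambda>y. y \<in> Y R l (nat \<bar>m\<bar>)"]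
      by simp
  qed
  finally have "\<kappa> * (\<Sum>m\<in>M. \<Sum>y\<in>Y R l (nat \<bar>m\<bar>). W m y / of_real (\<bar>nth_deriv p R y\<bar> powr (1 / p))) = 0"
    using zero by simp
  moreover have "\<kappa> \<noteq> 0" by (simp add: \<kappa>_def)
  ultimately show ?thesis by (simp add: p_def)
qed

subsection \<open>Test functions and observables\<close>

text \<open>Gives several test functions a common finite set of frequencies, with the canonical
  coefficients vanishing off it; the family in the definition of \<open>test_space\<close> is
  arbitrary there.\<close>

definition supported :: "int set \<Rightarrow> wavefun \<Rightarrow> bool" where
  "supported M f \<longleftrightarrow> finite M \<and> f = fourier_sum M (coef f) \<and>
    (\<forall>m. smooth_circle (coef f m)) \<and> (\<forall>m. m \<notin> M \<longrightarrow> coef f m = (\<lambda>_. 0))"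

lemma supported_fourier_sum:
  assumes "finite M" "\<And>m. m \<in> M \<Longrightarrow> smooth_circle (c m)"
  shows "supported M (fourier_sum M c)"
    "coef (fourier_sum M c) = (\<lambda>m. if m \<in> M then c m else (\<lambda>_. 0))"
proof -
  show coef: "coef (fourier_sum M c) = (\<lambda>m. if m \<in> M then c m else (\<lambda>_. 0))"
    by (intro ext) (simp add: coef_fourier_sum[OF assms(1)])
  have "fourier_sum M c = fourier_sum M (\<lambda>m. if m \<in> M then c m else (\<lambda>_. 0))"
    by (auto simp: fourier_sum_def intro!: sum.cong)
  then show "supported M (fourier_sum M c)"
    unfolding supported_def coef using assms by (auto simp: smooth_circle_const)
qed

lemma supported_mono:
  assumes "supported M f" "M \<subseteq> M'" "finite M'"
  shows "supported M' f"
proof -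
  have "fourier_sum M (coef f) = fourier_sum M' (coef f)"
  proof -
    have "\<forall>m. m \<notin> M \<longrightarrow> coef f m = (\<lambda>_. 0)" using assms(1) by (simp add: supported_def)
    then show ?thesis
      using assms(2,3) unfolding fourier_sum_def
      by (intro ext) (auto intro!: sum.mono_neutral_left)
  qed
  then show ?thesis using assms by (auto simp: supported_def)
qed

lemma supported_test_space: "supported M f \<Longrightarrow> f \<in> test_space"
  unfolding supported_def test_space_def by blast

lemma test_space_supported:
  assumes "f \<in> test_space"
  obtains M where "supported M f"
proof -
  obtain M c where "f = fourier_sum M c" "finite M" "\<forall>m. smooth_circle (c m)"
    using assms by (auto simp: test_space_def)
  then show thesis using supported_fourier_sum(1) that by metis
qed

lemma test_space_supported2:
  assumes "f \<in> test_space" "g \<in> test_space"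
  obtains M where "supported M f" "supported M g"
proof -
  obtain M N where "supported M f" "supported N g"
    using assms by (metis test_space_supported)
  moreover from this have "finite (M \<union> N)" by (simp add: supported_def)
  ultimately have "supported (M \<union> N) f" "supported (M \<union> N) g"
    by (simp_all add: supported_mono)
  then show thesis by (rule that)
qed

lemma supported_add:
  assumes "supported M f" "supported M g"
  shows "supported M (f + g)" "coef (f + g) = (\<lambda>m y. coef f m y + coef g m y)"
proof -
  have eq: "f + g = fourier_sum M (\<lambda>m y. coef f m y + coef g m y)"
  proof -
    have "fourier_sum M (coef f) + fourier_sum M (coef g) = fourier_sum M (\<lambda>m y. coef f m y + coef g m y)"
      by (auto simp: fourier_sum_def fun_eq_iff distrib_left sum.distrib)
    then show ?thesis using assms by (simp add: supported_def)
  qed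
  show "supported M (f + g)" 
    unfolding eq using assms by (intro supported_fourier_sum(1)) (auto simp: supported_def intro: smooth_circle_add)
  show "coef (f + g) = (\<lambda>m y. coef f m y + coef g m y)"
    unfolding eq using assms by (auto simp: supported_def fun_eq_iff coef_fourier_sum)
qed

lemma supported_scale:
  assumes "supported M f"
  shows "supported M (\<lambda>z. a * f z)" "coef (\<lambda>z. a * f z) = (\<lambda>m y. a * coef f m y)"
proof -
  have eq: "(\<lambda>z. a * f z) = fourier_sum M (\<lambda>m y. a * coef f m y)"
  proof -
    have "(\<lambda>z. a * fourier_sum M (coef f) z) = fourier_sum M (\<lambda>m y. a * coef f m y)"
      by (auto simp: fourier_sum_def fun_eq_iff sum_distrib_left mult_ac)
    then show ?thesis using assms by (simp add: supported_def)
  qed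
  show "supported M (\<lambda>z. a * f z)"
    unfolding eq using assms
    by (intro supported_fourier_sum(1)) (auto simp: supported_def intro: smooth_circle_mult smooth_circle_const)
  show "coef (\<lambda>z. a * f z) = (\<lambda>m y. a * coef f m y)"
    unfolding eq using assms by (auto simp: supported_def fun_eq_iff coef_fourier_sum)
qed

lemma supported_evol:
  assumes R: "smooth_circle R" and f: "supported M f"
  shows "supported M (evol R t f)"
    "coef (evol R t f) = (\<lambda>m y. exp (- \<i> * of_real (t * ((of_int m)\<^sup>2 - R y))) * coef f m y)"
proof -
  let ?e = "\<lambda>m y. exp (- \<i> * of_real (t * ((of_int m)\<^sup>2 - R y)))"
  have eq: "evol R t f = fourier_sum M (\<lambda>m y. ?e m y * coef f m y)"
    using evol_fourier_sum[of M R t "coef f"] f by (simp add: supported_def)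
  have "smooth_circle (?e m)" for m
  proof -
    have "smooth_circle (\<lambda>y. complex_of_real (R y))"
      by (rule smooth_circle_linear[OF bounded_linear_of_real R])
    then have "smooth_circle (\<lambda>y. \<i> * of_real t * of_real (R y) + - \<i> * of_real (t * (of_int m)\<^sup>2))"
      by (intro smooth_circle_add smooth_circle_mult smooth_circle_const)
    then show ?thesis
      by (intro smooth_circle_exp) (simp add: algebra_simps)
  qed
  then show "supported M (evol R t f)"
    unfolding eq using f
    by (intro supported_fourier_sum(1)) (auto simp: supported_def intro: smooth_circle_mult)
  show "coef (evol R t f) = (\<lambda>m y. ?e m y * coef f m y)"
    unfolding eq using f by (auto simp: supported_def fun_eq_iff coef_fourier_sum)
qed

section \<open>The inner product and the maps \<open>eta\<close> in terms of Fourier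
  coefficients\<close>

lemma set_integral_Ico:
  fixes f :: "real \<Rightarrow> complex"
  shows "(LINT y:{a..<b}|lborel. f y) = (LINT y:{a..b::real}|lborel. f y)"
  by (rule set_integral_discrete_difference[of "{b}"]) auto

lemma set_integral_exp:
  "(LINT x:{0..2 * pi}|lborel. exp (\<i> * of_int k * of_real x)) = (if k = 0 then of_real (2 * pi) else 0)"
proof -
  have "set_integrable lborel {0..2 * pi} (\<lambda>x. exp (\<i> * of_int k * complex_of_real x))"
    by (intro borel_integrable_atLeastAtMost' continuous_intros)
  \<comment> \<open>The integral is 2 pi times the zeroth Fourier coefficient of the single mode
    exp(ikx), already computed for Fourier sums.\<close>
  from set_borel_integral_eq_integral(2)[OF this]
  have "(LINT x:{0..2 * pi}|lborel. exp (\<i> * of_int k * of_real x)) = of_real (2 * pi) * coef (fourier_sum {k} (\<lambda>_ _. 1)) 0 0"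
    by (simp add: coef_def fourier_sum_def)
  also have "\<dots> = (if k = 0 then of_real (2 * pi) else 0)"
    by (simp add: coef_fourier_sum)
  finally show ?thesis .
qed

lemma
  fixes f :: "'i \<Rightarrow> 'a \<Rightarrow> 'b::{banach, second_countable_topology}"
  assumes "\<And>i. i \<in> I \<Longrightarrow> set_integrable M S (f i)"
  shows set_integrable_sum: "set_integrable M S (\<lambda>x. \<Sum>i\<in>I. f i x)"
    and set_integral_sum: "(LINT x:S|M. \<Sum>i\<in>I. f i x) = (\<Sum>i\<in>I. LINT x:S|M. f i x)"
  using assms unfolding set_integrable_def set_lebesgue_integral_def scaleR_sum_right
  by (auto intro: Bochner_Integration.integrable_sum Bochner_Integration.integral_sum)

text \<open>Parseval in \<open>x\<close> only: by Fubini the exponentials are integrated out, and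
  their orthogonality leaves the diagonal terms.\<close>

lemma inner_aux_supported:
  assumes f: "supported M f" and g: "supported M g"
  shows "inner_aux f g = of_real (2 * pi) * (\<Sum>m\<in>M. LINT y:{0..2 * pi}|lborel. cnj (coef f m y) * coef g m y)"
proof -
  let ?J = "{0..<2 * pi}"
  let ?e = "\<lambda>k x. exp (\<i> * of_int k * complex_of_real x)"
  have fin: "finite M" using f by (simp add: supported_def)
  have contf: "continuous_on A (coef f m)" and contg: "continuous_on A (coef g m)" for m A
    using f g by (simp_all add: supported_def smooth_circle_continuous)
  define F where "F m n y = cnj (coef f m y) * coef g n y" for m n y
  have contF: "continuous_on A (F m n)" for m n A
    unfolding F_def by (intro continuous_intros contf contg)
  have prod: "cnj (f (x, y)) * g (x, y) = (\<Sum>m\<in>M. \<Sum>n\<in>M. ?e (n - m) x * F m n y)" for x y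
  proof -
    have "f (x, y) = (\<Sum>m\<in>M. ?e m x * coef f m y)" "g (x, y) = (\<Sum>m\<in>M. ?e m x * coef g m y)"
      using f g unfolding supported_def fourier_sum_def by (metis (no_types, lifting) case_prod_conv)+
    moreover have "cnj (?e m x) * ?e n x = ?e (n - m) x" for m n
      by (simp add: exp_cnj exp_add[symmetric] algebra_simps)
    then have "(cnj (?e m x) * cnj (coef f m y)) * (?e n x * coef g n y) = ?e (n - m) x * F m n y" for m n
      unfolding F_def by (metis mult.assoc mult.commute)
    ultimately show ?thesis
      by (simp add: sum_product)
  qed
  have cont: "continuous_on A (\<lambda>z. \<Sum>m\<in>M. \<Sum>n\<in>M. ?e (n - m) (fst z) * F m n (snd z))" for A
    by (intro continuous_intros continuous_on_compose2[OF contF[of UNIV]]) auto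
  define G where "G z = (\<Sum>m\<in>M. \<Sum>n\<in>M. ?e (n - m) (fst z) * F m n (snd z))" for z
  have "inner_aux f g = (LINT z|torus. G z)"
    unfolding inner_aux_def G_def by (intro arg_cong[where f = "integral\<^sup>L torus"] ext) (auto simp: prod)
  also have "\<dots> = (LINT z|lborel. indicator (?J \<times> ?J) z *\<^sub>R G z)"
    unfolding torus_def by (rule integral_restrict_space) (auto simp: borel_Times)
  also have "\<dots> = (LINT z|(lborel \<Otimes>\<^sub>M lborel). indicator (?J \<times> ?J) z *\<^sub>R G z)"
    by (simp add: lborel_prod)
  also have "\<dots> = (LINT x|lborel. LINT y|lborel. indicator (?J \<times> ?J) (x, y) *\<^sub>R G (x, y))"
  proof (rule lborel_pair.integral_fst'[symmetric])
    have "compact ({0..2 * pi} \<times> {0..2 * pi})" by (intro compact_Times) auto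
    then have "set_integrable lborel ({0..2 * pi} \<times> {0..2 * pi}) G"
      unfolding set_integrable_def G_def by (rule borel_integrable_compact[OF _ cont])
    then have "set_integrable lborel (?J \<times> ?J) G"
      by (rule set_integrable_subset) (auto simp: borel_Times)
    then show "integrable (lborel \<Otimes>\<^sub>M lborel) (\<lambda>z. indicator (?J \<times> ?J) z *\<^sub>R G z)"
      by (simp add: set_integrable_def lborel_prod)
  qed
  also have "\<dots> = (LINT x:?J|lborel. LINT y:?J|lborel. G (x, y))"
    unfolding set_lebesgue_integral_def
    by (intro arg_cong[where f = "integral\<^sup>L lborel"] ext)
      (simp add: indicator_times flip: scaleR_scaleR)
  also have "\<dots> = (LINT x:{0..2 * pi}|lborel. LINT y:{0..2 * pi}|lborel. G (x, y))"
    by (simp only: set_integral_Ico)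
  also have "(\<lambda>x. LINT y:{0..2 * pi}|lborel. G (x, y)) = (\<lambda>x. \<Sum>m\<in>M. \<Sum>n\<in>M. ?e (n - m) x * (LINT y:{0..2 * pi}|lborel. F m n y))"
  proof
    fix x
    have "set_integrable lborel {0..2 * pi} (\<lambda>y. ?e (n - m) x * F m n y)" for m n
      by (intro borel_integrable_atLeastAtMost' continuous_intros contF)
    then show "(LINT y:{0..2 * pi}|lborel. G (x, y)) = (\<Sum>m\<in>M. \<Sum>n\<in>M. ?e (n - m) x * (LINT y:{0..2 * pi}|lborel. F m n y))"
      unfolding G_def fst_conv snd_conv using fin
      by (simp add: set_integral_sum set_integrable_sum)
  qed
  also have "(LINT x:{0..2 * pi}|lborel. \<Sum>m\<in>M. \<Sum>n\<in>M. ?e (n - m) x * (LINT y:{0..2 * pi}|lborel. F m n y)) =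
    (\<Sum>m\<in>M. \<Sum>n\<in>M. (LINT x:{0..2 * pi}|lborel. ?e (n - m) x) * (LINT y:{0..2 * pi}|lborel. F m n y))"
  proof -
    have "set_integrable lborel {0..2 * pi} (\<lambda>x. ?e (n - m) x * (LINT y:{0..2 * pi}|lborel. F m n y))" for m n
      by (intro borel_integrable_atLeastAtMost' continuous_intros)
    then show ?thesis using fin
      by (simp add: set_integral_sum set_integrable_sum)
  qed
  also have "\<dots> = (\<Sum>m\<in>M. \<Sum>n\<in>M. if n = m then of_real (2 * pi) * (LINT y:{0..2 * pi}|lborel. F m n y) else 0)"
    unfolding set_integral_exp by (intro sum.cong refl) auto
  also have "\<dots> = of_real (2 * pi) * (\<Sum>m\<in>M. LINT y:{0..2 * pi}|lborel. F m m y)"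
    using fin by (simp add: sum.delta sum_distrib_left)
  finally show ?thesis by (simp add: F_def)
qed

lemma eta_supported:
  assumes "supported M f" "supported M g"
  shows "eta R l f g = (2 * pi)\<^sup>2 * (\<Sum>m\<in>M. \<Sum>y\<in>Y R l (nat \<bar>m\<bar>).
    cnj (coef f m y) * coef g m y / of_real (\<bar>nth_deriv (label_order l) R y\<bar> powr (1 / real (label_order l))))"
proof -
  let ?t = "\<lambda>m. \<Sum>y\<in>Y R l (nat \<bar>m\<bar>). cnj (coef f m y) * coef g m y / complex_of_real (\<bar>nth_deriv (label_order l) R y\<bar> powr (1 / real (label_order l)))"
  have "(\<Sum>\<^sub>\<infinity>m\<in>UNIV. ?t m) = (\<Sum>\<^sub>\<infinity>m\<in>M. ?t m)"
    using assms by (intro infsum_cong_neutral) (auto simp: supported_def)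
  also have "\<dots> = (\<Sum>m\<in>M. ?t m)"
    using assms by (intro infsum_finite) (simp add: supported_def)
  finally show ?thesis
    using supported_test_space[OF assms(2)] by (simp add: eta_def)
qed

text \<open>The sides are arranged as in the definition of the adjoint, with \<open>g\<close> in the
  antilinear slot. The intertwining property follows from this by conjugation, since
  \<open>eta\<close> is real.\<close>

lemma eta_intertwines:
  assumes R: "standing_assumptions R"
    and orders: "\<And>p d. p \<in> orders R \<Longrightarrow> d dvd p \<Longrightarrow> real d < real p / 2 \<Longrightarrow> d \<notin> orders R"
    and l: "l \<in> labels R" and A: "A \<in> observables R"
    and test: "f \<in> test_space" "g \<in> test_space" "Af \<in> test_space" "Ag \<in> test_space"
    and Af: "(f, Af) \<in> A" and Ag: "(g, Ag) \<in> adjoint_op A"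
  shows "eta R l g Af = eta R l Ag f"
proof -
  obtain M1 M2 where "supported M1 f" "supported M1 g" "supported M2 Af" "supported M2 Ag"
    using test by (metis test_space_supported2)
  then obtain M where M: "supported M f" "supported M g" "supported M Af" "supported M Ag"
    using supported_mono[of _ _ "M1 \<union> M2"] by (metis Un_upper1 Un_upper2 finite_UnI supported_def)
  note smooth = standing_assumptions_smooth[OF R]
  have fin: "finite M" using M(1) by (simp add: supported_def)
  \<comment> \<open>The density of (g, A f) - (A^* g, f) at frequency \<open>m\<close>; evolving
    \<open>f\<close> and \<open>A f\<close> multiplies it by a phase.\<close>
  define W where "W m y = cnj (coef g m y) * coef Af m y + (- 1) * (cnj (coef Ag m y) * coef f m y)" for m y
  have cnj: "smooth_circle (\<lambda>y. cnj (coef h m y))" if "supported M h" for h m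
    using that by (intro smooth_circle_linear[OF bounded_linear_cnj]) (simp add: supported_def)
  have W: "smooth_circle (W m)" for m
    unfolding W_def using M
    by (intro smooth_circle_add smooth_circle_mult cnj smooth_circle_const) (auto simp: supported_def)
  have "(\<Sum>m\<in>M. \<Sum>y\<in>Y R l (nat \<bar>m\<bar>). W m y /
    of_real (\<bar>nth_deriv (label_order l) R y\<bar> powr (1 / real (label_order l)))) = 0"
  proof (rule weighted_sum_vanishes[OF R orders fin W _ l])
    fix t :: real
    let ?e = "\<lambda>m y. exp (\<i> * of_real t * complex_of_real (R y - (of_int m)\<^sup>2))"
    \<comment> \<open>Commutation with the evolution, read on the graph: the evolved pair may be
      inserted into the adjoint relation of \<open>g\<close>.\<close>
    have "(evol R t f, evol R t Af) \<in> A"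
      using A test Af unfolding observables_def by blast
    then have "inner_aux g (evol R t Af) = inner_aux Ag (evol R t f)"
      using Ag unfolding adjoint_op_def by blast
    then have "(\<Sum>m\<in>M. LINT y:{0..2 * pi}|lborel. cnj (coef g m y) * coef (evol R t Af) m y) =
      (\<Sum>m\<in>M. LINT y:{0..2 * pi}|lborel. cnj (coef Ag m y) * coef (evol R t f) m y)"
      using M by (simp add: inner_aux_supported supported_evol(1)[OF smooth])
    moreover have "exp (- \<i> * of_real (t * ((of_int m)\<^sup>2 - R y))) = ?e m y" for m y
      by (simp add: algebra_simps)
    ultimately have eq: "(\<Sum>m\<in>M. LINT y:{0..2 * pi}|lborel. cnj (coef g m y) * (?e m y * coef Af m y)) =
      (\<Sum>m\<in>M. LINT y:{0..2 * pi}|lborel. cnj (coef Ag m y) * (?e m y * coef f m y))"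
      using M by (simp add: supported_evol(2)[OF smooth])
    have cont: "continuous_on {0..2 * pi} (\<lambda>y. cnj (coef h m y) * (?e m y * coef k m y))"
      if "supported M h" "supported M k" for h k m
      using that smooth by (intro continuous_intros smooth_circle_continuous) (auto simp: supported_def)
    have "(LINT y:{0..2 * pi}|lborel. W m y * ?e m y) =
      (LINT y:{0..2 * pi}|lborel. cnj (coef g m y) * (?e m y * coef Af m y)) -
      (LINT y:{0..2 * pi}|lborel. cnj (coef Ag m y) * (?e m y * coef f m y))" for m
    proof -
      have "W m y * ?e m y = cnj (coef g m y) * (?e m y * coef Af m y) - cnj (coef Ag m y) * (?e m y * coef f m y)" for y
        by (simp add: W_def algebra_simps)
      then show ?thesis
        using set_integral_diff(2)[OF borel_integrable_atLeastAtMost'[OF cont[OF M(2,3)]] borel_integrable_atLeastAtMost'[OF cont[OF M(4,1)]]]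
        by simp
    qed
    then show "(\<Sum>m\<in>M. LINT y:{0..2 * pi}|lborel. W m y * ?e m y) = 0"
      using eq by (simp add: sum_subtractf)
  qed
  moreover have "W m y / c = cnj (coef g m y) * coef Af m y / c - cnj (coef Ag m y) * coef f m y / c" for m y c
    by (simp add: W_def diff_divide_distrib)
  ultimately show ?thesis
    using M by (simp add: eta_supported sum_subtractf)
qed

subsection \<open>The rigging maps\<close>

lemma test_space_supported3:
  assumes "f \<in> test_space" "g \<in> test_space" "h \<in> test_space"
  obtains M where "supported M f" "supported M g" "supported M h"
proof -
  obtain M N where M: "supported M f" "supported M g" and N: "supported N h"
    using assms by (metis test_space_supported test_space_supported2)
  moreover from this have "finite (M \<union> N)" by (simp add: supported_def)
  ultimately have "supported (M \<union> N) f" "supported (M \<union> N) g" "supported (M \<union> N) h"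
    by (simp_all add: supported_mono)
  then show thesis by (rule that)
qed

lemma eta_outside: "g \<notin> test_space \<Longrightarrow> eta R l f g = 0"
  by (simp add: eta_def)

lemma eta_add_left:
  assumes "f \<in> test_space" "g \<in> test_space"
  shows "eta R l (f + g) = eta R l f + eta R l g"
proof
  fix h
  show "eta R l (f + g) h = (eta R l f + eta R l g) h"
  proof (cases "h \<in> test_space")
    case True
    with assms obtain M where M: "supported M f" "supported M g" "supported M h"
      by (metis test_space_supported3)
    show ?thesis
      unfolding plus_fun_apply eta_supported[OF supported_add(1)[OF M(1,2)] M(3)] eta_supported[OF M(1,3)]
        eta_supported[OF M(2,3)] supported_add(2)[OF M(1,2)]
      by (simp add: add_divide_distrib distrib_right sum.distrib distrib_left)
  qed (simp add: eta_outside)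
qed

lemma eta_add_right:
  assumes "f \<in> test_space" "g \<in> test_space" "h \<in> test_space"
  shows "eta R l f (g + h) = eta R l f g + eta R l f h"
proof -
  from assms obtain M where M: "supported M f" "supported M g" "supported M h"
    by (metis test_space_supported3)
  show ?thesis
    unfolding eta_supported[OF M(1) supported_add(1)[OF M(2,3)]] eta_supported[OF M(1,2)]
      eta_supported[OF M(1,3)] supported_add(2)[OF M(2,3)]
    by (simp add: add_divide_distrib distrib_left sum.distrib)
qed

lemma eta_scale_left:
  assumes "f \<in> test_space"
  shows "eta R l (\<lambda>z. a * f z) = (\<lambda>h. cnj a * eta R l f h)"
proof
  fix h
  show "eta R l (\<lambda>z. a * f z) h = cnj a * eta R l f h"
  proof (cases "h \<in> test_space")
    case True
    with assms obtain M where M: "supported M f" "supported M h"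
      by (metis test_space_supported2)
    show ?thesis
      unfolding eta_supported[OF supported_scale(1)[OF M(1)] M(2)] eta_supported[OF M] supported_scale(2)[OF M(1)]
      by (simp add: sum_distrib_left mult_ac)
  qed (simp add: eta_outside)
qed

lemma eta_scale_right:
  assumes "f \<in> test_space" "g \<in> test_space"
  shows "eta R l f (\<lambda>z. a * g z) = a * eta R l f g"
proof -
  from assms obtain M where M: "supported M f" "supported M g"
    by (metis test_space_supported2)
  show ?thesis
    unfolding eta_supported[OF M(1) supported_scale(1)[OF M(2)]] eta_supported[OF M] supported_scale(2)[OF M(2)]
    by (simp add: sum_distrib_left mult_ac)
qed

lemma eta_real:
  assumes "f \<in> test_space" "g \<in> test_space"
  shows "eta R l f g = cnj (eta R l g f)"
proof -
  from assms obtain M where "supported M f" "supported M g"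
    by (metis test_space_supported2)
  then show ?thesis by (simp add: eta_supported mult.commute)
qed

text \<open>Multiplying the second argument by a real weight \<psi> turns the pairing into a
  weighted sum of squares. Weight 1 gives positivity, and a weight vanishing at chosen points will
  separate the images.\<close>

lemma eta_self:
  assumes f: "supported M f" and g: "supported M (fourier_sum M (\<lambda>m y. of_real (\<psi> y) * coef f m y))"
  shows "eta R l f (fourier_sum M (\<lambda>m y. of_real (\<psi> y) * coef f m y)) = of_real ((2 * pi)\<^sup>2 *
    (\<Sum>m\<in>M. \<Sum>y\<in>Y R l (nat \<bar>m\<bar>). \<psi> y * (cmod (coef f m y))\<^sup>2 / \<bar>nth_deriv (label_order l) R y\<bar> powr (1 / real (label_order l))))"
proof -
  have fin: "finite M" using f by (simp add: supported_def)
  have "cnj z * (of_real x * z) = of_real (x * (cmod z)\<^sup>2)" for x :: real and z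
    by (simp only: of_real_mult complex_norm_square mult_ac)
  then have key: "cnj (coef f m y) * coef (fourier_sum M (\<lambda>m y. of_real (\<psi> y) * coef f m y)) m y / of_real w =
    of_real (\<psi> y * (cmod (coef f m y))\<^sup>2 / w)" if "m \<in> M" for m y and w :: real
    by (simp only: coef_fourier_sum[OF fin] that if_True of_real_divide)
  have "(\<Sum>m\<in>M. \<Sum>y\<in>Y R l (nat \<bar>m\<bar>).
      cnj (coef f m y) * coef (fourier_sum M (\<lambda>m y. of_real (\<psi> y) * coef f m y)) m y /
        of_real (\<bar>nth_deriv (label_order l) R y\<bar> powr (1 / real (label_order l)))) =
    of_real (\<Sum>m\<in>M. \<Sum>y\<in>Y R l (nat \<bar>m\<bar>). \<psi> y * (cmod (coef f m y))\<^sup>2 /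
        \<bar>nth_deriv (label_order l) R y\<bar> powr (1 / real (label_order l)))"
    unfolding of_real_sum by (intro sum.cong refl key)
  then show ?thesis
    unfolding eta_supported[OF f g] of_real_mult by simp
qed

lemma supported_times:
  assumes f: "supported M f" and \<psi>: "smooth_circle \<psi>"
  shows "supported M (fourier_sum M (\<lambda>m y. \<psi> y * coef f m y))"
  using f by (intro supported_fourier_sum(1)) (auto simp: supported_def intro: smooth_circle_mult \<psi>)

text \<open>At the points summed over, R y = m^2, so the phase of the evolution is 1.\<close>

lemma eta_evol:
  assumes R: "smooth_circle R" and l: "l \<in> labels R" and "f \<in> test_space" "g \<in> test_space"
  shows "eta R l f (evol R t g) = eta R l f g"
proof -
  from assms obtain M where M: "supported M f" "supported M g"
    by (metis test_space_supported2)
  have "exp (- \<i> * complex_of_real (t * ((of_int m)\<^sup>2 - R y))) = 1" if "y \<in> Y R l (nat \<bar>m\<bar>)" for m y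
    using that square_nat_abs[of m] by (simp add: Y_iff(1)[OF l])
  then show ?thesis
    unfolding eta_supported[OF M(1) supported_evol(1)[OF R M(2)]] eta_supported[OF M] supported_evol(2)[OF R M(2)]
    by (simp cong: sum.cong)
qed

lemma rigging_map_eta:
  assumes R: "standing_assumptions R"
    and orders: "\<And>p d. p \<in> orders R \<Longrightarrow> d dvd p \<Longrightarrow> real d < real p / 2 \<Longrightarrow> d \<notin> orders R"
    and l: "l \<in> labels R"
  shows "rigging_map R (eta R l)"
  unfolding rigging_map_def
proof (intro conjI ballI allI impI)
  fix f assume f: "f \<in> test_space"
  show "eta R l f \<in> test_dual"
    using f by (auto simp: test_dual_def eta_outside eta_add_right eta_scale_right)
  obtain M where M: "supported M f" using f by (rule test_space_supported)
  have "eta R l f f = of_real ((2 * pi)\<^sup>2 *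
    (\<Sum>m\<in>M. \<Sum>y\<in>Y R l (nat \<bar>m\<bar>). 1 * (cmod (coef f m y))\<^sup>2 / \<bar>nth_deriv (label_order l) R y\<bar> powr (1 / real (label_order l))))"
    using eta_self[OF M, of "\<lambda>_. 1"] M by (simp add: supported_def)
  then show "eta R l f f \<in> \<real>\<^sub>\<ge>\<^sub>0"
    by (auto intro!: mult_nonneg_nonneg sum_nonneg simp del: of_real_mult)
next
  fix A f g Af Ag
  assume A: "A \<in> observables R" and test: "f \<in> test_space" "g \<in> test_space" "Af \<in> test_space" "Ag \<in> test_space"
    and Af: "(f, Af) \<in> A" and Ag: "(g, Ag) \<in> adjoint_op A"
  have "eta R l g Af = eta R l Ag f"
    by (rule eta_intertwines[OF R orders l A test Af Ag])
  then show "eta R l Af g = eta R l f Ag"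
    using eta_real test by metis
next
  fix f g t assume "f \<in> test_space" "g \<in> test_space"
  then show "eta R l f g = cnj (eta R l g f)" "eta R l f (evol R t g) = eta R l f g"
    by (rule eta_real, rule eta_evol[OF standing_assumptions_smooth[OF R] l])
qed (simp_all add: eta_add_left eta_scale_left)

section \<open>Nontrivial and finite-dimensional images\<close>

lemma finite_Y:
  assumes R: "standing_assumptions R" and l: "l \<in> labels R"
  shows "finite (Y R l q)"
proof (rule finite_subset)
  show "Y R l q \<subseteq> {y \<in> {0..2 * pi}. R y = (real q)\<^sup>2}"
    by (auto simp: Y_iff(1)[OF l])
  show "finite {y \<in> {0..2 * pi}. R y = (real q)\<^sup>2}"
    by (rule finite_level[OF standing_assumptions_smooth[OF R] critical_point_stat_order[OF R]])
qed

lemma weight_pos: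
  assumes R: "standing_assumptions R" and l: "l \<in> labels R" and y: "y \<in> Y R l q"
  shows "\<bar>nth_deriv (label_order l) R y\<bar> powr (1 / real (label_order l)) > 0"
  using critical_point.lead[OF critical_point_stat_order[OF R, of y]] y by (simp add: Y_iff(1)[OF l])

text \<open>An order may be witnessed by any real y; for odd labels the witness is moved into the
  fundamental domain, and for even labels the claim is part of \<open>labels\<close>.\<close>

lemma Y_nonempty:
  assumes R: "standing_assumptions R" and l: "l \<in> labels R"
  shows "\<exists>q. Y R l q \<noteq> {}"
proof (cases l)
  case (Odd p)
  then obtain q y where y: "(real q)\<^sup>2 = R y" "p = stat_order R y"
    using l by (auto simp: labels_def orders_def)
  obtain k where k: "y + 2 * pi * of_int k \<in> {0..<2 * pi}" by (rule ex_representative)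
  have "nth_deriv n R (y + 2 * pi * of_int k) = nth_deriv n R y" for n
    by (rule periodic_int) (rule nth_deriv_periodic[OF standing_assumptions_smooth[OF R]])
  from this this[of 0] have "y + 2 * pi * of_int k \<in> Y R l q"
    using y k by (simp add: Odd stat_order_def)
  then show ?thesis by blast
next
  case (Even p \<epsilon>)
  then show ?thesis using l by (auto simp: labels_def)
qed

text \<open>R is bounded on the circle, and R y = m^2 gives |m| <= m^2 <= B for the integer
  m.\<close>

lemma finite_points:
  assumes R: "standing_assumptions R" and l: "l \<in> labels R"
  shows "finite {m :: int. Y R l (nat \<bar>m\<bar>) \<noteq> {}}"
proof -
  have "bounded (R ` {0..2 * pi})"
    using smooth_circle_continuous[OF standing_assumptions_smooth[OF R]]
    by (intro compact_imp_bounded compact_continuous_image) auto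
  then obtain B where "\<forall>y\<in>{0..2 * pi}. \<bar>R y\<bar> \<le> B"
    by (auto simp: bounded_iff)
  then have B: "\<bar>R y\<bar> \<le> B" if "y \<in> {0..2 * pi}" for y
    using that by blast
  have "{m :: int. Y R l (nat \<bar>m\<bar>) \<noteq> {}} \<subseteq> {- \<lceil>B\<rceil>..\<lceil>B\<rceil>}"
  proof
    fix m :: int assume "m \<in> {m. Y R l (nat \<bar>m\<bar>) \<noteq> {}}"
    then obtain y where "y \<in> {0..2 * pi}" "R y = (of_int m)\<^sup>2"
      using square_nat_abs[of m] by (fastforce simp: Y_iff(1)[OF l])
    then have "(of_int m)\<^sup>2 \<le> B" using B[of y] by simp
    moreover have "\<bar>m\<bar> \<le> \<bar>m\<bar> * \<bar>m\<bar>"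
      using mult_left_mono[of 1 "\<bar>m\<bar>" "\<bar>m\<bar>"] by (cases "m = 0") auto
    then have "\<bar>m\<bar> \<le> m\<^sup>2" by (simp add: power2_eq_square)
    then have "real_of_int \<bar>m\<bar> \<le> (of_int m)\<^sup>2" by (metis of_int_le_iff of_int_power)
    ultimately have "real_of_int \<bar>m\<bar> \<le> B" by linarith
    then have "\<bar>m\<bar> \<le> \<lceil>B\<rceil>" by linarith
    then show "m \<in> {- \<lceil>B\<rceil>..\<lceil>B\<rceil>}" by auto
  qed
  then show ?thesis by (rule finite_subset) simp
qed

lemma eta_nontrivial:
  assumes R: "standing_assumptions R" and l: "l \<in> labels R"
  shows "eta R l ` test_space \<noteq> {0}"
proof
  assume trivial: "eta R l ` test_space = {0}"
  obtain q where q: "Y R l q \<noteq> {}" using Y_nonempty[OF R l] by blast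
  \<comment> \<open>The pure mode exp(iqx): its value \<open>eta R l f f\<close> is a nonempty sum
    of positive weights.\<close>
  define f where "f = fourier_sum {int q} (\<lambda>_ _. 1)"
  have f: "supported {int q} f" "coef f (int q) = (\<lambda>_. 1)"
    unfolding f_def by (auto simp: coef_fourier_sum intro!: supported_fourier_sum(1) smooth_circle_const)
  have "eta R l f f = of_real ((2 * pi)\<^sup>2 *
    (\<Sum>y\<in>Y R l q. 1 / \<bar>nth_deriv (label_order l) R y\<bar> powr (1 / real (label_order l))))"
    by (simp add: eta_supported[OF f(1) f(1)] f(2))
  moreover have "(\<Sum>y\<in>Y R l q. 1 / \<bar>nth_deriv (label_order l) R y\<bar> powr (1 / real (label_order l))) > 0"
    using q finite_Y[OF R l] weight_pos[OF R l] by (intro sum_pos) auto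
  ultimately have "eta R l f f \<noteq> 0"
    by (metis less_irrefl mult_pos_pos of_real_eq_0_iff pi_gt_zero zero_less_numeral zero_less_power)
  moreover have "eta R l f = 0"
    using trivial supported_test_space[OF f(1)] by blast
  ultimately show False by simp
qed

lemma sum_functional_apply: "(\<Sum>i\<in>I. F i) x = (\<Sum>i\<in>I. F i x)" for F :: "'i \<Rightarrow> functional"
  by (induction I rule: infinite_finite_induct) auto

text \<open>Every functional in the image is a combination of evaluations of Fourier coefficients at
  the finitely many relevant points. The definition asks for a spanning set inside the image, so a
  maximal independent subset of the image is taken, and the evaluations bound its size.\<close>

lemma eta_finite_dimensional:
  assumes R: "standing_assumptions R" and l: "l \<in> labels R"
  shows "finite_dimensional (eta R l ` test_space)"
proof -
  define N where "N = {m :: int. Y R l (nat \<bar>m\<bar>) \<noteq> {}}"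
  have N: "finite N" unfolding N_def by (rule finite_points[OF R l])
  define P where "P = Sigma N (\<lambda>m. Y R l (nat \<bar>m\<bar>))"
  have P: "finite P" unfolding P_def using N finite_Y[OF R l] by auto
  define e :: "int \<times> real \<Rightarrow> functional" where
    "e z g = (if g \<in> test_space then coef g (fst z) (snd z) else 0)" for z g
  have "eta R l f \<in> functionals.span (e ` P)" if f: "f \<in> test_space" for f
  proof -
    define w where "w z = (2 * pi)\<^sup>2 * cnj (coef f (fst z) (snd z)) /
      of_real (\<bar>nth_deriv (label_order l) R (snd z)\<bar> powr (1 / real (label_order l)))" for z
    have "eta R l f = (\<Sum>z\<in>P. (\<lambda>g. w z * e z g))"
    proof
      fix g
      show "eta R l f g = (\<Sum>z\<in>P. (\<lambda>g. w z * e z g)) g"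
      proof (cases "g \<in> test_space")
        case True
        with f obtain M0 where M0: "supported M0 f" "supported M0 g"
          by (metis test_space_supported2)
        define M where "M = M0 \<union> N"
        have finM: "finite M" using M0 N by (simp add: M_def supported_def)
        have M: "supported M f" "supported M g"
          using M0 finM by (auto intro: supported_mono simp: M_def)
        have "eta R l f g = (\<Sum>m\<in>M. \<Sum>y\<in>Y R l (nat \<bar>m\<bar>). w (m, y) * e (m, y) g)"
          using True unfolding eta_supported[OF M] by (simp add: w_def e_def sum_distrib_left mult.assoc)
        also have "\<dots> = (\<Sum>(m, y)\<in>Sigma M (\<lambda>m. Y R l (nat \<bar>m\<bar>)). w (m, y) * e (m, y) g)"
          using finM finite_Y[OF R l] by (intro sum.Sigma) auto
        also have "Sigma M (\<lambda>m. Y R l (nat \<bar>m\<bar>)) = P"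
          by (auto simp: P_def M_def N_def)
        finally show ?thesis by (simp add: sum_functional_apply case_prod_beta)
      qed (simp add: sum_functional_apply e_def eta_outside)
    qed
    then show ?thesis
      by (simp only:) (intro functionals.span_sum functionals.span_scale functionals.span_base imageI)
  qed
  then have span: "eta R l ` test_space \<subseteq> functionals.span (e ` P)" by blast
  obtain B where B: "B \<subseteq> eta R l ` test_space" "functionals.independent B"
    "eta R l ` test_space \<subseteq> functionals.span B"
    by (rule functionals.maximal_independent_subset)
  have "finite B"
    using functionals.independent_span_bound[of "e ` P" B] P B span by blast
  with B show ?thesis unfolding finite_dimensional_def by blast
qed

section \<open>Separation of the images of different labels\<close>

lemma Y_disjoint:
  assumes "l \<in> labels R" "l' \<in> labels R" "y \<in> Y R l q" "y \<in> Y R l' q'"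
  shows "l = l'"
  using assms by (cases l; cases l') (auto simp: labels_def)

text \<open>Suppose \<xi> is the image of f under one map and of f' under the other. Evaluated at
  \<psi> f, with \<psi> vanishing at the points where f' is sampled, \<xi> gives 0 by the second
  description and a sum of squares with positive weights by the first. Hence f vanishes wherever the
  first map samples it.\<close>

lemma eta_images_intersect_trivially:
  assumes R: "standing_assumptions R" and l: "l \<in> labels R" and l': "l' \<in> labels R" and neq: "l \<noteq> l'"
  shows "eta R l ` test_space \<inter> eta R l' ` test_space = {0}"
proof (intro equalityI subsetI)
  fix \<xi> assume "\<xi> \<in> {0 :: functional}"
  define f where "f = fourier_sum {} (\<lambda>_ _. 0)"
  have f: "f \<in> test_space"
    unfolding f_def by (rule supported_test_space[OF supported_fourier_sum(1)]) auto
  \<comment> \<open>The zero functional lies in both images, as the value at 0 times a test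
    function.\<close>
  then have "(\<lambda>z. 0 * f z) \<in> test_space"
    using test_space_supported supported_scale(1) supported_test_space by metis
  moreover have "eta R k (\<lambda>z. 0 * f z) = 0" for k
    using eta_scale_left[OF f, of R k 0] by (simp add: fun_eq_iff)
  ultimately show "\<xi> \<in> eta R l ` test_space \<inter> eta R l' ` test_space"
    using \<open>\<xi> \<in> {0}\<close> by (auto intro!: image_eqI[of _ _ "\<lambda>z. 0 * f z"])
next
  fix \<xi> assume "\<xi> \<in> eta R l ` test_space \<inter> eta R l' ` test_space"
  then obtain f f' where f: "f \<in> test_space" "\<xi> = eta R l f" and f': "f' \<in> test_space" "\<xi> = eta R l' f'"
    by blast
  obtain M where M: "supported M f" "supported M f'"
    using f f' by (metis test_space_supported2)
  have finM: "finite M" using M by (simp add: supported_def)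
  define Q where "Q = (\<Union>m\<in>M. Y R l' (nat \<bar>m\<bar>))"
  have Q: "finite Q" unfolding Q_def using finM finite_Y[OF R l'] by auto
  \<comment> \<open>Each factor vanishes on the circle only at its \<open>b\<close>. Since a point
    determines its label, even across frequencies, the product stays positive at all points of the
    label \<open>l\<close>.\<close>
  define \<psi> where "\<psi> y = (\<Prod>b\<in>Q. 1 - cos (y - b))" for y
  have \<psi>_smooth: "smooth_circle (\<lambda>y. complex_of_real (\<psi> y))"
  proof -
    have "smooth_circle (\<lambda>y. \<Prod>b\<in>Q. 1 + (- 1) * complex_of_real (cos (y - b)))"
      by (intro smooth_circle_prod smooth_circle_add smooth_circle_mult smooth_circle_const smooth_circle_cos)
    then show ?thesis by (simp add: \<psi>_def)
  qed
  define g where "g = fourier_sum M (\<lambda>m y. of_real (\<psi> y) * coef f m y)"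
  have g: "supported M g" unfolding g_def by (rule supported_times[OF M(1) \<psi>_smooth])
  have "eta R l' f' g = 0"
  proof -
    have "coef g m y = 0" if "m \<in> M" "y \<in> Y R l' (nat \<bar>m\<bar>)" for m y
    proof -
      have "y \<in> Q" using that by (auto simp: Q_def)
      then have "\<psi> y = 0" unfolding \<psi>_def using Q by (intro prod_zero bexI[of _ y]) auto
      then show ?thesis by (simp add: g_def coef_fourier_sum[OF finM])
    qed
    then show ?thesis by (simp add: eta_supported[OF M(2) g])
  qed
  then have "eta R l f g = 0" using f f' by simp
  then have zero: "(\<Sum>m\<in>M. \<Sum>y\<in>Y R l (nat \<bar>m\<bar>). \<psi> y * (cmod (coef f m y))\<^sup>2 /
      \<bar>nth_deriv (label_order l) R y\<bar> powr (1 / real (label_order l))) = 0"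
    using eta_self[OF M(1) g[unfolded g_def], of R l] unfolding g_def by (simp del: of_real_mult of_real_sum)
  have \<psi>_nonneg: "\<psi> y \<ge> 0" for y
    unfolding \<psi>_def by (intro prod_nonneg) simp
  have \<psi>_pos: "\<psi> y > 0" if y: "y \<in> Y R l q" for y q
    unfolding \<psi>_def
  proof (intro prod_pos)
    fix b assume "b \<in> Q"
    then obtain q' where b: "b \<in> Y R l' q'" by (auto simp: Q_def)
    then have "y \<noteq> b" using Y_disjoint[OF l l'] y neq by blast
    have "y \<in> {0..<2 * pi}" "b \<in> {0..<2 * pi}"
      using y b by (auto simp: Y_iff(1)[OF l] Y_iff(1)[OF l'])
    then have range: "\<bar>y - b\<bar> < 2 * pi" by auto
    have "cos (y - b) \<noteq> 1"
    proof
      assume "cos (y - b) = 1"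
      then obtain n :: int where n: "y - b = of_int n * 2 * pi"
        by (auto simp: cos_one_2pi_int)
      then have "\<bar>real_of_int n\<bar> * (2 * pi) < 1 * (2 * pi)"
        using range by (simp add: abs_mult)
      then have "\<bar>real_of_int n\<bar> < 1" by (rule mult_right_less_imp_less) simp
      then have "n = 0" by linarith
      with n \<open>y \<noteq> b\<close> show False by simp
    qed
    then show "0 < 1 - cos (y - b)" using cos_le_one[of "y - b"] by linarith
  qed
  have nonneg: "\<psi> y * (cmod (coef f m y))\<^sup>2 / \<bar>nth_deriv (label_order l) R y\<bar> powr (1 / real (label_order l)) \<ge> 0" for m y
    by (intro divide_nonneg_nonneg mult_nonneg_nonneg \<psi>_nonneg) simp_all
  have coef_zero: "coef f m y = 0" if m: "m \<in> M" and y: "y \<in> Y R l (nat \<bar>m\<bar>)" for m y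
  proof -
    have "(\<Sum>y\<in>Y R l (nat \<bar>m\<bar>). \<psi> y * (cmod (coef f m y))\<^sup>2 /
      \<bar>nth_deriv (label_order l) R y\<bar> powr (1 / real (label_order l))) = 0"
      using zero m by (subst (asm) sum_nonneg_eq_0_iff[OF finM]) (auto intro!: sum_nonneg nonneg)
    then have "\<psi> y * (cmod (coef f m y))\<^sup>2 / \<bar>nth_deriv (label_order l) R y\<bar> powr (1 / real (label_order l)) = 0"
      using y by (subst (asm) sum_nonneg_eq_0_iff[OF finite_Y[OF R l]]) (auto intro!: nonneg)
    then show ?thesis
      using \<psi>_pos[OF y] weight_pos[OF R l y] by auto
  qed
  have "\<xi> h = 0" for h
  proof (cases "h \<in> test_space")
    case True
    obtain K where K: "supported K f" "supported K h"
      using f(1) True by (metis test_space_supported2)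
    have "coef f m y = 0" if "y \<in> Y R l (nat \<bar>m\<bar>)" for m y
      using coef_zero[OF _ that] M(1) by (cases "m \<in> M") (auto simp: supported_def)
    then show ?thesis
      by (simp add: f(2) eta_supported[OF K])
  qed (simp add: f(2) eta_outside)
  then show "\<xi> \<in> {0}" by (simp add: fun_eq_iff)
qed

theorem mainTheorem2:
  fixes R :: "real \<Rightarrow> real"
  assumes "standing_assumptions R"
    and "\<exists>(q::nat) y. (real q)\<^sup>2 = R y"
    and "\<And>p d. p \<in> orders R \<Longrightarrow> d dvd p \<Longrightarrow> real d < real p / 2 \<Longrightarrow> d \<notin> orders R"
  shows "(\<forall>l \<in> labels R.
            rigging_map R (eta R l) \<and>
            eta R l ` test_space \<noteq> {0} \<and>
            finite_dimensional (eta R l ` test_space)) \<and>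
         (\<forall>l \<in> labels R. \<forall>l' \<in> labels R. l \<noteq> l' \<longrightarrow>
            eta R l ` test_space \<inter> eta R l' ` test_space = {0})"
  using rigging_map_eta[OF assms(1,3)] eta_nontrivial[OF assms(1)]
    eta_finite_dimensional[OF assms(1)] eta_images_intersect_trivially[OF assms(1)] by simp

end
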